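(* There is a polynomial time reduction from the problem of deciding whether Eve wins a parity game to the problem of deciding whether Eve wins a unary-encoded interval mean-payoff game (one in which all weights and interval endpoints are encoded in unary).
   Context: A game graph is a tuple $G=(V,V_\exists,E,w,q_0)$ where $(V,E)$ is a finite directed graph in which every vertex has an outgoing edge, $w:E\to\mathbb{Z}$ is an integer edge-weight function, $V_\exists\subseteq V$ are Eve's vertices (the rest are Adam's), and $q_0\in V$ is the initial vertex. A play is an infinite path $\pi=v_0v_1\cdots$ with $v_0=q_0$; write $w(\pi[..k])=\sum_{i=0}^{k-1}w(v_i,v_{i+1})$. A strategy for a player maps finite play prefixes ending in one of that player's vertices to a successor vertex. A player wins a game if they have a strategy such that every play consistent with it is winning for them. The (liminf) mean-payoff is $\underline{MP}(\pi)=\liminf_{k\to\infty}\frac1k w(\pi[..k])$; in an interval mean-payoff game $(G,I)$, with $I$ a finite union of real intervals, a play is winning for Eve iff $\underline{MP}(\pi)\in I$ and winning for Adam otherwise. A parity game is a pair $(G,\Omega)$ with $G$ a game graph (weights ignored) and $\Omega:V\to\mathbb{N}$ a priority function; a play is winning for Eve iff the minimal priority occurring infinitely often is even. *)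

theory Defs
  imports Complex_Main "HOL-Library.Extended_Real"
begin

definition is_play :: "(nat \<times> nat) set \<Rightarrow> nat \<Rightarrow> (nat \<Rightarrow> nat) \<Rightarrow> bool" where
  "is_play E q0 \<pi> \<longleftrightarrow> \<pi> 0 = q0 \<and> (\<forall>i. (\<pi> i, \<pi> (Suc i)) \<in> E)"

definition legal_strategy :: "(nat \<times> nat) set \<Rightarrow> nat set \<Rightarrow> (nat list \<Rightarrow> nat) \<Rightarrow> bool" where
  "legal_strategy E VE \<sigma> \<longleftrightarrow> (\<forall>h. h \<noteq> [] \<and> last h \<in> VE \<longrightarrow> (last h, \<sigma> h) \<in> E)"

definition consistent_with :: "nat set \<Rightarrow> (nat list \<Rightarrow> nat) \<Rightarrow> (nat \<Rightarrow> nat) \<Rightarrow> bool" where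
  "consistent_with VE \<sigma> \<pi> \<longleftrightarrow> (\<forall>i. \<pi> i \<in> VE \<longrightarrow> \<pi> (Suc i) = \<sigma> (map \<pi> [0..<Suc i]))"

definition eve_wins :: "(nat \<times> nat) set \<Rightarrow> nat set \<Rightarrow> nat \<Rightarrow> ((nat \<Rightarrow> nat) \<Rightarrow> bool) \<Rightarrow> bool" where
  "eve_wins E VE q0 Win \<longleftrightarrow>
     (\<exists>\<sigma>. legal_strategy E VE \<sigma> \<and>
          (\<forall>\<pi>. is_play E q0 \<pi> \<and> consistent_with VE \<sigma> \<pi> \<longrightarrow> Win \<pi>))"

record parity_game =
  pg_n :: nat
  pg_eve :: "bool list"
  pg_edges :: "(nat \<times> nat) list"
  pg_prio :: "nat list"
  pg_init :: nat

definition wf_pg :: "parity_game \<Rightarrow> bool" where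
  "wf_pg G \<longleftrightarrow> length (pg_eve G) = pg_n G \<and> length (pg_prio G) = pg_n G
     \<and> (\<forall>(u,v) \<in> set (pg_edges G). u < pg_n G \<and> v < pg_n G)
     \<and> (\<forall>u < pg_n G. \<exists>v. (u,v) \<in> set (pg_edges G))
     \<and> pg_init G < pg_n G"

definition pg_eve_vertices :: "parity_game \<Rightarrow> nat set" where
  "pg_eve_vertices G = {u. u < pg_n G \<and> pg_eve G ! u}"

definition parity_winning :: "parity_game \<Rightarrow> (nat \<Rightarrow> nat) \<Rightarrow> bool" where
  "parity_winning G \<pi> \<longleftrightarrow>
     even (Min {p. infinite {i. pg_prio G ! (\<pi> i) = p}})"

definition pg_eve_wins :: "parity_game \<Rightarrow> bool" where
  "pg_eve_wins G \<longleftrightarrow> eve_wins (set (pg_edges G)) (pg_eve_vertices G) (pg_init G) (parity_winning G)"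

text \<open>A bound of an interval: unbounded, or a rational endpoint num/den (den > 0),
closed or open.\<close>
datatype bound = Unbounded | Bnd bool int nat

fun lower_ok :: "bound \<Rightarrow> real \<Rightarrow> bool" where
  "lower_ok Unbounded x = True"
| "lower_ok (Bnd c p q) x = (if c then real_of_int p / real q \<le> x else real_of_int p / real q < x)"

fun upper_ok :: "bound \<Rightarrow> real \<Rightarrow> bool" where
  "upper_ok Unbounded x = True"
| "upper_ok (Bnd c p q) x = (if c then x \<le> real_of_int p / real q else x < real_of_int p / real q)"

fun bound_wf :: "bound \<Rightarrow> bool" where
  "bound_wf Unbounded = True"
| "bound_wf (Bnd c p q) = (q > 0)"

definition interval_union :: "(bound \<times> bound) list \<Rightarrow> real set" where
  "interval_union I = (\<Union>(lo,hi) \<in> set I. {x. lower_ok lo x \<and> upper_ok hi x})"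

record imp_game =
  ig_n :: nat
  ig_eve :: "bool list"
  ig_edges :: "(nat \<times> nat \<times> int) list"
  ig_init :: nat
  ig_intervals :: "(bound \<times> bound) list"

definition ig_edge_set :: "imp_game \<Rightarrow> (nat \<times> nat) set" where
  "ig_edge_set G = (\<lambda>(u,v,w). (u,v)) ` set (ig_edges G)"

definition wf_imp :: "imp_game \<Rightarrow> bool" where
  "wf_imp G \<longleftrightarrow> length (ig_eve G) = ig_n G
     \<and> (\<forall>(u,v,w) \<in> set (ig_edges G). u < ig_n G \<and> v < ig_n G)
     \<and> distinct (map (\<lambda>(u,v,w). (u,v)) (ig_edges G))
     \<and> (\<forall>u < ig_n G. \<exists>v. (u,v) \<in> ig_edge_set G)
     \<and> ig_init G < ig_n G
     \<and> (\<forall>(lo,hi) \<in> set (ig_intervals G). bound_wf lo \<and> bound_wf hi)"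

definition ig_weight :: "imp_game \<Rightarrow> nat \<Rightarrow> nat \<Rightarrow> int" where
  "ig_weight G u v = (THE w. (u,v,w) \<in> set (ig_edges G))"

definition ig_eve_vertices :: "imp_game \<Rightarrow> nat set" where
  "ig_eve_vertices G = {u. u < ig_n G \<and> ig_eve G ! u}"

definition prefix_weight :: "imp_game \<Rightarrow> (nat \<Rightarrow> nat) \<Rightarrow> nat \<Rightarrow> int" where
  "prefix_weight G \<pi> k = (\<Sum>i<k. ig_weight G (\<pi> i) (\<pi> (Suc i)))"

text \<open>liminf of the averages, as an extended real (it is finite, since weights are bounded).\<close>
definition lim_inf_mp :: "imp_game \<Rightarrow> (nat \<Rightarrow> nat) \<Rightarrow> ereal" where
  "lim_inf_mp G \<pi> = liminf (\<lambda>k. ereal (real_of_int (prefix_weight G \<pi> k) / real k))"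

definition imp_winning :: "imp_game \<Rightarrow> (nat \<Rightarrow> nat) \<Rightarrow> bool" where
  "imp_winning G \<pi> \<longleftrightarrow> (\<exists>r. lim_inf_mp G \<pi> = ereal r \<and> r \<in> interval_union (ig_intervals G))"

definition imp_eve_wins :: "imp_game \<Rightarrow> bool" where
  "imp_eve_wins G \<longleftrightarrow> eve_wins (ig_edge_set G) (ig_eve_vertices G) (ig_init G) (imp_winning G)"

text \<open>Self-delimiting binary encoding of naturals (used for structural data and,
for parity games, for priorities).\<close>
fun enc_bin :: "nat \<Rightarrow> bool list" where
  "enc_bin n = (if n = 0 then [False] else [True, odd n] @ enc_bin (n div 2))"

definition enc_un :: "nat \<Rightarrow> bool list" where
  "enc_un n = replicate n True @ [False]"

definition enc_int_un :: "int \<Rightarrow> bool list" where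
  "enc_int_un z = [z < 0] @ enc_un (nat \<bar>z\<bar>)"

definition enc_list :: "('a \<Rightarrow> bool list) \<Rightarrow> 'a list \<Rightarrow> bool list" where
  "enc_list e xs = enc_bin (length xs) @ concat (map e xs)"

definition enc_pg :: "parity_game \<Rightarrow> bool list" where
  "enc_pg G = enc_bin (pg_n G) @ enc_list (\<lambda>b. [b]) (pg_eve G)
     @ enc_list (\<lambda>(u,v). enc_bin u @ enc_bin v) (pg_edges G)
     @ enc_list enc_bin (pg_prio G) @ enc_bin (pg_init G)"

fun enc_bound_un :: "bound \<Rightarrow> bool list" where
  "enc_bound_un Unbounded = [False]"
| "enc_bound_un (Bnd c p q) = [True, c] @ enc_int_un p @ enc_un q"

definition enc_imp_unary :: "imp_game \<Rightarrow> bool list" where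
  "enc_imp_unary G = enc_bin (ig_n G) @ enc_list (\<lambda>b. [b]) (ig_eve G)
     @ enc_list (\<lambda>(u,v,w). enc_bin u @ enc_bin v @ enc_int_un w) (ig_edges G)
     @ enc_bin (ig_init G)
     @ enc_list (\<lambda>(lo,hi). enc_bound_un lo @ enc_bound_un hi) (ig_intervals G)"

definition PARITY :: "bool list set" where
  "PARITY = {enc_pg G | G. wf_pg G \<and> pg_eve_wins G}"

definition UNARY_IMP :: "bool list set" where
  "UNARY_IMP = {enc_imp_unary G | G. wf_imp G \<and> imp_eve_wins G}"

text \<open>States 0..<nstates, state 0 initial, state 1 halting. Tape symbols 0..<nsyms,
0 = blank, 1 = bit False, 2 = bit True. Moves are -1, 0, 1.\<close>
record tm =
  tm_nstates :: nat
  tm_nsyms :: nat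
  tm_delta :: "nat \<Rightarrow> nat \<Rightarrow> nat \<times> nat \<times> int"

definition wf_tm :: "tm \<Rightarrow> bool" where
  "wf_tm M \<longleftrightarrow> tm_nsyms M \<ge> 3 \<and> tm_nstates M \<ge> 2 \<and>
     (\<forall>q < tm_nstates M. \<forall>s < tm_nsyms M.
        (case tm_delta M q s of (q', s', d) \<Rightarrow> q' < tm_nstates M \<and> s' < tm_nsyms M \<and> d \<in> {-1, 0, 1}))"

type_synonym config = "nat \<times> int \<times> (int \<Rightarrow> nat)"

definition tm_step :: "tm \<Rightarrow> config \<Rightarrow> config" where
  "tm_step M c = (case c of (q, p, tp) \<Rightarrow>
     if q = 1 then (q, p, tp)
     else (case tm_delta M q (tp p) of (q', s', d) \<Rightarrow> (q', p + d, tp(p := s'))))"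

definition bitsym :: "bool \<Rightarrow> nat" where
  "bitsym b = (if b then 2 else 1)"

definition init_config :: "bool list \<Rightarrow> config" where
  "init_config w = (0, 0, \<lambda>i. if 0 \<le> i \<and> i < int (length w) then bitsym (w ! nat i) else 0)"

definition computes_in_time :: "tm \<Rightarrow> (bool list \<Rightarrow> bool list) \<Rightarrow> (nat \<Rightarrow> nat) \<Rightarrow> bool" where
  "computes_in_time M f T \<longleftrightarrow> (\<forall>w. \<exists>t \<le> T (length w).
     (case (tm_step M ^^ t) (init_config w) of (q, p, tp) \<Rightarrow>
        q = 1 \<and> (\<forall>i < length (f w). tp (p + int i) = bitsym (f w ! i))
        \<and> tp (p + int (length (f w))) = 0))"

definition poly_time_computable :: "(bool list \<Rightarrow> bool list) \<Rightarrow> bool" where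
  "poly_time_computable f \<longleftrightarrow>
     (\<exists>M c k. wf_tm M \<and> computes_in_time M f (\<lambda>n. c * n ^ k + c))"

definition poly_time_reduces :: "bool list set \<Rightarrow> bool list set \<Rightarrow> bool" where
  "poly_time_reduces A B \<longleftrightarrow> (\<exists>f. poly_time_computable f \<and> (\<forall>w. w \<in> A \<longleftrightarrow> f w \<in> B))"

end

theory Submission
  imports Defs
begin

text \<open>Replace every edge \<open>(u, v)\<close> of the parity game by a vertex with a self-loop of weight
  \<open>c\<close>, where \<open>c\<close> has the parity of the priority of \<open>u\<close> and grows with it, while all other edges
  get a weight above every \<open>c\<close>. The self-loop belongs to Eve iff \<open>c\<close> is even, and Eve has to bring
  the lower mean payoff into the union of the intervals \<open>(2 j, 2 j + 1]\<close>. Looping forever gives the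
  value \<open>c\<close>, which is lost for the owner of the loop. An owner who loops exactly while the average is
  above \<open>c + 1/2\<close> forces the value \<open>c + 1/2\<close> if \<open>c\<close> is the least colour seen infinitely often.
  Replacing priorities by twice their rank plus their parity keeps the weights linear in the number of
  vertices, even though priorities are given in binary.

  For the running time, stack programs are simulated on one tape with one track per stack. Values are
  trees, stored in preorder on a stack, so that the functions computable in polynomial time are
  closed under pairing, case distinction and folds with additive growth. Malformed inputs are recognised
  by re-encoding the parsed game and comparing.\<close>

section \<open>Stack machines\<close>

text \<open>The value is forced although only one player follows the looping rule. Put
  \<open>D = 2 * weight - (2 * c + 1) * steps\<close>, with \<open>c\<close> the least colour seen
  infinitely often. From some point on, loops of larger colour and all edges of the top weight raise
  \<open>D\<close>; only a loop of colour \<open>c\<close> lowers it, by exactly 1, and the rule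
  permits this only while \<open>D > 0\<close>. So \<open>D\<close> is eventually nonnegative, and
  it is at most 0 whenever such a loop is left. The liminf is therefore \<open>c + 1/2\<close>,
  whatever the opponent does on his own loops, as long as he leaves them. The half-open intervals
  contain \<open>c\<close> iff \<open>c\<close> is odd and \<open>c + 1/2\<close> iff
  \<open>c\<close> is even, so staying forever and obeying the rule have opposite outcomes. Loops
  sit on separate edge vertices because their owner depends on the colour and not on who owns the
  source. One estimate serves both directions: Eve obeys on even loops when a parity strategy is
  translated, and a scripted Adam obeys on odd loops when a mean-payoff strategy is translated
  back.\<close>

datatype reg = RI | RA | RB | RC | RK | RF

type_synonym store = "reg \<Rightarrow> bool list"

text \<open>Jump distances are relative to the current instruction, so that code can be
  concatenated without relocation.\<close>
datatype instr = Push reg bool | Pop reg int int int | Jmp int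

fun istep :: "instr \<Rightarrow> int \<times> store \<Rightarrow> int \<times> store" where
  "istep (Push r b) (pc, s) = (pc + 1, s(r := b # s r))"
| "istep (Jmp d) (pc, s) = (pc + d, s)"
| "istep (Pop r e f t) (pc, s) = (case s r of [] \<Rightarrow> (pc + e, s)
      | b # xs \<Rightarrow> (pc + (if b then t else f), s(r := xs)))"

inductive runs :: "instr list \<Rightarrow> int \<times> store \<Rightarrow> nat \<Rightarrow> int \<times> store \<Rightarrow> bool" for P where
  runs_refl: "runs P c 0 c"
| runs_step: "0 \<le> pc \<Longrightarrow> pc < int (length P) \<Longrightarrow> runs P (istep (P ! nat pc) (pc, s)) t c'
    \<Longrightarrow> runs P (pc, s) (Suc t) c'"

lemma runs_trans: "runs P c t c' \<Longrightarrow> runs P c' u c'' \<Longrightarrow> runs P c (t + u) c''"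
  by (induction rule: runs.induct) (auto intro: runs_step)

lemma runs_one: "0 \<le> pc \<Longrightarrow> pc < int (length P) \<Longrightarrow> istep (P ! nat pc) (pc, s) = c' \<Longrightarrow> runs P (pc, s) 1 c'"
  using runs_step[OF _ _ runs_refl] by auto

lemma istep_shift: "istep i (d + pc, s) = (case istep i (pc, s) of (pc', s') \<Rightarrow> (d + pc', s'))"
  by (cases i) (auto split: list.split)

text \<open>A step is taken only while the counter lies inside \<open>P\<close>, so the surrounding
  code is never executed, and relative jumps act alike at every offset.\<close>

lemma runs_shift:
  assumes "runs P c t c'"
  shows "runs (A @ P @ B) (int (length A) + fst c, snd c) t (int (length A) + fst c', snd c')"
  using assms
proof (induction rule: runs.induct)
  case (runs_step pc s t c')
  have "nat (int (length A) + pc) = length A + nat pc" using runs_step by auto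
  then have nth: "(A @ P @ B) ! nat (int (length A) + pc) = P ! nat pc"
    using runs_step by (auto simp: nth_append)
  show ?case using runs_step
    by (auto intro!: runs.runs_step simp: nth istep_shift split: prod.splits)
qed (auto intro: runs.intros)

section \<open>Programs that run off their end: step bounds and structured control flow\<close>

definition exec :: "instr list \<Rightarrow> store \<Rightarrow> store \<Rightarrow> nat \<Rightarrow> bool" where
  "exec P s s' T \<longleftrightarrow> (\<exists>t \<le> T. runs P (0, s) t (int (length P), s'))"

lemma exec_mono: "exec P s s' T \<Longrightarrow> T \<le> U \<Longrightarrow> exec P s s' U"
  unfolding exec_def by (meson le_trans)

lemma exec_Nil: "exec [] s s 0"
  unfolding exec_def by (auto intro: runs_refl)

lemma exec_embed:
  assumes "exec P s s' T"
  shows "\<exists>t \<le> T. runs (A @ P @ B) (int (length A), s) t (int (length A) + int (length P), s')"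
proof -
  obtain t where t: "t \<le> T" "runs P (0, s) t (int (length P), s')" using assms exec_def by auto
  show ?thesis using runs_shift[OF t(2), of A B] t(1) by auto
qed

lemma exec_append:
  assumes "exec P s s' T" "exec Q s' s'' U"
  shows "exec (P @ Q) s s'' (T + U)"
proof -
  obtain t where t: "t \<le> T" "runs (P @ Q) (0, s) t (int (length P), s')"
    using exec_embed[OF assms(1), of "[]" Q] by auto
  obtain u where u: "u \<le> U" "runs (P @ Q) (int (length P), s') u (int (length (P @ Q)), s'')"
    using exec_embed[OF assms(2), of P "[]"] by auto
  show ?thesis unfolding exec_def using runs_trans[OF t(2) u(2)] t(1) u(1) by (meson add_mono)
qed

lemma exec_Push: "exec [Push r b] s (s(r := b # s r)) 1"
  unfolding exec_def by (auto intro!: exI[of _ 1] runs_one[of 0, unfolded One_nat_def])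

text \<open>The constants account for the \<open>Pop\<close> and the two separating jumps:
  \<open>Pf\<close> starts at offset \<open>2 + length Pe\<close>, \<open>Pt\<close> one jump after
  the end of \<open>Pf\<close>, and both jumps lead past \<open>Pt\<close>.\<close>

definition caseC :: "reg \<Rightarrow> instr list \<Rightarrow> instr list \<Rightarrow> instr list \<Rightarrow> instr list" where
  "caseC r Pe Pf Pt = Pop r 1 (2 + int (length Pe)) (3 + int (length Pe) + int (length Pf))
     # Pe @ Jmp (2 + int (length Pf) + int (length Pt)) # Pf @ Jmp (1 + int (length Pt)) # Pt"

lemma exec_caseC_Nil:
  assumes "s r = []" "exec Pe s s' T"
  shows "exec (caseC r Pe Pf Pt) s s' (T + 2)"
proof -
  let ?P = "caseC r Pe Pf Pt"
  have 1: "runs ?P (0, s) 1 (1, s)" by (rule runs_one) (auto simp: caseC_def assms)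
  obtain t where t: "t \<le> T" "runs ?P (1, s) t (1 + int (length Pe), s')"
    using exec_embed[OF assms(2), of "[hd ?P]"
      "Jmp (2 + int (length Pf) + int (length Pt)) # Pf @ Jmp (1 + int (length Pt)) # Pt"]
    by (auto simp: caseC_def)
  have 3: "runs ?P (1 + int (length Pe), s') 1 (int (length ?P), s')"
    by (rule runs_one) (auto simp: caseC_def nth_append nat_add_distrib)
  show ?thesis unfolding exec_def using runs_trans[OF runs_trans[OF 1 t(2)] 3] t(1)
    by (intro exI[of _ "1 + t + 1"]) auto
qed

lemma exec_caseC_False:
  assumes "s r = False # xs" "exec Pf (s(r := xs)) s' T"
  shows "exec (caseC r Pe Pf Pt) s s' (T + 2)"
proof -
  let ?P = "caseC r Pe Pf Pt"
  have 1: "runs ?P (0, s) 1 (2 + int (length Pe), s(r := xs))"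
    by (rule runs_one) (auto simp: caseC_def assms)
  obtain t where t: "t \<le> T"
    "runs ?P (2 + int (length Pe), s(r := xs)) t (2 + int (length Pe) + int (length Pf), s')"
    using exec_embed[OF assms(2), of "hd ?P # Pe @ [Jmp (2 + int (length Pf) + int (length Pt))]"
      "Jmp (1 + int (length Pt)) # Pt"]
    by (auto simp: caseC_def algebra_simps)
  have 3: "runs ?P (2 + int (length Pe) + int (length Pf), s') 1 (int (length ?P), s')"
    by (rule runs_one) (auto simp: caseC_def nth_append nth_Cons' nat_add_distrib)
  show ?thesis unfolding exec_def using runs_trans[OF runs_trans[OF 1 t(2)] 3] t(1)
    by (intro exI[of _ "1 + t + 1"]) auto
qed

lemma exec_caseC_True:
  assumes "s r = True # xs" "exec Pt (s(r := xs)) s' T"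
  shows "exec (caseC r Pe Pf Pt) s s' (T + 2)"
proof -
  let ?P = "caseC r Pe Pf Pt"
  have 1: "runs ?P (0, s) 1 (3 + int (length Pe) + int (length Pf), s(r := xs))"
    by (rule runs_one) (auto simp: caseC_def assms)
  obtain t where t: "t \<le> T"
    "runs ?P (3 + int (length Pe) + int (length Pf), s(r := xs)) t (int (length ?P), s')"
    using exec_embed[OF assms(2), of "hd ?P # Pe @ Jmp (2 + int (length Pf) + int (length Pt)) # Pf @ [Jmp (1 + int (length Pt))]"
      "[]"]
    by (auto simp: caseC_def algebra_simps)
  show ?thesis unfolding exec_def using runs_trans[OF 1 t(2)] t(1)
    by (intro exI[of _ "1 + t"]) auto
qed

text \<open>A do-while loop: the body runs first and asks for another round by leaving
  \<open>True\<close> on \<open>r\<close>.\<close>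

definition loopC :: "reg \<Rightarrow> instr list \<Rightarrow> instr list" where
  "loopC r P = P @ [Pop r 1 1 (- int (length P))]"

lemma exec_loopC_exit:
  assumes "exec P s s' T" "s' r = []"
  shows "exec (loopC r P) s s' (T + 1)"
proof -
  obtain t where t: "t \<le> T" "runs (loopC r P) (0, s) t (int (length P), s')"
    using exec_embed[OF assms(1), of "[]"] by (auto simp: loopC_def)
  have "runs (loopC r P) (int (length P), s') 1 (int (length (loopC r P)), s')"
    by (rule runs_one) (auto simp: loopC_def assms)
  from runs_trans[OF t(2) this] show ?thesis using t(1)
    unfolding exec_def by (intro exI[of _ "t + 1"]) auto
qed

lemma exec_loopC_repeat:
  assumes "exec P s s1 T" "s1 r = True # xs" "exec (loopC r P) (s1(r := xs)) s' U"
  shows "exec (loopC r P) s s' (T + 1 + U)"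
proof -
  obtain t where t: "t \<le> T" "runs (loopC r P) (0, s) t (int (length P), s1)"
    using exec_embed[OF assms(1), of "[]"] by (auto simp: loopC_def)
  have 2: "runs (loopC r P) (int (length P), s1) 1 (0, s1(r := xs))"
    by (rule runs_one) (auto simp: loopC_def assms)
  obtain u where u: "u \<le> U" "runs (loopC r P) (0, s1(r := xs)) u (int (length (loopC r P)), s')"
    using assms(3) exec_def by auto
  show ?thesis unfolding exec_def using runs_trans[OF runs_trans[OF t(2) 2] u(2)] t(1) u(1)
    by (intro exI[of _ "t + 1 + u"]) auto
qed

text \<open>An instruction pushes at most one bit, so a time bound also bounds every stack. Both the
  cost of the simulation and the output size of \<open>pt\<close> functions rest on this.\<close>

lemma runs_length: "runs P c t c' \<Longrightarrow> length (snd c' r) \<le> length (snd c r) + t"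
proof (induction rule: runs.induct)
  case (runs_step pc s t c')
  have "length (snd (istep (P ! nat pc) (pc, s)) r) \<le> length (s r) + 1"
    by (cases "P ! nat pc") (auto split: list.split)
  with runs_step show ?case by auto
qed auto

lemma exec_length: "exec P s s' T \<Longrightarrow> length (s' r) \<le> length (s r) + T"
  unfolding exec_def using runs_length[of P "(0, s)" _ _ r] by fastforce

section \<open>Simulating a stack machine by a Turing machine\<close>

text \<open>One tape symbol holds a base-3 digit per track: 0 for blank, 1 and 2 for the bits.
  \<open>RI\<close> is the lowest digit, so the input tape already is the tape of the stack
  \<open>RI\<close> with all other stacks empty; six tracks give \<open>3 ^ 6 = 729\<close>
  symbols.\<close>

definition cell_enc :: "(reg \<Rightarrow> nat) \<Rightarrow> nat" where
  "cell_enc f = f RI + 3 * (f RA + 3 * (f RB + 3 * (f RC + 3 * (f RK + 3 * f RF))))"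

primrec reg_index :: "reg \<Rightarrow> nat" where
  "reg_index RI = 0"
| "reg_index RA = Suc 0"
| "reg_index RB = Suc (Suc 0)"
| "reg_index RC = Suc (Suc (Suc 0))"
| "reg_index RK = Suc (Suc (Suc (Suc 0)))"
| "reg_index RF = Suc (Suc (Suc (Suc (Suc 0))))"

definition cell_dec :: "nat \<Rightarrow> reg \<Rightarrow> nat" where
  "cell_dec c r = ((\<lambda>x. x div 3) ^^ reg_index r) c mod 3"

lemma cell_dec_enc: "(\<And>r. f r < 3) \<Longrightarrow> cell_dec (cell_enc f) = f"
proof
  fix r assume a: "\<And>r. f r < 3"
  have d: "(f r + 3 * x) div 3 = x" for r x using a[of r] by simp
  have m: "(f r + 3 * x) mod 3 = f r" for r x using a[of r] by simp
  have n: "f r mod 3 = f r" for r using a[of r] by simp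
  show "cell_dec (cell_enc f) r = f r"
    by (cases r) (simp_all only: cell_enc_def cell_dec_def reg_index.simps
        funpow.simps o_apply id_apply d m n)
qed

lemma cell_dec_less: "cell_dec c r < 3"
  by (simp add: cell_dec_def)

lemma cell_enc_less: "(\<And>r. f r < 3) \<Longrightarrow> cell_enc f < 729"
proof -
  assume a: "\<And>r. f r < 3"
  show ?thesis using a[of RI] a[of RA] a[of RB] a[of RC] a[of RK] a[of RF]
    unfolding cell_enc_def by (simp add: algebra_simps)
qed

lemma cell_enc_eq_0_iff: "cell_enc f = 0 \<longleftrightarrow> (\<forall>r. f r = 0)"
  unfolding cell_enc_def by (auto, metis reg.exhaust)

text \<open>Every stack has its bottom at cell 0 and its top at the right end, so a push or pop
  touches one cell; the negative cells stay blank and act as a left end marker.\<close>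

definition sym_at :: "bool list \<Rightarrow> int \<Rightarrow> nat" where
  "sym_at xs i = (if 0 \<le> i \<and> i < int (length xs) then bitsym (rev xs ! nat i) else 0)"

definition tape_of :: "store \<Rightarrow> int \<Rightarrow> nat" where
  "tape_of s i = cell_enc (\<lambda>r. sym_at (s r) i)"

lemma sym_at_less: "sym_at xs i < 3"
  by (auto simp: sym_at_def bitsym_def)

lemma cell_dec_tape_of: "cell_dec (tape_of s i) r = sym_at (s r) i"
  unfolding tape_of_def by (subst cell_dec_enc) (auto simp: sym_at_less)

lemma sym_at_eq_0_iff: "sym_at xs i = 0 \<longleftrightarrow> \<not> (0 \<le> i \<and> i < int (length xs))"
  by (auto simp: sym_at_def bitsym_def)

lemma tape_of_neg: "i < 0 \<Longrightarrow> tape_of s i = 0"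
  by (auto simp: tape_of_def cell_enc_eq_0_iff sym_at_eq_0_iff)

lemma tape_of_pos: "0 \<le> i \<Longrightarrow> i < int (length (s r)) \<Longrightarrow> tape_of s i > 0"
  by (metis cell_enc_eq_0_iff gr0I sym_at_eq_0_iff tape_of_def)

lemma tape_of_update:
  assumes "\<And>j. j \<noteq> i \<Longrightarrow> sym_at xs j = sym_at (s r) j" "sym_at xs i = d"
  shows "(tape_of s)(i := cell_enc ((cell_dec (tape_of s i))(r := d))) = tape_of (s(r := xs))"
proof
  fix j
  show "((tape_of s)(i := cell_enc ((cell_dec (tape_of s i))(r := d)))) j = tape_of (s(r := xs)) j"
    using assms by (auto simp: tape_of_def cell_dec_tape_of[unfolded tape_of_def] intro!: arg_cong[of _ _ cell_enc])
qed

lemma sym_at_Cons: "j \<noteq> int (length xs) \<Longrightarrow> sym_at (b # xs) j = sym_at xs j"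
  "sym_at (b # xs) (int (length xs)) = bitsym b"
  by (auto simp: sym_at_def nth_append)

section \<open>The simulating transition function\<close>

definition tm_state :: "nat \<Rightarrow> nat \<Rightarrow> nat" where "tm_state pc ph = 2 + 4 * pc + ph"

definition tm_goto :: "instr list \<Rightarrow> int \<Rightarrow> nat" where
  "tm_goto P pc = (if 0 \<le> pc \<and> pc < int (length P) then tm_state (nat pc) 0 else 1)"

text \<open>Truncated subtraction decodes the initial state 0, like state 2, as instruction 0 in
  phase 0, so the machine starts directly with the first instruction.\<close>

definition tm_pc :: "nat \<Rightarrow> nat" where "tm_pc q = (q - 2) div 4"

definition tm_phase :: "nat \<Rightarrow> nat" where "tm_phase q = (q - 2) mod 4"

lemma tm_state_simps [simp]: "ph < 4 \<Longrightarrow> tm_pc (tm_state pc ph) = pc" "ph < 4 \<Longrightarrow> tm_phase (tm_state pc ph) = ph"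
  "tm_state pc ph \<noteq> 1" "tm_state pc ph \<noteq> Suc 0"
  by (simp_all add: tm_pc_def tm_phase_def tm_state_def)

text \<open>Phase 0 walks right to the top of the stack concerned; phases 1 to 3 walk back to the blank
  cell at position -1, phases 2 and 3 remembering the popped bit.\<close>
definition tm_trans :: "instr list \<Rightarrow> nat \<Rightarrow> nat \<Rightarrow> nat \<times> nat \<times> int" where
  "tm_trans P q c = (let pc = tm_pc q; ph = tm_phase q; back = (\<lambda>d. if c \<noteq> 0 then (tm_state pc ph, c, -1)
       else (tm_goto P (int pc + d), c, 1)) in
     case P ! pc of
       Push r b \<Rightarrow> if ph = 0 then (if cell_dec c r \<noteq> 0 then (tm_state pc 0, c, 1)
             else (tm_state pc 1, cell_enc ((cell_dec c)(r := bitsym b)), -1))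
           else back 1
     | Jmp d \<Rightarrow> (tm_goto P (int pc + d), c, 0)
     | Pop r e f t \<Rightarrow> if ph = 0 then (if cell_dec c r \<noteq> 0 then (tm_state pc 0, c, 1)
             else (tm_state pc 1, c, -1))
           else if ph = 1 then (if cell_dec c r = 0 then (tm_goto P (int pc + e), c, 1)
             else (tm_state pc (if cell_dec c r = 2 then 3 else 2), cell_enc ((cell_dec c)(r := 0)), -1))
           else back (if ph = 3 then t else f))"

definition tm_of :: "instr list \<Rightarrow> tm" where
  "tm_of P = \<lparr>tm_nstates = 2 + 4 * length P, tm_nsyms = 729, tm_delta = tm_trans P\<rparr>"

lemma wf_tm_of:
  assumes "P \<noteq> []"
  shows "wf_tm (tm_of P)"
proof -
  let ?n = "2 + 4 * length P"
  have st: "tm_state pc ph < ?n" if "pc < length P" "ph < 4" for pc ph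
    using that by (simp add: tm_state_def)
  have g: "tm_goto P pc < ?n" for pc
    using st[of "nat pc" 0] by (auto simp: tm_goto_def)
  have u: "cell_enc ((cell_dec c)(r := d)) < 729" if "d < 3" for c r d
    using that by (intro cell_enc_less) (auto simp: cell_dec_less)
  have b: "bitsym b < 3" for b by (simp add: bitsym_def)
  have H: "fst (tm_trans P q c) < ?n \<and> fst (snd (tm_trans P q c)) < 729 \<and> snd (snd (tm_trans P q c)) \<in> {-1, 0, 1}"
    if q: "q < ?n" and c: "c < 729" for q c
  proof -
    have "0 < length P" using assms by simp
    then have pc: "tm_pc q < length P" using q unfolding tm_pc_def by presburger
    have ph: "tm_phase q < 4" by (auto simp: tm_phase_def)
    show ?thesis
      by (cases "P ! tm_pc q") (simp_all add: tm_trans_def Let_def c g u b st[OF pc] st[OF pc ph]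
        del: add_2_eq_Suc)
  qed
  show ?thesis unfolding wf_tm_def tm_of_def tm.select_convs case_prod_beta
    by (intro conjI allI impI) (simp, simp, (erule (1) H[THEN conjunct1]
      H[THEN conjunct2, THEN conjunct1] H[THEN conjunct2, THEN conjunct2])+)
qed

lemma tm_steps_trans:
  "(tm_step M ^^ t) c = c' \<Longrightarrow> (tm_step M ^^ u) c' = c'' \<Longrightarrow> (tm_step M ^^ (t + u)) c = c''"
  by (simp add: add.commute[of t u] funpow_add)

lemma tm_step_tm_of: "q \<noteq> 1 \<Longrightarrow> tm_trans P q (tp p) = (q', c, d)
  \<Longrightarrow> tm_step (tm_of P) (q, p, tp) = (q', p + d, tp(p := c))"
  by (simp add: tm_step_def tm_of_def)

text \<open>The walk may start in the initial state 0, which merely decodes like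
  \<open>tm_state 0 0\<close>; hence states are described by \<open>tm_pc\<close> and
  \<open>tm_phase\<close>, and the final one is existential.\<close>

lemma tm_walk_right:
  assumes "(\<exists>b. P ! pc = Push r b) \<or> (\<exists>e f t. P ! pc = Pop r e f t)"
    and "k \<le> length (s r)" "q \<noteq> 1" "tm_pc q = pc" "tm_phase q = 0"
  shows "\<exists>q'. q' \<noteq> 1 \<and> tm_pc q' = pc \<and> tm_phase q' = 0 \<and>
    (tm_step (tm_of P) ^^ k) (q, 0, tape_of s) = (q', int k, tape_of s)"
  using assms(2)
proof (induction k)
  case 0
  show ?case using assms(3-5) by (intro exI[of _ q]) simp
next
  case (Suc k)
  then obtain q' where q': "q' \<noteq> 1" "tm_pc q' = pc" "tm_phase q' = 0"
    "(tm_step (tm_of P) ^^ k) (q, 0, tape_of s) = (q', int k, tape_of s)" by auto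
  have "cell_dec (tape_of s (int k)) r \<noteq> 0" using Suc by (simp add: cell_dec_tape_of sym_at_eq_0_iff)
  then have "tm_trans P q' (tape_of s (int k)) = (tm_state pc 0, tape_of s (int k), 1)"
    using q' assms(1) by (auto simp: tm_trans_def)
  from tm_step_tm_of[of q' P "tape_of s" "int k", OF q'(1) this]
  have "tm_step (tm_of P) (q', int k, tape_of s) = (tm_state pc 0, int (Suc k), tape_of s)"
    by (simp only: fun_upd_triv of_nat_Suc add.commute)
  then show ?case using q'(4) by (intro exI[of _ "tm_state pc 0"] conjI) simp_all
qed

text \<open>Below the height of any one stack all cells are nonblank, even where other stacks are
  shorter, so the first blank on the way left is cell -1.\<close>

lemma tm_walk_back:
  assumes "\<And>c. tm_trans P q c = (if c \<noteq> 0 then (q, c, -1) else (q', c, 1))"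
    and "k \<le> length (s r)" "q \<noteq> 1"
  shows "(tm_step (tm_of P) ^^ (k + 1)) (q, int k - 1, tape_of s) = (q', 0, tape_of s)"
  using assms(2)
proof (induction k)
  case 0
  have "tm_step (tm_of P) (q, -1, tape_of s) = (q', -1 + 1, (tape_of s)(-1 := tape_of s (-1)))"
    using assms(3) by (intro tm_step_tm_of) (auto simp: assms(1) tape_of_neg)
  then show ?case by simp
next
  case (Suc k)
  have "tm_step (tm_of P) (q, int k, tape_of s) = (q, int k + -1, (tape_of s)(int k := tape_of s (int k)))"
    using Suc tape_of_pos[of "int k" s r] assms(3) by (intro tm_step_tm_of) (auto simp: assms(1))
  then have "tm_step (tm_of P) (q, int k, tape_of s) = (q, int k - 1, tape_of s)" by simp
  then show ?case using Suc by (simp add: funpow_Suc_right del: funpow.simps)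
qed

lemma tm_simulates_instr:
  assumes "pc < length P" "q \<noteq> 1" "tm_pc q = pc" "tm_phase q = 0"
    and "istep (P ! pc) (int pc, s) = (pc', s')"
    and "\<And>r. length (s r) \<le> L"
  shows "\<exists>t \<le> 2 * L + 4. (tm_step (tm_of P) ^^ t) (q, 0, tape_of s) = (tm_goto P pc', 0, tape_of s')"
proof (cases "P ! pc")
  case (Jmp d)
  have "tm_step (tm_of P) (q, 0, tape_of s) = (tm_goto P pc', 0 + 0, (tape_of s)(0 := tape_of s 0))"
    using assms Jmp by (intro tm_step_tm_of) (auto simp: tm_trans_def)
  then show ?thesis using assms Jmp by (intro exI[of _ 1]) auto
next
  case (Push r b)
  let ?k = "length (s r)"
  obtain q1 where q1: "q1 \<noteq> 1" "tm_pc q1 = pc" "tm_phase q1 = 0"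
    "(tm_step (tm_of P) ^^ ?k) (q, 0, tape_of s) = (q1, int ?k, tape_of s)"
    using tm_walk_right[of P pc r ?k s q] assms Push by auto
  have s': "s' = s(r := b # s r)" "pc' = int pc + 1" using assms(5) Push by auto
  let ?c = "cell_enc ((cell_dec (tape_of s (int ?k)))(r := bitsym b))"
  have "tm_trans P q1 (tape_of s (int ?k)) = (tm_state pc 1, ?c, -1)"
    using q1 Push by (auto simp: tm_trans_def cell_dec_tape_of sym_at_eq_0_iff)
  from tm_step_tm_of[of q1 P "tape_of s" "int ?k", OF q1(1) this]
  have 2: "(tm_step (tm_of P) ^^ 1) (q1, int ?k, tape_of s) = (tm_state pc 1, int ?k - 1, tape_of s')"
    using tape_of_update[of "int ?k" "b # s r" s r "bitsym b"] by (auto simp: s' sym_at_Cons)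
  have 3: "(tm_step (tm_of P) ^^ (?k + 1)) (tm_state pc 1, int ?k - 1, tape_of s') = (tm_goto P pc', 0, tape_of s')"
  proof (rule tm_walk_back)
    show "?k \<le> length (s' r)" by (simp add: s')
  qed (use Push in \<open>auto simp: tm_trans_def s' Let_def\<close>)
  show ?thesis using tm_steps_trans[OF tm_steps_trans[OF q1(4) 2] 3] assms(6)[of r]
    by (intro exI[of _ "?k + 1 + (?k + 1)"]) auto
next
  case (Pop r e f t)
  let ?k = "length (s r)"
  obtain q1 where q1: "q1 \<noteq> 1" "tm_pc q1 = pc" "tm_phase q1 = 0"
    "(tm_step (tm_of P) ^^ ?k) (q, 0, tape_of s) = (q1, int ?k, tape_of s)"
    using tm_walk_right[of P pc r ?k s q] assms Pop by auto
  have "tm_trans P q1 (tape_of s (int ?k)) = (tm_state pc 1, tape_of s (int ?k), -1)"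
    using q1 Pop by (auto simp: tm_trans_def cell_dec_tape_of sym_at_eq_0_iff)
  from tm_step_tm_of[of q1 P "tape_of s" "int ?k", OF q1(1) this]
  have 2: "(tm_step (tm_of P) ^^ 1) (q1, int ?k, tape_of s) = (tm_state pc 1, int ?k - 1, tape_of s)"
    by simp
  note 12 = tm_steps_trans[OF q1(4) 2]
  show ?thesis
  proof (cases "s r")
    \<comment> \<open>The top of an empty stack would be cell -1; reading the blank there in phase 1
      is the emptiness test.\<close>
    case Nil
    then have s': "s' = s" "pc' = int pc + e" using assms(5) Pop by auto
    have "tm_trans P (tm_state pc 1) (tape_of s (-1)) = (tm_goto P pc', tape_of s (-1), 1)"
      using Pop by (auto simp: tm_trans_def cell_dec_tape_of sym_at_eq_0_iff s' Let_def)
    from tm_step_tm_of[of _ P "tape_of s" "-1", OF _ this]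
    have "(tm_step (tm_of P) ^^ 1) (tm_state pc 1, -1, tape_of s) = (tm_goto P pc', 0, tape_of s')"
      by (simp add: s')
    moreover have "(tm_step (tm_of P) ^^ 1) (q, 0, tape_of s) = (tm_state pc 1, -1, tape_of s)"
      using 12 Nil by simp
    ultimately have "(tm_step (tm_of P) ^^ (1 + 1)) (q, 0, tape_of s) = (tm_goto P pc', 0, tape_of s')"
      by (rule tm_steps_trans[rotated])
    then show ?thesis by (intro exI[of _ "1 + 1"] conjI) simp_all
  next
    case (Cons b xs)
    let ?j = "length xs"
    have s': "s' = s(r := xs)" "pc' = int pc + (if b then t else f)" using assms(5) Pop Cons by auto
    let ?c = "cell_enc ((cell_dec (tape_of s (int ?j)))(r := 0))"
    let ?q = "tm_state pc (if b then 3 else 2)"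
    have sa: "cell_dec (tape_of s (int ?j)) r = bitsym b"
      by (simp add: cell_dec_tape_of Cons sym_at_Cons)
    have "tm_trans P (tm_state pc 1) (tape_of s (int ?j)) = (?q, ?c, -1)"
      using Pop sa by (auto simp: tm_trans_def Let_def bitsym_def)
    from tm_step_tm_of[of _ P "tape_of s" "int ?j", OF _ this]
    have 3: "(tm_step (tm_of P) ^^ 1) (tm_state pc 1, int ?k - 1, tape_of s) = (?q, int ?j - 1, tape_of s')"
      using tape_of_update[of "int ?j" xs s r 0] Cons by (auto simp: s' sym_at_Cons sym_at_eq_0_iff)
    have 4: "(tm_step (tm_of P) ^^ (?j + 1)) (?q, int ?j - 1, tape_of s') = (tm_goto P pc', 0, tape_of s')"
    proof (rule tm_walk_back)
      show "?j \<le> length (s' r)" by (simp add: s')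
    qed (use Pop in \<open>auto simp: tm_trans_def s' Let_def\<close>)
    show ?thesis using tm_steps_trans[OF tm_steps_trans[OF 12 3] 4] assms(6)[of r] Cons
      by (intro exI[of _ "?k + 1 + 1 + (?j + 1)"]) auto
  qed
qed

lemma tm_simulates_runs:
  assumes "runs P c t c'" "0 \<le> fst c" "fst c < int (length P)" "fst c' = int (length P)"
    and "q \<noteq> 1" "tm_pc q = nat (fst c)" "tm_phase q = 0"
    and "\<And>r. length (snd c r) + t \<le> L"
  shows "\<exists>u \<le> t * (2 * L + 4). (tm_step (tm_of P) ^^ u) (q, 0, tape_of (snd c)) = (1, 0, tape_of (snd c'))"
  using assms
proof (induction arbitrary: q rule: runs.induct)
  case (runs_step pc s t c')
  obtain pc1 s1 where 1: "istep (P ! nat pc) (pc, s) = (pc1, s1)" by force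
  have "length (s r) \<le> L" for r using runs_step.prems(7)[of r] by simp
  then obtain u where u: "u \<le> 2 * L + 4"
    "(tm_step (tm_of P) ^^ u) (q, 0, tape_of s) = (tm_goto P pc1, 0, tape_of s1)"
    using tm_simulates_instr[of "nat pc" P q s pc1 s1 L] runs_step.prems runs_step.hyps 1
    by (auto simp: nat_less_iff)
  \<comment> \<open>A step adds at most one cell and uses up one unit of the remaining time, so
    \<open>L\<close> bounds the stacks throughout.\<close>
  have len: "length (s1 r) + t \<le> L" for r
    using runs_length[OF runs_one[OF runs_step.hyps(1,2) 1], of r] runs_step.prems(7)[of r] by simp
  show ?case
  proof (cases "0 \<le> pc1 \<and> pc1 < int (length P)")
    case True
    have "\<exists>v\<le>t * (2 * L + 4). (tm_step (tm_of P) ^^ v) (tm_goto P pc1, 0, tape_of (snd (istep (P ! nat pc) (pc, s)))) = (1, 0, tape_of (snd c'))"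
      by (rule runs_step.IH) (use True 1 runs_step.prems len in \<open>auto simp: tm_goto_def\<close>)
    then obtain v where v: "v \<le> t * (2 * L + 4)"
      "(tm_step (tm_of P) ^^ v) (tm_goto P pc1, 0, tape_of s1) = (1, 0, tape_of (snd c'))" by (auto simp: 1)
    show ?thesis using tm_steps_trans[OF u(2) v(2)] u(1) v(1) by (intro exI[of _ "u + v"]) auto
  next
    case False
    \<comment> \<open>No instruction runs outside the code, so this was the last step, and
      \<open>tm_goto\<close> yields the halting state.\<close>
    have "c' = (pc1, s1)" using runs_step.hyps(3) False unfolding 1 by (cases rule: runs.cases) auto
    then show ?thesis using False u by (intro exI[of _ u]) (auto simp: tm_goto_def)
  qed
qed auto

section \<open>Trees on a stack\<close>

datatype tree = Leaf | Node tree tree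

text \<open>In preorder, building and splitting a node is a single push or pop.\<close>
primrec ser :: "tree \<Rightarrow> bool list" where
  "ser Leaf = [False]"
| "ser (Node l r) = True # ser l @ ser r"

lemma exec_cong: "exec P s s1 T \<Longrightarrow> s1 = s2 \<Longrightarrow> T \<le> U \<Longrightarrow> exec P s s2 U"
  using exec_mono by blast

lemma exec_PushCons: "exec P (s(r := b # s r)) s' T \<Longrightarrow> exec (Push r b # P) s s' (T + 1)"
  using exec_append[OF exec_Push, of P s r b s' T] by (simp add: add.commute)

lemma exec_pushes: "distinct ds \<Longrightarrow>
  exec (map (\<lambda>d. Push d b) ds) s (\<lambda>x. if x \<in> set ds then b # s x else s x) (length ds)"
proof (induction ds arbitrary: s)
  case (Cons d ds)
  show ?case using Cons.prems
    by (auto intro: exec_cong[OF exec_PushCons[OF Cons.IH]] simp: fun_eq_iff)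
qed (simp add: exec_Nil)

section \<open>Moving, copying and discarding the topmost tree\<close>

definition mvC :: "reg \<Rightarrow> instr list" where
  "mvC d = Push RK True # loopC RF (caseC RK [] []
     (caseC RA [] [Push d False, Push RF True]
        [Push d True, Push RK True, Push RK True, Push RF True]))"

text \<open>The stack RK counts, in unary, the subtrees still to be moved.\<close>
lemma exec_mvC_loop:
  assumes "d \<noteq> RA" "d \<noteq> RK" "d \<noteq> RF"
  defines "L \<equiv> loopC RF (caseC RK [] [] (caseC RA [] [Push d False, Push RF True]
        [Push d True, Push RK True, Push RK True, Push RF True]))"
  shows "s RA = ser x @ a \<Longrightarrow> s RK = True # k \<Longrightarrow> s RF = [] \<Longrightarrow>
    exec L (s(RA := a, RK := k, d := rev (ser x) @ s d)) s' T \<Longrightarrow> exec L s s' (T + 10 * length (ser x))"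
proof (induction x arbitrary: s a k T)
  case Leaf
  let ?s1 = "s(RK := k, RA := a, d := False # s d, RF := [True])"
  have "exec (caseC RK [] [] (caseC RA [] [Push d False, Push RF True]
        [Push d True, Push RK True, Push RK True, Push RF True])) s ?s1 (0 + 1 + 1 + 2 + 2)"
    by (rule exec_caseC_True[where xs = k], use Leaf.prems(1-3) in simp, rule exec_caseC_False[where xs = a], use Leaf.prems(1-3) in simp)
      (rule exec_cong[OF exec_PushCons[OF exec_PushCons[OF exec_Nil]]], use Leaf.prems(1-3) assms(1-3) in \<open>auto simp: fun_eq_iff\<close>)
  note body = this
  have eq: "?s1(RF := []) = s(RA := a, RK := k, d := rev (ser Leaf) @ s d)"
    using Leaf.prems(1-3) assms(1-3) by (auto simp: fun_eq_iff)
  have "exec L (?s1(RF := [])) s' T" unfolding eq by (rule Leaf.prems(4))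
  from exec_loopC_repeat[OF body _ this[unfolded L_def]]
  have "exec L s s' (0 + 1 + 1 + 2 + 2 + 1 + T)" unfolding L_def by simp
  then show ?case by (rule exec_mono) simp
next
  case (Node l r)
  let ?s1 = "s(RK := True # True # k, RA := ser l @ ser r @ a, d := True # s d, RF := [True])"
  let ?s2 = "?s1(RF := [])"
  let ?s3 = "?s2(RA := ser r @ a, RK := True # k, d := rev (ser l) @ ?s2 d)"
  have body: "exec (caseC RK [] [] (caseC RA [] [Push d False, Push RF True]
        [Push d True, Push RK True, Push RK True, Push RF True])) s ?s1 (0 + 1 + 1 + 1 + 1 + 2 + 2)"
    by (rule exec_caseC_True[where xs = k], use Node.prems(1-3) in simp, rule exec_caseC_True[where xs = "ser l @ ser r @ a"], use Node.prems(1-3) in simp)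
      (rule exec_cong[OF exec_PushCons[OF exec_PushCons[OF exec_PushCons[OF exec_PushCons[OF exec_Nil]]]]],
        use Node.prems(1-3) assms(1-3) in \<open>auto simp: fun_eq_iff\<close>)
  have eq: "?s3(RA := a, RK := k, d := rev (ser r) @ ?s3 d) = s(RA := a, RK := k, d := rev (ser (Node l r)) @ s d)"
    using Node.prems(1-3) assms(1-3) by (auto simp: fun_eq_iff)
  \<comment> \<open>The loop does not pause between subtrees, so the rest of the run is passed to
    the induction hypothesis as a continuation: first for the right subtree, then for the
    left.\<close>
  have "exec L (?s3(RA := a, RK := k, d := rev (ser r) @ ?s3 d)) s' T"
    unfolding eq by (rule Node.prems(4))
  then have 3: "exec L ?s3 s' (T + 10 * length (ser r))"
    by (rule Node.IH(2)[rotated -1]) (use assms(1-3) in simp_all)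
  have "exec L ?s2 s' (T + 10 * length (ser r) + 10 * length (ser l))"
    by (rule Node.IH(1)[rotated -1], rule 3) (use assms(1-3) in simp_all)
  from exec_loopC_repeat[OF body _ this[unfolded L_def]]
  have "exec L s s' (0 + 1 + 1 + 1 + 1 + 2 + 2 + 1 + (T + 10 * length (ser r) + 10 * length (ser l)))"
    unfolding L_def by simp
  then show ?case by (rule exec_mono) simp
qed

lemma exec_mvC:
  assumes "d \<noteq> RA" "d \<noteq> RK" "d \<noteq> RF" "s RA = ser x @ a" "s RK = []" "s RF = []"
  shows "exec (mvC d) s (s(RA := a, d := rev (ser x) @ s d)) (10 * length (ser x) + 4)"
proof -
  let ?B = "caseC RK [] [] (caseC RA [] [Push d False, Push RF True]
        [Push d True, Push RK True, Push RK True, Push RF True])"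
  let ?s' = "s(RA := a, d := rev (ser x) @ s d)"
  have 1: "exec (loopC RF ?B) ?s' ?s' (0 + 2 + 1)"
    by (rule exec_loopC_exit[OF exec_caseC_Nil[OF _ exec_Nil]]) (use assms in auto)
  have "exec (loopC RF ?B) (s(RK := True # s RK)) ?s' (0 + 2 + 1 + 10 * length (ser x))"
  proof (rule exec_mvC_loop)
    have "(s(RK := True # s RK))(RA := a, RK := [], d := rev (ser x) @ (s(RK := True # s RK)) d) = ?s'"
      using assms by (auto simp: fun_eq_iff)
    then show "exec (loopC RF ?B) ((s(RK := True # s RK))(RA := a, RK := [], d := rev (ser x) @ (s(RK := True # s RK)) d)) ?s' (0 + 2 + 1)"
      using 1 by simp
  qed (use assms in auto)
  then show ?thesis unfolding mvC_def by (auto intro: exec_mono[OF exec_PushCons])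
qed

text \<open>Emptying a stack onto others reverses it, which undoes the reversal made by
  \<open>mvC\<close>; several targets copy, none discards.\<close>

definition trC :: "reg \<Rightarrow> reg list \<Rightarrow> instr list" where
  "trC r ds = loopC RF (caseC r [] (Push RF True # map (\<lambda>d. Push d False) ds)
     (Push RF True # map (\<lambda>d. Push d True) ds))"

lemma exec_trC:
  assumes "distinct ds" "r \<notin> set ds" "RF \<notin> set ds" "r \<noteq> RF"
  shows "s r = xs \<Longrightarrow> s RF = [] \<Longrightarrow>
    exec (trC r ds) s (\<lambda>x. if x = r then [] else if x \<in> set ds then rev xs @ s x else s x)
      ((length ds + 4) * length xs + 3)"
proof (induction xs arbitrary: s)
  case Nil
  have "exec (trC r ds) s s (0 + 2 + 1)" unfolding trC_def
    by (rule exec_loopC_exit[OF exec_caseC_Nil[OF _ exec_Nil]]) (use Nil in auto)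
  then show ?case by (rule exec_cong) (use Nil in \<open>auto simp: fun_eq_iff\<close>)
next
  case (Cons b xs)
  let ?s0 = "s(r := xs, RF := [True])"
  let ?s1 = "\<lambda>x. if x \<in> set ds then b # ?s0 x else ?s0 x"
  let ?s2 = "?s1(RF := [])"
  have p: "exec (Push RF True # map (\<lambda>d. Push d b) ds) (s(r := xs)) ?s1 (length ds + 1)"
    by (rule exec_cong[OF exec_PushCons[OF exec_pushes[OF assms(1)]]])
      (use Cons.prems assms in \<open>auto simp: fun_eq_iff\<close>)
  have body: "exec (caseC r [] (Push RF True # map (\<lambda>d. Push d False) ds)
     (Push RF True # map (\<lambda>d. Push d True) ds)) s ?s1 (length ds + 1 + 2)"
    using p exec_caseC_True[of s r xs] exec_caseC_False[of s r xs] Cons.prems by (cases b) auto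
  have "exec (trC r ds) ?s2 (\<lambda>x. if x = r then [] else if x \<in> set ds then rev xs @ ?s2 x else ?s2 x)
      ((length ds + 4) * length xs + 3)"
    by (rule Cons.IH) (use assms in auto)
  from exec_loopC_repeat[OF body _ this[unfolded trC_def]] assms
  have "exec (trC r ds) s (\<lambda>x. if x = r then [] else if x \<in> set ds then rev xs @ ?s2 x else ?s2 x)
      (length ds + 1 + 2 + 1 + ((length ds + 4) * length xs + 3))"
    unfolding trC_def by simp
  then show ?case
    by (rule exec_cong) (use assms Cons.prems in \<open>auto simp: fun_eq_iff\<close>)
qed

definition mem :: "bool list \<Rightarrow> store" where
  "mem a = (\<lambda>_. [])(RA := a)"

lemma mem_simps [simp]: "mem a RA = a" "r \<noteq> RA \<Longrightarrow> mem a r = []" "(mem a)(RA := b) = mem b"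
  by (auto simp: mem_def)

lemma exec_Pop_mem: "exec [Pop RA 1 1 1] (mem (b # a)) (mem a) 1"
  unfolding exec_def by (auto intro!: exI[of _ 1] runs_one[of 0, unfolded One_nat_def])

lemma exec_Push_mem: "exec [Push RA b] (mem a) (mem (b # a)) 1"
  using exec_Push[of RA b "mem a"] by simp

definition dropC :: "instr list" where "dropC = mvC RB @ trC RB []"

lemma exec_dropC: "exec dropC (mem (ser x @ a)) (mem a) (20 * length (ser x) + 20)"
proof -
  have 1: "exec (mvC RB) (mem (ser x @ a)) ((mem a)(RB := rev (ser x))) (10 * length (ser x) + 4)"
    by (rule exec_cong[OF exec_mvC[where x = x and a = a]]) auto
  have 2: "exec (trC RB []) ((mem a)(RB := rev (ser x))) (mem a) (4 * length (ser x) + 3)"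
    by (rule exec_cong[OF exec_trC]) (auto simp: fun_eq_iff mem_def)
  show ?thesis unfolding dropC_def by (rule exec_mono[OF exec_append[OF 1 2]]) simp
qed

text \<open>The copy kept in \<open>RC\<close> stands in forward order, so it is reversed into
  \<open>RB\<close> before it is laid on \<open>RA\<close>.\<close>

definition dupC :: "instr list" where "dupC = mvC RB @ trC RB [RA, RC] @ trC RC [RB] @ trC RB [RA]"

lemma exec_dupC: "exec dupC (mem (ser x @ a)) (mem (ser x @ ser x @ a)) (40 * length (ser x) + 40)"
proof -
  let ?x = "ser x"
  have 1: "exec (mvC RB) (mem (?x @ a)) ((mem a)(RB := rev ?x)) (10 * length ?x + 4)"
    by (rule exec_cong[OF exec_mvC[where x = x and a = a]]) auto
  have 2: "exec (trC RB [RA, RC]) ((mem a)(RB := rev ?x)) ((mem (?x @ a))(RC := ?x)) (6 * length ?x + 3)"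
    by (rule exec_cong[OF exec_trC]) (auto simp: fun_eq_iff mem_def)
  have 3: "exec (trC RC [RB]) ((mem (?x @ a))(RC := ?x)) ((mem (?x @ a))(RB := rev ?x)) (5 * length ?x + 3)"
    by (rule exec_cong[OF exec_trC]) (auto simp: fun_eq_iff mem_def)
  have 4: "exec (trC RB [RA]) ((mem (?x @ a))(RB := rev ?x)) (mem (?x @ ?x @ a)) (5 * length ?x + 3)"
    by (rule exec_cong[OF exec_trC]) (auto simp: fun_eq_iff mem_def)
  show ?thesis unfolding dupC_def
    by (rule exec_mono[OF exec_append[OF 1 exec_append[OF 2 exec_append[OF 3 4]]]]) simp
qed

definition swapC :: "instr list" where "swapC = mvC RB @ mvC RC @ trC RB [RA] @ trC RC [RA]"

lemma exec_swapC: "exec swapC (mem (ser x @ ser y @ a)) (mem (ser y @ ser x @ a))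
  (20 * length (ser x) + 20 * length (ser y) + 20)"
proof -
  let ?x = "ser x" and ?y = "ser y"
  have 1: "exec (mvC RB) (mem (?x @ ?y @ a)) ((mem (?y @ a))(RB := rev ?x)) (10 * length ?x + 4)"
    by (rule exec_cong[OF exec_mvC[where x = x and a = "?y @ a"]]) auto
  have 2: "exec (mvC RC) ((mem (?y @ a))(RB := rev ?x)) ((mem a)(RB := rev ?x, RC := rev ?y)) (10 * length ?y + 4)"
    by (rule exec_cong[OF exec_mvC[where x = y and a = a]]) (auto simp: fun_eq_iff mem_def)
  have 3: "exec (trC RB [RA]) ((mem a)(RB := rev ?x, RC := rev ?y)) ((mem (?x @ a))(RC := rev ?y)) (5 * length ?x + 3)"
    by (rule exec_cong[OF exec_trC]) (auto simp: fun_eq_iff mem_def)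
  have 4: "exec (trC RC [RA]) ((mem (?x @ a))(RC := rev ?y)) (mem (?y @ ?x @ a)) (5 * length ?y + 3)"
    by (rule exec_cong[OF exec_trC]) (auto simp: fun_eq_iff mem_def)
  show ?thesis unfolding swapC_def
    by (rule exec_mono[OF exec_append[OF 1 exec_append[OF 2 exec_append[OF 3 4]]]]) simp
qed

section \<open>Polynomially bounded functions\<close>

text \<open>Monotonicity is part of the notion because bounds are evaluated at upper bounds of
  sizes.\<close>

definition poly :: "(nat \<Rightarrow> nat) \<Rightarrow> bool" where
  "poly p \<longleftrightarrow> mono p \<and> (\<exists>c k. \<forall>n. p n \<le> c * n ^ k + c)"

lemma poly_const: "poly (\<lambda>n. c)"
  unfolding poly_def by (auto intro!: monoI exI[of _ c])

lemma poly_id: "poly (\<lambda>n. n)"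
  unfolding poly_def by (auto intro!: monoI exI[of _ 1])

lemma poly_le: "poly q \<Longrightarrow> mono p \<Longrightarrow> (\<And>n. p n \<le> q n) \<Longrightarrow> poly p"
  unfolding poly_def by (meson order_trans)

text \<open>The summand 1 covers \<open>n = 0\<close>, \<open>k = 0\<close>, \<open>l > 0\<close>,
  where the left side is 1 and the power on the right is 0.\<close>

lemma power_le_sum: "(n::nat) ^ k \<le> n ^ (k + l) + 1"
proof (cases "n = 0")
  case False
  then have "n ^ k \<le> n ^ (k + l)" by (intro power_increasing) auto
  then show ?thesis by simp
qed (cases k, auto)

lemma poly_add:
  assumes "poly p" "poly q"
  shows "poly (\<lambda>n. p n + q n)"
proof -
  obtain c k d l where p: "\<And>n. p n \<le> c * n ^ k + c" and q: "\<And>n. q n \<le> d * n ^ l + d"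
    using assms unfolding poly_def by blast
  have "p n + q n \<le> (2 * c + 2 * d) * n ^ (k + l) + (2 * c + 2 * d)" for n
  proof -
    have "c * n ^ k \<le> c * (n ^ (k + l) + 1)" "d * n ^ l \<le> d * (n ^ (k + l) + 1)"
      using mult_left_mono[OF power_le_sum[of n k l], of c] mult_left_mono[OF power_le_sum[of n l k], of d]
      by (simp_all add: add.commute)
    then show ?thesis using p[of n] q[of n] by (simp add: algebra_simps)
  qed
  moreover have "mono (\<lambda>n. p n + q n)" using assms unfolding poly_def mono_def by (simp add: add_mono)
  ultimately show ?thesis unfolding poly_def by blast
qed

lemma poly_mult:
  assumes "poly p" "poly q"
  shows "poly (\<lambda>n. p n * q n)"
proof -
  obtain c k d l where p: "\<And>n. p n \<le> c * n ^ k + c" and q: "\<And>n. q n \<le> d * n ^ l + d"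
    using assms unfolding poly_def by blast
  have "p n * q n \<le> (3 * c * d) * n ^ (k + l) + (3 * c * d)" for n
  proof -
    have "p n * q n \<le> (c * n ^ k + c) * (d * n ^ l + d)" by (intro mult_mono p q) auto
    also have "\<dots> = c * d * n ^ (k + l) + c * d * n ^ k + c * d * n ^ l + c * d"
      by (simp add: algebra_simps power_add)
    also have "\<dots> \<le> c * d * n ^ (k + l) + c * d * (n ^ (k + l) + 1) + c * d * (n ^ (k + l) + 1) + c * d"
      using power_le_sum[of n k l] power_le_sum[of n l k]
      by (intro add_mono mult_left_mono) (auto simp: add.commute)
    finally show ?thesis by (simp add: algebra_simps)
  qed
  moreover have "mono (\<lambda>n. p n * q n)" using assms unfolding poly_def mono_def by (simp add: mult_mono)
  ultimately show ?thesis unfolding poly_def by blast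
qed

lemma poly_power: "poly p \<Longrightarrow> poly (\<lambda>n. p n ^ k)"
  by (induction k) (auto intro: poly_const poly_mult)

lemma poly_comp:
  assumes "poly p" "poly q"
  shows "poly (\<lambda>n. p (q n))"
proof -
  obtain c k where p: "\<And>n. p n \<le> c * n ^ k + c" using assms unfolding poly_def by blast
  have "mono (\<lambda>n. p (q n))" using assms unfolding poly_def mono_def by simp
  then show ?thesis
    using poly_add[OF poly_mult[OF poly_const[of c] poly_power[OF assms(2), of k]] poly_const[of c]] p
    by (blast intro: poly_le)
qed

lemmas poly_intros = poly_const poly_id poly_add poly_mult

lemma poly_mono: "poly p \<Longrightarrow> m \<le> n \<Longrightarrow> p m \<le> p n"
  by (simp add: poly_def mono_def)

section \<open>Polynomial-time functions on tree-encoded types\<close>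

class treeable =
  fixes tree_of :: "'a \<Rightarrow> tree"

instantiation unit :: treeable
begin
definition tree_of_unit :: "unit \<Rightarrow> tree" where "tree_of_unit x = Leaf"
instance ..
end

instantiation bool :: treeable
begin
definition tree_of_bool :: "bool \<Rightarrow> tree" where "tree_of_bool b = (if b then Node Leaf Leaf else Leaf)"
instance ..
end

text \<open>Numbers are unary, so that folds can count with them; in return every number has to stay
  polynomially small. Binary numerals are kept as \<open>bool list\<close> instead.\<close>

instantiation nat :: treeable
begin
primrec tree_of_nat :: "nat \<Rightarrow> tree" where
  "tree_of_nat 0 = Leaf"
| "tree_of_nat (Suc n) = Node Leaf (tree_of_nat n)"
instance ..
end

instantiation prod :: (treeable, treeable) treeable
begin
definition tree_of_prod :: "'a \<times> 'b \<Rightarrow> tree" where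
  "tree_of_prod x = Node (tree_of (fst x)) (tree_of (snd x))"
instance ..
end

instantiation list :: (treeable) treeable
begin
primrec tree_of_list :: "'a list \<Rightarrow> tree" where
  "tree_of_list [] = Leaf"
| "tree_of_list (x # xs) = Node (tree_of x) (tree_of_list xs)"
instance ..
end

abbreviation code :: "'a::treeable \<Rightarrow> bool list" where "code x \<equiv> ser (tree_of x)"

definition sz :: "'a::treeable \<Rightarrow> nat" where "sz x = length (code x)"

lemma sz_simps [simp]:
  "sz (a, b) = sz a + sz b + 1" "sz ([] :: 'a::treeable list) = 1" "sz (x # xs) = sz x + sz xs + 1"
  "sz True = 3" "sz False = 1" "sz (n::nat) = 2 * n + 1" "sz () = 1"
  by (auto simp: sz_def tree_of_prod_def tree_of_bool_def tree_of_unit_def) (induction n, auto)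

lemma sz_pos: "sz x > 0"
  unfolding sz_def by (cases "tree_of x") auto

lemma sz_bool_le: "sz (b::bool) \<le> 3"
  by (cases b) auto

lemma sz_append: "sz (xs @ ys) + 1 = sz xs + sz ys"
  by (induction xs) auto

lemma sz_rev [simp]: "sz (rev xs) = sz xs"
proof (induction xs)
  case (Cons x xs)
  then show ?case using sz_append[of "rev xs" "[x]"] by simp
qed simp

lemma length_le_sz: "length xs \<le> sz xs"
  by (induction xs) auto

lemma sz_member: "x \<in> set xs \<Longrightarrow> sz x \<le> sz xs"
  by (induction xs) auto

text \<open>The arbitrary remainder \<open>a\<close> lets a program run while other values wait
  below its argument.\<close>

definition pt :: "('a::treeable \<Rightarrow> 'b::treeable) \<Rightarrow> bool" where
  "pt f \<longleftrightarrow> (\<exists>P p. poly p \<and> (\<forall>x a. exec P (mem (code x @ a)) (mem (code (f x) @ a)) (p (sz x))))"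

lemma ptI: "poly p \<Longrightarrow> (\<And>x a. exec P (mem (code x @ a)) (mem (code (f x) @ a)) (p (sz x))) \<Longrightarrow> pt f"
  unfolding pt_def by blast

lemma ptE:
  assumes "pt f"
  obtains P p where "poly p" "\<And>x a. exec P (mem (code x @ a)) (mem (code (f x) @ a)) (p (sz x))"
    "\<And>x. sz (f x) \<le> sz x + p (sz x)"
proof -
  obtain P p where P: "poly p" "\<And>x a. exec P (mem (code x @ a)) (mem (code (f x) @ a)) (p (sz x))"
    using assms unfolding pt_def by blast
  have "sz (f x) \<le> sz x + p (sz x)" for x
    using exec_length[OF P(2)[of x "[]"], of RA] by (simp add: sz_def)
  then show thesis using that P by blast
qed

lemma pt_size:
  assumes "pt f"
  obtains p where "poly p" "\<And>x. sz (f x) \<le> p (sz x)"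
  using ptE[OF assms] poly_add[OF poly_id] by metis

lemma pt_id: "pt (\<lambda>x. x)"
  by (rule ptI[of "\<lambda>_. 0" "[]"]) (auto intro: exec_Nil poly_const)

text \<open>Values with equal trees convert for free: a cons cell is a pair, and a number is a list
  of units.\<close>

lemma pt_same_code:
  assumes "pt f" "\<And>x. tree_of (g x) = tree_of (f x)"
  shows "pt g"
  using assms unfolding pt_def by auto

lemma pt_cong: "pt f \<Longrightarrow> (\<And>x. f x = g x) \<Longrightarrow> pt g"
  by (metis ext)

lemma pt_comp:
  assumes "pt g" "pt f"
  shows "pt (\<lambda>x. g (f x))"
proof -
  obtain F p where F: "poly p" "\<And>x a. exec F (mem (code x @ a)) (mem (code (f x) @ a)) (p (sz x))"
    "\<And>x. sz (f x) \<le> sz x + p (sz x)" using ptE[OF assms(2)] by metis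
  obtain G q where G: "poly q" "\<And>x a. exec G (mem (code x @ a)) (mem (code (g x) @ a)) (q (sz x))"
    using ptE[OF assms(1)] by metis
  show ?thesis
  proof (rule ptI[of "\<lambda>n. p n + q (n + p n)" "F @ G"])
    show "poly (\<lambda>n. p n + q (n + p n))" by (intro poly_add F(1) poly_comp[OF G(1)] poly_id)
    show "exec (F @ G) (mem (code x @ a)) (mem (code (g (f x)) @ a)) (p (sz x) + q (sz x + p (sz x)))" for x a
      by (rule exec_mono[OF exec_append[OF F(2) G(2)]]) (simp add: F(3) poly_mono[OF G(1)])
  qed
qed

text \<open>Preorder wants the first component on top, so \<open>g\<close> is evaluated first, and
  then the saved argument is swapped up for \<open>f\<close>.\<close>

lemma pt_pair:
  assumes "pt f" "pt g"
  shows "pt (\<lambda>x. (f x, g x))"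
proof -
  obtain F p where F: "poly p" "\<And>x a. exec F (mem (code x @ a)) (mem (code (f x) @ a)) (p (sz x))"
    "\<And>x. sz (f x) \<le> sz x + p (sz x)" using ptE[OF assms(1)] by metis
  obtain G q where G: "poly q" "\<And>x a. exec G (mem (code x @ a)) (mem (code (g x) @ a)) (q (sz x))"
    "\<And>x. sz (g x) \<le> sz x + q (sz x)"
    using ptE[OF assms(2)] by metis
  let ?r = "\<lambda>n. (40 * n + 40) + (q n + ((20 * (n + q n) + 20 * n + 20) + (p n + 1)))"
  show ?thesis
  proof (rule ptI[of ?r "dupC @ G @ swapC @ F @ [Push RA True]"])
    show "poly ?r" by (intro poly_intros F(1) G(1))
    show "exec (dupC @ G @ swapC @ F @ [Push RA True]) (mem (code x @ a)) (mem (code (f x, g x) @ a)) (?r (sz x))" for x a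
    proof (rule exec_cong[OF exec_append[OF exec_dupC exec_append[OF G(2) exec_append[OF exec_swapC exec_append[OF F(2) exec_Push_mem]]]]])
      show "mem (True # code (f x) @ code (g x) @ a) = mem (code (f x, g x) @ a)"
        by (simp add: tree_of_prod_def)
      show "40 * length (code x) + 40 + (q (sz x) + (20 * length (code (g x)) + 20 * length (code x) + 20 + (p (sz x) + 1))) \<le> ?r (sz x)"
        using G(3)[of x] by (simp add: sz_def)
    qed
  qed
qed

lemma pt_fst': "pt (fst :: 'a::treeable \<times> 'b::treeable \<Rightarrow> 'a)"
proof (rule ptI[of "\<lambda>n. 100 * n + 100" "[Pop RA 1 1 1] @ swapC @ dropC"])
  show "exec ([Pop RA 1 1 1] @ swapC @ dropC) (mem (code x @ a)) (mem (code (fst x) @ a)) (100 * sz x + 100)"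
    for x :: "'a \<times> 'b" and a
    using exec_append[OF exec_Pop_mem[of True] exec_append[OF exec_swapC exec_dropC], of "tree_of (fst x)" "tree_of (snd x)" a]
    by (auto elim!: exec_mono simp: sz_def tree_of_prod_def)
qed (intro poly_intros)

lemma pt_snd': "pt (snd :: 'a::treeable \<times> 'b::treeable \<Rightarrow> 'b)"
proof (rule ptI[of "\<lambda>n. 100 * n + 100" "[Pop RA 1 1 1] @ dropC"])
  show "exec ([Pop RA 1 1 1] @ dropC) (mem (code x @ a)) (mem (code (snd x) @ a)) (100 * sz x + 100)"
    for x :: "'a \<times> 'b" and a
    using exec_append[OF exec_Pop_mem[of True] exec_dropC, of "tree_of (fst x)" "code (snd x) @ a"]
    by (auto elim!: exec_mono simp: sz_def tree_of_prod_def)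
qed (intro poly_intros)

lemmas pt_fst = pt_comp[OF pt_fst'] and pt_snd = pt_comp[OF pt_snd']

lemma exec_pushes_mem: "exec (map (Push RA) xs) (mem a) (mem (rev xs @ a)) (length xs)"
proof (induction xs arbitrary: a)
  case (Cons b xs)
  show ?case using exec_append[OF exec_Push_mem Cons.IH, of b a] by simp
qed (simp add: exec_Nil)

lemma pt_const: "pt (\<lambda>x :: 'a::treeable. c :: 'b::treeable)"
proof (rule ptI[of "\<lambda>n. 20 * n + 20 + sz c" "dropC @ map (Push RA) (rev (code c))"])
  show "exec (dropC @ map (Push RA) (rev (code c))) (mem (code x @ a)) (mem (code c @ a)) (20 * sz x + 20 + sz c)"
    for x :: 'a and a
    using exec_append[OF exec_dropC exec_pushes_mem[of "rev (code c)"], of "tree_of x" a] by (simp add: sz_def)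
qed (intro poly_intros)

lemma pt_if:
  assumes "pt b" "pt f" "pt g"
  shows "pt (\<lambda>x. if b x then f x else g x)"
proof -
  obtain B r where B: "poly r" "\<And>x a. exec B (mem (code x @ a)) (mem (code (b x) @ a)) (r (sz x))"
    using ptE[OF assms(1)] by metis
  obtain F p where F: "poly p" "\<And>x a. exec F (mem (code x @ a)) (mem (code (f x) @ a)) (p (sz x))"
    using ptE[OF assms(2)] by metis
  obtain G q where G: "poly q" "\<And>x a. exec G (mem (code x @ a)) (mem (code (g x) @ a)) (q (sz x))"
    using ptE[OF assms(3)] by metis
  let ?pop = "[Pop RA 1 1 1]"
  let ?t = "\<lambda>n. (40 * n + 40) + (r n + (p n + q n + 4))"
  \<comment> \<open>The code of \<open>True\<close> is a node with two leaves: the branch consumes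
    the node symbol, the two pops the leaves.\<close>
  let ?P = "dupC @ B @ caseC RA [] G (?pop @ ?pop @ F)"
  show ?thesis
  proof (rule ptI[of ?t ?P])
    show "poly ?t" by (intro poly_intros F(1) G(1) B(1))
    show "exec ?P (mem (code x @ a)) (mem (code (if b x then f x else g x) @ a)) (?t (sz x))" for x a
    proof -
      have "exec (caseC RA [] G (?pop @ ?pop @ F)) (mem (code (b x) @ code x @ a))
        (mem (code (if b x then f x else g x) @ a)) (p (sz x) + q (sz x) + 4)"
      proof (cases "b x")
        case True
        have "exec (?pop @ ?pop @ F) (mem (False # False # code x @ a)) (mem (code (f x) @ a)) (1 + (1 + p (sz x)))"
          by (rule exec_append[OF exec_Pop_mem exec_append[OF exec_Pop_mem F(2)]])
        then show ?thesis using True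
          by (auto intro!: exec_mono[OF exec_caseC_True] simp: tree_of_bool_def)
      next
        case False
        then show ?thesis using G(2)[of x a]
          by (auto intro!: exec_mono[OF exec_caseC_False] simp: tree_of_bool_def)
      qed
      from exec_append[OF exec_dupC exec_append[OF B(2) this]] show ?thesis by (simp add: sz_def)
    qed
  qed
qed

text \<open>Matching on the first component of a pair inspects the symbol directly below the pair symbol.\<close>
lemma pt_case_list':
  assumes "pt f" "pt g"
  shows "pt (\<lambda>z :: 'a::treeable list \<times> 'b::treeable. case fst z of [] \<Rightarrow> f (snd z) | y # ys \<Rightarrow> g ((y, ys), snd z))"
proof -
  obtain F p where F: "poly p" "\<And>x a. exec F (mem (code x @ a)) (mem (code (f x) @ a)) (p (sz x))"
    using ptE[OF assms(1)] by metis
  obtain G q where G: "poly q" "\<And>x a. exec G (mem (code x @ a)) (mem (code (g x) @ a)) (q (sz x))"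
    using ptE[OF assms(2)] by metis
  let ?t = "\<lambda>n. 1 + (p n + q n + 4)"
  let ?C = "caseC RA [] F ([Push RA True] @ [Push RA True] @ G)"
  show ?thesis
  proof (rule ptI[of ?t "[Pop RA 1 1 1] @ ?C"])
    show "poly ?t" by (intro poly_intros F(1) G(1))
    show "exec ([Pop RA 1 1 1] @ ?C) (mem (code z @ a)) (mem (code
      (case fst z of [] \<Rightarrow> f (snd z) | y # ys \<Rightarrow> g ((y, ys), snd z)) @ a)) (?t (sz z))" for z :: "'a list \<times> 'b" and a
    proof -
      have "exec ?C (mem (code (fst z) @ code (snd z) @ a))
        (mem (code (case fst z of [] \<Rightarrow> f (snd z) | y # ys \<Rightarrow> g ((y, ys), snd z)) @ a)) (p (sz z) + q (sz z) + 4)"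
      proof (cases "fst z")
        case Nil
        have "p (sz (snd z)) \<le> p (sz z)" by (rule poly_mono[OF F(1)]) (cases z; simp)
        then show ?thesis using F(2)[of "snd z" a] Nil
          by (auto intro!: exec_mono[OF exec_caseC_False])
      next
        case (Cons y ys)
        \<comment> \<open>Head, tail and context already lie on the stack in order; two node symbols
          turn them into the nested pair that \<open>g\<close> expects.\<close>
        have "exec ([Push RA True] @ [Push RA True] @ G) (mem (code y @ code ys @ code (snd z) @ a))
          (mem (code (g ((y, ys), snd z)) @ a)) (1 + (1 + q (sz ((y, ys), snd z))))"
          using exec_append[OF exec_Push_mem exec_append[OF exec_Push_mem G(2)[of "((y, ys), snd z)" a, unfolded tree_of_prod_def ser.simps append_Cons append_assoc fst_conv snd_conv]]] .
        moreover have "sz ((y, ys), snd z) = sz z" using Cons by (cases z) simp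
        ultimately show ?thesis using Cons
          by (auto intro!: exec_mono[OF exec_caseC_True])
      qed
      from exec_append[OF exec_Pop_mem[of True] this] show ?thesis by (simp add: tree_of_prod_def)
    qed
  qed
qed

lemma pt_case_list:
  assumes "pt h" "pt f" "pt (\<lambda>z. g (snd z) (fst (fst z)) (snd (fst z)))"
  shows "pt (\<lambda>x. case h x of [] \<Rightarrow> f x | y # ys \<Rightarrow> g x y ys)"
  using pt_comp[OF pt_case_list'[OF assms(2,3)] pt_pair[OF assms(1) pt_id]]
  by (simp cong: list.case_cong)

lemma pt_Cons: "pt f \<Longrightarrow> pt g \<Longrightarrow> pt (\<lambda>x. f x # g x)"
  by (rule pt_same_code[OF pt_pair]) (auto simp: tree_of_prod_def)

lemma pt_Suc: "pt f \<Longrightarrow> pt (\<lambda>x. Suc (f x))"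
  by (rule pt_same_code[OF pt_pair[OF pt_const[of "()"]]]) (auto simp: tree_of_prod_def tree_of_unit_def)

lemma pt_units: "pt f \<Longrightarrow> pt (\<lambda>x. replicate (f x) ())"
proof (rule pt_same_code)
  have "tree_of (replicate n ()) = tree_of n" for n
    by (induction n) (auto simp: tree_of_unit_def)
  then show "tree_of (replicate (f x) ()) = tree_of (f x)" for x by simp
qed

lemma pt_not: "pt f \<Longrightarrow> pt (\<lambda>x. \<not> f x)"
  by (rule pt_cong[OF pt_if[OF _ pt_const[of False] pt_const[of True]]]) auto

lemma pt_conj: "pt f \<Longrightarrow> pt g \<Longrightarrow> pt (\<lambda>x. f x \<and> g x)"
  by (rule pt_cong[OF pt_if[of f g "\<lambda>_. False", OF _ _ pt_const]]) auto

lemma pt_eq_bool: "pt f \<Longrightarrow> pt g \<Longrightarrow> pt (\<lambda>x. f x = (g x :: bool))"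
  by (rule pt_cong[OF pt_if[of f g "\<lambda>x. \<not> g x", OF _ _ pt_not]]) auto

lemma pt_null: "pt f \<Longrightarrow> pt (\<lambda>x. f x = [])"
  by (rule pt_cong[OF pt_case_list[OF _ pt_const[of True] pt_const[of False]]]) (auto split: list.split)

lemma pt_hd: "pt f \<Longrightarrow> pt (\<lambda>x. hd (f x))"
  by (rule pt_cong[OF pt_case_list[OF _ pt_const[of "hd []"] pt_fst[OF pt_fst[OF pt_id]]]]) (auto split: list.split)

lemma pt_tl: "pt f \<Longrightarrow> pt (\<lambda>x. tl (f x))"
  by (rule pt_cong[OF pt_case_list[OF _ pt_const[of "[]"] pt_snd[OF pt_fst[OF pt_id]]]]) (auto split: list.split)

text \<open>Polynomially many rounds do not bound the time, as the data may grow in each; so the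
  sizes of all intermediate values are bounded along with the number of rounds.\<close>

lemma pt_while:
  fixes f :: "'b::treeable \<Rightarrow> 'b" and i h :: "'a::treeable \<Rightarrow> 'b"
  assumes "pt b" "pt f" "pt i" "poly q"
    and "\<And>x. \<exists>n \<le> q (sz x). (\<forall>j < n. b ((f ^^ j) (i x))) \<and> \<not> b ((f ^^ n) (i x)) \<and>
      (\<forall>j \<le> n. sz ((f ^^ j) (i x)) \<le> q (sz x)) \<and> h x = (f ^^ n) (i x)"
  shows "pt h"
proof -
  obtain B r where B: "poly r" "\<And>x a. exec B (mem (code x @ a)) (mem (code (b x) @ a)) (r (sz x))"
    using ptE[OF assms(1)] by metis
  obtain F p where F: "poly p" "\<And>x a. exec F (mem (code x @ a)) (mem (code (f x) @ a)) (p (sz x))"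
    using ptE[OF assms(2)] by metis
  obtain I e where I: "poly e" "\<And>x a. exec I (mem (code x @ a)) (mem (code (i x) @ a)) (e (sz x))"
    using ptE[OF assms(3)] by metis
  let ?pop = "[Pop RA 1 1 1]"
  let ?body = "dupC @ B @ caseC RA [] [] (?pop @ ?pop @ F @ [Push RF True])"
  let ?t = "\<lambda>n. 40 * n + 40 + (r n + (p n + 6))"
  have t: "poly ?t" by (intro poly_intros F(1) B(1))
  \<comment> \<open>The step subtracted from \<open>?t\<close> is the test of \<open>RF\<close> that
    closes the round.\<close>
  have step: "exec ?body (mem (code y @ a)) (if b y then (mem (code (f y) @ a))(RF := [True]) else mem (code y @ a)) (?t (sz y) - 1)" for y a
  proof -
    have "exec (caseC RA [] [] (?pop @ ?pop @ F @ [Push RF True])) (mem (code (b y) @ code y @ a))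
        (if b y then (mem (code (f y) @ a))(RF := [True]) else mem (code y @ a)) (p (sz y) + 5)"
    proof (cases "b y")
      case True
      have "exec (?pop @ ?pop @ F @ [Push RF True]) (mem (False # False # code y @ a)) ((mem (code (f y) @ a))(RF := [True])) (1 + (1 + (p (sz y) + 1)))"
        using exec_append[OF exec_Pop_mem exec_append[OF exec_Pop_mem exec_append[OF F(2) exec_Push[of RF]]]] by simp
      then show ?thesis using True
        by (auto intro!: exec_mono[OF exec_caseC_True] simp: tree_of_bool_def)
    next
      case False
      then show ?thesis
        by (auto intro!: exec_mono[OF exec_caseC_False] exec_Nil simp: tree_of_bool_def)
    qed
    from exec_append[OF exec_dupC exec_append[OF B(2) this]] show ?thesis by (simp add: sz_def)
  qed
  have loop: "exec (loopC RF ?body) (mem (code y @ a)) (mem (code ((f ^^ n) y) @ a)) ((n + 1) * ?t S)"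
    if "\<forall>j < n. b ((f ^^ j) y)" "\<not> b ((f ^^ n) y)" "\<forall>j \<le> n. sz ((f ^^ j) y) \<le> S" for n y S a
    using that
  proof (induction n arbitrary: y)
    case 0
    then have "?t (sz y) \<le> ?t S" using poly_mono[OF t] by simp
    then show ?case using step[of y a] 0
      by (intro exec_mono[OF exec_loopC_exit[of _ _ _ "?t (sz y) - 1"]]) auto
  next
    case (Suc n)
    have sh: "(f ^^ j) (f y) = (f ^^ Suc j) y" for j by (simp add: funpow_swap1)
    have IH: "exec (loopC RF ?body) (mem (code (f y) @ a)) (mem (code ((f ^^ n) (f y)) @ a)) ((n + 1) * ?t S)"
      by (rule Suc.IH) (use Suc.prems in \<open>simp_all add: sh del: funpow.simps\<close>)
    have "?t (sz y) \<le> ?t S" using poly_mono[OF t] Suc.prems(3) by force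
    moreover have body: "exec ?body (mem (code y @ a)) ((mem (code (f y) @ a))(RF := [True])) (?t (sz y) - 1)"
      using step[of y a] Suc.prems(1) by force
    have upd: "(mem (code (f y) @ a))(RF := [True], RF := []) = mem (code (f y) @ a)"
      by (auto simp: fun_eq_iff mem_def)
    have "exec (loopC RF ?body) (mem (code y @ a)) (mem (code ((f ^^ n) (f y)) @ a)) (?t (sz y) - 1 + 1 + (n + 1) * ?t S)"
      by (rule exec_loopC_repeat[OF body, where xs = "[]"], simp, unfold upd, rule IH)
    ultimately show ?case by (auto elim!: exec_mono simp: funpow_swap1)
  qed
  let ?T = "\<lambda>n. e n + (q n + 1) * ?t (q n)"
  show ?thesis
  proof (rule ptI[of ?T "I @ loopC RF ?body"])
    show "poly ?T" by (intro poly_add poly_mult poly_const I(1) assms(4) poly_comp[OF t])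
    show "exec (I @ loopC RF ?body) (mem (code x @ a)) (mem (code (h x) @ a)) (?T (sz x))" for x a
    proof -
      obtain n where n: "n \<le> q (sz x)" "\<forall>j < n. b ((f ^^ j) (i x))" "\<not> b ((f ^^ n) (i x))"
        "\<forall>j \<le> n. sz ((f ^^ j) (i x)) \<le> q (sz x)" "h x = (f ^^ n) (i x)" using assms(5) by blast
      show ?thesis unfolding n(5)
        by (rule exec_mono[OF exec_append[OF I(2) loop[OF n(2-4)]]]) (use n(1) in \<open>auto intro!: mult_right_mono\<close>)
    qed
  qed
qed

lemma foldl_funpow:
  assumes "j \<le> length es"
  shows "((\<lambda>z. (fst z, tl (fst (snd z)), g (fst z) (snd (snd z)) (hd (fst (snd z))))) ^^ j) (x, es, s)
    = (x, drop j es, foldl (g x) s (take j es))"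
  using assms
proof (induction j)
  case (Suc j)
  then show ?case by (simp add: take_Suc_conv_app_nth hd_drop_conv_nth drop_Suc tl_drop)
qed simp

text \<open>The growth is additive, with a summand independent of the accumulator; a step that
  doubled the accumulator would reach exponential size after linearly many rounds.\<close>

lemma pt_foldl:
  fixes g :: "'a::treeable \<Rightarrow> 's::treeable \<Rightarrow> 'e::treeable \<Rightarrow> 's"
  assumes g: "pt (\<lambda>z. g (fst z) (fst (snd z)) (snd (snd z)))" and s: "pt s" and xs: "pt xs" and q: "poly q"
    and bound: "\<And>x t e. e \<in> set (xs x) \<Longrightarrow> sz (g x t e) \<le> sz t + q (sz x)"
  shows "pt (\<lambda>x. foldl (g x) (s x) (xs x))"
proof -
  obtain p1 where p1: "poly p1" "\<And>x. sz (xs x) \<le> p1 (sz x)" using pt_size[OF xs] by metis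
  obtain p2 where p2: "poly p2" "\<And>x. sz (s x) \<le> p2 (sz x)" using pt_size[OF s] by metis
  let ?f = "\<lambda>z :: 'a \<times> 'e list \<times> 's. (fst z, tl (fst (snd z)), g (fst z) (snd (snd z)) (hd (fst (snd z))))"
  let ?b = "\<lambda>z :: 'a \<times> 'e list \<times> 's. \<not> fst (snd z) = []"
  let ?i = "\<lambda>x. (x, xs x, s x)"
  let ?q = "\<lambda>n. n + p1 n + (p2 n + p1 n * q n) + 2"
  have size: "sz (foldl (g x) t es) \<le> sz t + length es * q (sz x)" if "set es \<subseteq> set (xs x)" for x t es
    using that
  proof (induction es arbitrary: t)
    case (Cons e es)
    then have "sz (foldl (g x) (g x t e) es) \<le> sz (g x t e) + length es * q (sz x)" by simp
    moreover have "sz (g x t e) \<le> sz t + q (sz x)" using bound Cons.prems by simp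
    ultimately show ?case by simp
  qed simp
  have "pt (\<lambda>x. (x, [] :: 'e list, foldl (g x) (s x) (xs x)))"
  proof (rule pt_while[of ?b ?f ?i ?q])
    show "pt ?b" by (intro pt_not pt_null pt_fst pt_snd pt_id)
    have "pt (\<lambda>z :: 'a \<times> 'e list \<times> 's. g (fst z) (snd (snd z)) (hd (fst (snd z))))"
      using pt_comp[OF g pt_pair[OF pt_fst[OF pt_id] pt_pair[OF pt_snd[OF pt_snd[OF pt_id]] pt_hd[OF pt_fst[OF pt_snd[OF pt_id]]]]]]
      by simp
    then show "pt ?f" by (intro pt_pair pt_fst pt_id pt_tl pt_snd)
    show "pt ?i" by (intro pt_pair pt_id xs s)
    show "poly ?q" by (intro poly_intros p1 p2 q)
    fix x
    let ?n = "length (xs x)"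
    have n1: "?n \<le> p1 (sz x)" using length_le_sz[of "xs x"] p1(2)[of x] by simp
    have "sz ((?f ^^ j) (?i x)) \<le> ?q (sz x)" if j: "j \<le> ?n" for j
    proof -
      have 1: "sz (drop j (xs x)) \<le> p1 (sz x)"
        using sz_append[of "take j (xs x)" "drop j (xs x)"] sz_pos[of "take j (xs x)"] p1(2)[of x] by simp
      have "sz (foldl (g x) (s x) (take j (xs x))) \<le> sz (s x) + length (take j (xs x)) * q (sz x)"
        by (rule size) (meson set_take_subset)
      also have "\<dots> \<le> p2 (sz x) + p1 (sz x) * q (sz x)"
        using n1 p2(2)[of x] by (intro add_mono mult_right_mono) auto
      finally show ?thesis using 1 by (simp only: foldl_funpow[OF j] sz_simps)
    qed
    then show "\<exists>n\<le>?q (sz x). (\<forall>j<n. ?b ((?f ^^ j) (?i x))) \<and> \<not> ?b ((?f ^^ n) (?i x)) \<and>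
         (\<forall>j\<le>n. sz ((?f ^^ j) (?i x)) \<le> ?q (sz x)) \<and> (x, [], foldl (g x) (s x) (xs x)) = (?f ^^ n) (?i x)"
      using n1 by (intro exI[of _ ?n]) (simp add: foldl_funpow)
  qed
  from pt_snd[OF pt_snd[OF this]] show ?thesis by simp
qed

lemmas pt_intros = pt_pair pt_fst pt_snd pt_if pt_Cons pt_Suc pt_not pt_conj pt_null pt_hd pt_tl

lemma pt_comp2:
  assumes "pt (\<lambda>z. h (fst z) (snd z))" "pt f" "pt g"
  shows "pt (\<lambda>x. h (f x) (g x))"
  using pt_comp[OF assms(1) pt_pair[OF assms(2,3)]] by simp

text \<open>The growth may also depend on the element, since an element is no larger than the list
  containing it.\<close>

lemma pt_foldl_elem:
  assumes g: "pt (\<lambda>z. g (fst z) (fst (snd z)) (snd (snd z)))" and s: "pt s" and xs: "pt xs" and q: "poly q"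
    and bound: "\<And>x t e. sz (g x t e) \<le> sz t + q (sz x + sz e)"
  shows "pt (\<lambda>x. foldl (g x) (s x) (xs x))"
proof -
  obtain p where p: "poly p" "\<And>x. sz (xs x) \<le> p (sz x)" using pt_size[OF xs] by metis
  show ?thesis
  proof (rule pt_foldl[OF g s xs])
    show "poly (\<lambda>n. q (n + p n))" by (intro poly_comp[OF q] poly_intros p(1))
    show "sz (g x t e) \<le> sz t + q (sz x + p (sz x))" if "e \<in> set (xs x)" for x t e
      using bound[of x t e] sz_member[OF that] p(2)[of x] poly_mono[OF q, of "sz x + sz e" "sz x + p (sz x)"] by simp
  qed
qed

section \<open>A library of polynomial-time functions\<close>

lemma pt_rev: assumes "pt f" shows "pt (\<lambda>x. rev (f x))"
proof (rule pt_cong)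
  show "pt (\<lambda>x. foldl (\<lambda>s e. e # s) [] (f x))"
    by (rule pt_foldl_elem[of "\<lambda>_ s e. e # s", where q = "\<lambda>n. n + 1"])
      (intro pt_intros pt_id pt_const assms poly_intros | simp)+
qed (simp add: foldl_conv_fold rev_conv_fold)

lemma pt_append: assumes "pt f" "pt g" shows "pt (\<lambda>x. f x @ g x)"
proof (rule pt_cong)
  show "pt (\<lambda>x. foldl (\<lambda>s e. e # s) (g x) (rev (f x)))"
    by (rule pt_foldl_elem[of "\<lambda>_ s e. e # s", where q = "\<lambda>n. n + 1"])
      (intro pt_intros pt_rev pt_id pt_const assms poly_intros | simp)+
qed (simp add: foldl_conv_fold fold_Cons_rev)

lemma foldl_map_Cons: "foldl (\<lambda>s e. h e # s) ys zs = rev (map h zs) @ ys"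
  by (induction zs arbitrary: ys) auto

lemma foldl_filter_Cons: "foldl (\<lambda>s e. if h e then e # s else s) ys zs = rev (filter h zs) @ ys"
  by (induction zs arbitrary: ys) auto

lemma foldl_append_concat: "foldl (\<lambda>s e. s @ e) ys zs = ys @ concat zs"
  by (induction zs arbitrary: ys) auto

lemma foldl_Suc_length: "foldl (\<lambda>s e. Suc s) m xs = m + length xs"
  by (induction xs arbitrary: m) auto

lemma pt_map:
  assumes "pt (\<lambda>z. g (fst z) (snd z))" "pt xs"
  shows "pt (\<lambda>x. map (g x) (xs x))"
proof (rule pt_cong)
  obtain p where p: "poly p" "\<And>z. sz (g (fst z) (snd z)) \<le> p (sz z)" using pt_size[OF assms(1)] by metis
  have "sz (g x e # s) \<le> sz s + (p (sz x + sz e + 1) + 1)" for x e s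
    using p(2)[of "(x, e)"] by simp
  then have "pt (\<lambda>x. foldl (\<lambda>s e. g x e # s) [] (xs x))"
    by (intro pt_foldl_elem[of "\<lambda>x s e. g x e # s", where q = "\<lambda>n. p (n + 1) + 1"] pt_Cons
        pt_comp2[OF assms(1)] pt_fst pt_snd pt_id pt_const assms(2) poly_intros poly_comp[OF p(1)])
  then show "pt (\<lambda>x. rev (foldl (\<lambda>s e. g x e # s) [] (xs x)))" by (rule pt_rev)
qed (simp add: foldl_map_Cons)

lemma pt_filter:
  assumes "pt (\<lambda>z. g (fst z) (snd z))" "pt xs"
  shows "pt (\<lambda>x. filter (g x) (xs x))"
proof (rule pt_cong)
  have "pt (\<lambda>x. foldl (\<lambda>s e. if g x e then e # s else s) [] (xs x))"
    by (rule pt_foldl_elem[of "\<lambda>x s e. if g x e then e # s else s", where q = "\<lambda>n. n + 1"])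
      (intro pt_if pt_Cons pt_comp2[OF assms(1)] pt_fst pt_snd pt_id pt_const assms(2) poly_intros | simp)+
  then show "pt (\<lambda>x. rev (foldl (\<lambda>s e. if g x e then e # s else s) [] (xs x)))" by (rule pt_rev)
qed (simp add: foldl_filter_Cons)

lemma pt_concat: assumes "pt f" shows "pt (\<lambda>x. concat (f x))"
proof (rule pt_cong)
  have "sz (s @ e) \<le> sz s + sz e" for s e :: "'b list" using sz_append[of s e] by simp
  then show "pt (\<lambda>x. foldl (\<lambda>s e. s @ e) [] (f x))"
    by (intro pt_foldl_elem[of "\<lambda>_ s e. s @ e", where q = "\<lambda>n. n"] pt_append pt_fst pt_snd pt_id pt_const assms poly_intros)
      (simp add: trans_le_add2 add.left_commute)
qed (simp add: foldl_append_concat)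

lemma pt_add: assumes "pt f" "pt g" shows "pt (\<lambda>x. f x + (g x :: nat))"
proof (rule pt_cong)
  show "pt (\<lambda>x. foldl (\<lambda>s e. Suc s) (f x) (replicate (g x) ()))"
    by (rule pt_foldl_elem[of "\<lambda>_ s e. Suc s", where q = "\<lambda>n. 2"])
      (intro pt_intros pt_units pt_id pt_const assms poly_intros | simp)+
qed (simp add: foldl_Suc_length)

lemma pt_length: assumes "pt f" shows "pt (\<lambda>x. length (f x))"
proof (rule pt_cong)
  show "pt (\<lambda>x. foldl (\<lambda>s e. Suc s) 0 (f x))"
    by (rule pt_foldl_elem[of "\<lambda>_ s e. Suc s", where q = "\<lambda>n. 2"])
      (intro pt_intros pt_id pt_const assms poly_intros | simp)+
qed (simp add: foldl_Suc_length)

lemma sz_tl_le: "sz (tl xs) \<le> sz xs"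
  by (cases xs) auto

lemma pt_drop: assumes "pt f" "pt g" shows "pt (\<lambda>x. drop (f x) (g x))"
proof (rule pt_cong)
  show "pt (\<lambda>x. foldl (\<lambda>s e. tl s) (g x) (replicate (f x) ()))"
    by (rule pt_foldl_elem[of "\<lambda>_ s e. tl s", where q = "\<lambda>n. 0"])
      (intro pt_intros pt_units pt_id pt_const assms poly_intros | simp add: sz_tl_le)+
  have "foldl (\<lambda>s e. tl s) xs (replicate n ()) = drop n xs" for n and xs :: "'b list"
    by (induction n arbitrary: xs) (auto simp: drop_Suc)
  then show "foldl (\<lambda>s e. tl s) (g x) (replicate (f x) ()) = drop (f x) (g x)" for x by simp
qed

lemma pt_less: assumes "pt f" "pt g" shows "pt (\<lambda>x. f x < (g x :: nat))"
  by (rule pt_cong[of "\<lambda>x. \<not> drop (f x) (replicate (g x) ()) = []"], intro pt_intros pt_drop pt_units assms, auto)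

lemma pt_diff: assumes "pt f" "pt g" shows "pt (\<lambda>x. f x - (g x :: nat))"
  by (rule pt_cong[of "\<lambda>x. length (drop (g x) (replicate (f x) ()))"], intro pt_length pt_drop pt_units assms, auto)

lemma pt_eq_nat: assumes "pt f" "pt g" shows "pt (\<lambda>x. f x = (g x :: nat))"
  by (rule pt_cong[of "\<lambda>x. \<not> f x < g x \<and> \<not> g x < f x"], intro pt_intros pt_less assms, auto)

lemma pt_min: assumes "pt f" "pt g" shows "pt (\<lambda>x. min (f x) (g x :: nat))"
  by (rule pt_cong[of "\<lambda>x. if f x < g x then f x else g x"], intro pt_intros pt_less assms, auto)

lemma pt_take: assumes "pt f" "pt g" shows "pt (\<lambda>x. take (f x) (g x))"
proof (rule pt_cong)
  show "pt (\<lambda>x. rev (drop (length (g x) - f x) (rev (g x))))"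
    by (intro pt_rev pt_drop pt_diff pt_length assms)
  show "rev (drop (length (g x) - f x) (rev (g x))) = take (f x) (g x)" for x
    by (cases "f x \<le> length (g x)") (auto simp: rev_drop)
qed

lemma pt_list_all:
  assumes "pt (\<lambda>z. g (fst z) (snd z))" "pt xs"
  shows "pt (\<lambda>x. list_all (g x) (xs x))"
proof (rule pt_cong)
  show "pt (\<lambda>x. foldl (\<lambda>s e. s \<and> g x e) True (xs x))"
    by (rule pt_foldl_elem[of "\<lambda>x s e. s \<and> g x e", where q = "\<lambda>n. 3"])
      (intro pt_conj pt_comp2[OF assms(1)] pt_fst pt_snd pt_id pt_const assms(2) poly_intros | simp add: trans_le_add2 sz_bool_le)+
  have "foldl (\<lambda>s e. s \<and> h e) b zs \<longleftrightarrow> b \<and> list_all h zs" for h :: "'b \<Rightarrow> bool" and b zs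
    by (induction zs arbitrary: b) auto
  then show "foldl (\<lambda>s e. s \<and> g x e) True (xs x) = list_all (g x) (xs x)" for x by simp
qed

lemma pt_list_ex:
  assumes "pt (\<lambda>z. g (fst z) (snd z))" "pt xs"
  shows "pt (\<lambda>x. list_ex (g x) (xs x))"
  by (rule pt_cong[of "\<lambda>x. \<not> list_all (\<lambda>y. \<not> g x y) (xs x)"],
      intro pt_not pt_list_all assms, auto simp: list_ex_iff list_all_iff)

lemma pt_upt': "pt (\<lambda>n. [0..<n])"
proof (rule pt_cong)
  \<comment> \<open>The number consed on is always \<open>length s\<close>; the minimum with
    \<open>n\<close> caps its size independently of the accumulator, as the fold rule
    demands.\<close>
  show "pt (\<lambda>n. rev (foldl (\<lambda>s e. min n (length s) # s) [] (replicate n ())))"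
    by (rule pt_rev, rule pt_foldl_elem[of "\<lambda>n s e. min n (length s) # s", where q = "\<lambda>n. 2 * n + 2"])
      (intro pt_intros pt_min pt_length pt_units pt_id pt_const poly_intros | simp)+
  have "foldl (\<lambda>s e. min n (length s) # s) [] (replicate k ()) = rev [0..<k]" if "k \<le> n" for k n
    using that
  proof (induction k)
    case (Suc k)
    have "replicate (Suc k) () = replicate k () @ [()]" by (simp add: replicate_append_same)
    then show ?case using Suc by simp
  qed simp
  then show "rev (foldl (\<lambda>s e. min n (length s) # s) [] (replicate n ())) = [0..<n]" for n by simp
qed

lemmas pt_upt = pt_comp[OF pt_upt']

lemma pt_replicate: assumes "pt f" "pt g" shows "pt (\<lambda>x. replicate (f x) (g x))"
  by (rule pt_cong[of "\<lambda>x. map (\<lambda>_. g x) [0..<f x]"],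
      intro pt_map pt_upt pt_comp[OF assms(2)] pt_fst pt_id assms(1), auto simp: map_replicate_trivial)

lemma pt_eq_bits: assumes "pt f" "pt g" shows "pt (\<lambda>x. f x = (g x :: bool list))"
proof (rule pt_cong)
  let ?h = "\<lambda>s e. (tl (fst s), snd s \<and> \<not> fst s = [] \<and> hd (fst s) = (e::bool))"
  have b: "sz (?h s e) \<le> sz s + 3" for s e
    using sz_tl_le[of "fst s"] sz_bool_le[of "snd s \<and> fst s \<noteq> [] \<and> hd (fst s) = e"] by (cases s) simp
  have "pt (\<lambda>x. foldl ?h (g x, True) (f x))"
    by (rule pt_foldl_elem[of "\<lambda>_. ?h", where q = "\<lambda>n. 3"])
      (intro pt_intros pt_eq_bool pt_id pt_const assms poly_intros b)+
  then show "pt (\<lambda>x. fst (foldl ?h (g x, True) (f x)) = [] \<and> snd (foldl ?h (g x, True) (f x)))"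
    by (intro pt_intros)
  have "fst (foldl ?h (ys, b) xs) = [] \<and> snd (foldl ?h (ys, b) xs) \<longleftrightarrow> b \<and> xs = ys" for xs ys b
  proof (induction xs arbitrary: ys b)
    case (Cons x xs)
    show ?case by (cases ys) (auto simp: Cons.IH)
  qed auto
  then show "(fst (foldl ?h (g x, True) (f x)) = [] \<and> snd (foldl ?h (g x, True) (f x))) = (f x = g x)" for x by simp
qed

section \<open>From tree-encoded functions to Turing machines\<close>

text \<open>Stack \<open>RI\<close> yields the last input bit first, and consing in that order
  restores the word. The pushes spell the code of the new cons cell backwards.\<close>

definition readC :: "instr list" where
  "readC = Push RA False # loopC RF (caseC RI []
     [Push RA False, Push RA True, Push RF True]
     [Push RA False, Push RA False, Push RA True, Push RA True, Push RF True])"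

lemma exec_readC: "exec readC ((\<lambda>_. [])(RI := rev w)) (mem (code w)) (10 * length w + 4)"
proof -
  let ?B = "caseC RI [] [Push RA False, Push RA True, Push RF True]
     [Push RA False, Push RA False, Push RA True, Push RA True, Push RF True]"
  have loop: "exec (loopC RF ?B) ((mem (code ys))(RI := xs)) (mem (code (rev xs @ ys))) (10 * length xs + 3)" for xs ys
  proof (induction xs arbitrary: ys)
    case Nil
    have eq: "(mem (code ys))(RI := []) = mem (code ys)" by (auto simp: fun_eq_iff)
    have "exec ?B (mem (code ys)) (mem (code ys)) (0 + 2)"
      by (rule exec_caseC_Nil[OF _ exec_Nil]) simp
    from exec_loopC_exit[OF this, of RF] show ?case by (simp add: eq numeral_3_eq_3)
  next
    case (Cons b xs)
    let ?s = "((mem (code ys))(RI := b # xs))(RI := xs)"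
    let ?s1 = "(mem (code (b # ys)))(RI := xs, RF := [True])"
    have "exec ?B ((mem (code ys))(RI := b # xs)) ?s1 (5 + 2)"
    proof (cases b)
      case True
      have "exec [Push RA False, Push RA False, Push RA True, Push RA True, Push RF True] ?s ?s1 5"
        by (rule exec_cong[OF exec_PushCons[OF exec_PushCons[OF exec_PushCons[OF exec_PushCons[OF exec_PushCons[OF exec_Nil]]]]]])
          (use True in \<open>auto simp: fun_eq_iff tree_of_bool_def mem_def\<close>)
      then show ?thesis by (rule exec_caseC_True[rotated]) (simp add: True)
    next
      case False
      have "exec [Push RA False, Push RA True, Push RF True] ?s ?s1 5"
        by (rule exec_cong[OF exec_PushCons[OF exec_PushCons[OF exec_PushCons[OF exec_Nil]]]])
          (use False in \<open>auto simp: fun_eq_iff tree_of_bool_def mem_def\<close>)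
      then show ?thesis by (rule exec_caseC_False[rotated]) (simp add: False)
    qed
    moreover have "?s1 RF = True # []" by simp
    moreover have upd: "?s1(RF := []) = (mem (code (b # ys)))(RI := xs)" by (auto simp: fun_eq_iff)
    have "exec (loopC RF ?B) (?s1(RF := [])) (mem (code (rev xs @ b # ys))) (10 * length xs + 3)"
      unfolding upd by (rule Cons.IH)
    ultimately have "exec (loopC RF ?B) ((mem (code ys))(RI := b # xs)) (mem (code (rev xs @ b # ys))) (5 + 2 + 1 + (10 * length xs + 3))"
      by (rule exec_loopC_repeat)
    then show ?case by (rule exec_cong) auto
  qed
  have init: "((\<lambda>_. [])(RI := rev w))(RA := False # ((\<lambda>_. [])(RI := rev w)) RA) = (mem (code ([]::bool list)))(RI := rev w)"
    by (auto simp: fun_eq_iff mem_def)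
  have "exec (loopC RF ?B) ((mem (code ([]::bool list)))(RI := rev w)) (mem (code (rev (rev w) @ []))) (10 * length (rev w) + 3)"
    by (rule loop)
  then have "exec (loopC RF ?B) ((mem (code ([]::bool list)))(RI := rev w)) (mem (code w)) (10 * length w + 3)" by simp
  from exec_PushCons[of _ "(\<lambda>_. [])(RI := rev w)" RA False, unfolded init, OF this]
  show ?thesis unfolding readC_def by (simp add: add.commute)
qed

text \<open>Consuming the list from its head puts the first output bit at the bottom of
  \<open>RI\<close>, that is at cell 0, where the machine halts.\<close>

definition writeC :: "instr list" where
  "writeC = loopC RF (caseC RA [] [] (caseC RA [] [Push RI False, Push RF True]
     ([Pop RA 1 1 1] @ [Pop RA 1 1 1] @ [Push RI True, Push RF True])))"

lemma exec_Pop: "s r = b # xs \<Longrightarrow> exec [Pop r 1 1 1] s (s(r := xs)) 1"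
  unfolding exec_def by (auto intro!: exI[of _ 1] runs_one[of 0, unfolded One_nat_def])

lemma exec_writeC: "exec writeC ((mem (code xs))(RI := ys)) ((\<lambda>_. [])(RI := rev xs @ ys)) (12 * length xs + 3)"
proof (induction xs arbitrary: ys)
  case Nil
  let ?s = "(mem (code ([]::bool list)))(RI := ys)"
  have "exec (caseC RA [] [] (caseC RA [] [Push RI False, Push RF True]
     ([Pop RA 1 1 1] @ [Pop RA 1 1 1] @ [Push RI True, Push RF True]))) ?s (?s(RA := [])) (0 + 2)"
    by (rule exec_caseC_False[OF _ exec_Nil]) simp
  from exec_loopC_exit[OF this, of RF] have "exec writeC ?s (?s(RA := [])) 3"
    unfolding writeC_def by (simp add: numeral_3_eq_3)
  then show ?case by (rule exec_cong) (auto simp: fun_eq_iff mem_def)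
next
  case (Cons b xs)
  let ?s = "(mem (code (b # xs)))(RI := ys)"
  let ?t = "(mem (code b @ code xs))(RI := ys)"
  let ?s1 = "(mem (code xs))(RI := b # ys, RF := [True])"
  have inner: "exec (caseC RA [] [Push RI False, Push RF True]
     ([Pop RA 1 1 1] @ [Pop RA 1 1 1] @ [Push RI True, Push RF True])) ?t ?s1 (4 + 2)"
  proof (cases b)
    case True
    have 1: "exec [Push RI True, Push RF True] ((mem (code xs))(RI := ys)) ?s1 (0 + 1 + 1)"
      by (rule exec_cong[OF exec_PushCons[OF exec_PushCons[OF exec_Nil]]])
        (use True in \<open>auto simp: fun_eq_iff mem_def\<close>)
    have 2: "exec [Pop RA 1 1 1] ((mem (False # code xs))(RI := ys)) ((mem (code xs))(RI := ys)) 1"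
      by (rule exec_cong[OF exec_Pop]) (auto simp: fun_eq_iff mem_def)
    have 3: "exec [Pop RA 1 1 1] ((mem (False # False # code xs))(RI := ys)) ((mem (False # code xs))(RI := ys)) 1"
      by (rule exec_cong[OF exec_Pop]) (auto simp: fun_eq_iff mem_def)
    have upd: "?t(RA := False # False # code xs) = (mem (False # False # code xs))(RI := ys)"
      by (auto simp: fun_eq_iff mem_def)
    have "exec ([Pop RA 1 1 1] @ [Pop RA 1 1 1] @ [Push RI True, Push RF True])
      (?t(RA := False # False # code xs)) ?s1 (1 + (1 + (0 + 1 + 1)))"
      unfolding upd by (rule exec_append[OF 3 exec_append[OF 2 1]])
    then have "exec (caseC RA [] [Push RI False, Push RF True]
     ([Pop RA 1 1 1] @ [Pop RA 1 1 1] @ [Push RI True, Push RF True])) ?t ?s1 (1 + (1 + (0 + 1 + 1)) + 2)"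
      by (rule exec_caseC_True[rotated]) (use True in \<open>simp add: tree_of_bool_def\<close>)
    then show ?thesis by (rule exec_mono) simp
  next
    case False
    have "exec [Push RI False, Push RF True] (?t(RA := code xs)) ?s1 (0 + 1 + 1)"
      by (rule exec_cong[OF exec_PushCons[OF exec_PushCons[OF exec_Nil]]])
        (use False in \<open>auto simp: fun_eq_iff mem_def\<close>)
    then have "exec (caseC RA [] [Push RI False, Push RF True]
     ([Pop RA 1 1 1] @ [Pop RA 1 1 1] @ [Push RI True, Push RF True])) ?t ?s1 (0 + 1 + 1 + 2)"
      by (rule exec_caseC_False[rotated]) (use False in \<open>simp add: tree_of_bool_def\<close>)
    then show ?thesis by (rule exec_mono) simp
  qed
  have upd0: "?s(RA := code b @ code xs) = ?t" by (auto simp: fun_eq_iff mem_def)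
  have body: "exec (caseC RA [] [] (caseC RA [] [Push RI False, Push RF True]
     ([Pop RA 1 1 1] @ [Pop RA 1 1 1] @ [Push RI True, Push RF True]))) ?s ?s1 (4 + 2 + 2)"
    by (rule exec_caseC_True[OF _ inner[folded upd0]]) simp
  have upd: "?s1(RF := []) = (mem (code xs))(RI := b # ys)" by (auto simp: fun_eq_iff)
  have "exec writeC ?s ((\<lambda>_. [])(RI := rev xs @ b # ys)) (4 + 2 + 2 + 1 + (12 * length xs + 3))"
    unfolding writeC_def
    by (rule exec_loopC_repeat[OF body, where xs = "[]"], simp, unfold upd, fold writeC_def, rule Cons.IH)
  then show ?case by (rule exec_cong) auto
qed

lemma sz_bits_le: "sz (w :: bool list) \<le> 4 * length w + 1"
proof (induction w)
  case (Cons b w)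
  then show ?case using sz_bool_le[of b] by simp
qed simp

theorem poly_time_computable_if_pt:
  fixes f :: "bool list \<Rightarrow> bool list"
  assumes "pt f"
  shows "poly_time_computable f"
proof -
  obtain F p where F: "poly p" "\<And>x a. exec F (mem (code x @ a)) (mem (code (f x) @ a)) (p (sz x))"
    "\<And>x. sz (f x) \<le> sz x + p (sz x)" using ptE[OF assms] by metis
  let ?P = "readC @ F @ writeC"
  let ?S = "\<lambda>n. 4 * n + 1"
  let ?t = "\<lambda>n. 10 * n + 4 + (p (?S n) + (12 * (?S n + p (?S n)) + 3))"
  let ?T = "\<lambda>n. ?t n * (2 * (n + ?t n) + 4)"
  have polyT: "poly ?T" by (intro poly_add poly_mult poly_const poly_id poly_comp[OF F(1)])
  then obtain c k where ck: "\<And>n. ?T n \<le> c * n ^ k + c" unfolding poly_def by blast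
  have "computes_in_time (tm_of ?P) f (\<lambda>n. c * n ^ k + c)"
    unfolding computes_in_time_def
  proof
    fix w :: "bool list"
    let ?n = "length w"
    let ?s0 = "(\<lambda>_. [])(RI := rev w) :: store" and ?s1 = "(\<lambda>_. [])(RI := rev (f w)) :: store"
    have szw: "sz w \<le> ?S ?n" by (rule sz_bits_le)
    have len: "length (f w) \<le> ?S ?n + p (?S ?n)"
      using length_le_sz[of "f w"] F(3)[of w] szw poly_mono[OF F(1) szw] by linarith
    have F': "exec F (mem (code w)) (mem (code (f w))) (p (?S ?n))"
      using exec_mono[OF F(2)[of w "[]"] poly_mono[OF F(1) szw]] by simp
    have nil: "(mem (code (f w)))(RI := []) = mem (code (f w))" by (auto simp: fun_eq_iff)
    have W: "exec writeC (mem (code (f w))) ?s1 (12 * (?S ?n + p (?S ?n)) + 3)"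
      using exec_mono[OF exec_writeC[of "f w" "[]", unfolded nil]] len by simp
    have "exec ?P ?s0 ?s1 (?t ?n)" by (rule exec_append[OF exec_readC exec_append[OF F' W]])
    then obtain t where t: "t \<le> ?t ?n" "runs ?P (0, ?s0) t (int (length ?P), ?s1)"
      unfolding exec_def by blast
    have "\<exists>u \<le> t * (2 * (?n + ?t ?n) + 4). (tm_step (tm_of ?P) ^^ u) (0, 0, tape_of (snd (0::int, ?s0))) = (1, 0, tape_of (snd (int (length ?P), ?s1)))"
      by (rule tm_simulates_runs[OF t(2)]) (use t(1) in \<open>auto simp: tm_pc_def tm_phase_def readC_def\<close>)
    then obtain u where u: "u \<le> t * (2 * (?n + ?t ?n) + 4)"
      "(tm_step (tm_of ?P) ^^ u) (0, 0, tape_of ?s0) = (1, 0, tape_of ?s1)" by auto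
    have tape: "tape_of ((\<lambda>_. [])(RI := rev v)) i = (if 0 \<le> i \<and> i < int (length v) then bitsym (v ! nat i) else 0)" for v i
      by (simp add: tape_of_def cell_enc_def sym_at_def)
    then have init: "init_config w = (0, 0, tape_of ?s0)" by (auto simp: init_config_def)
    have "u \<le> ?T ?n" using u(1) t(1) mult_right_mono[OF t(1), of "2 * (?n + ?t ?n) + 4"] by linarith
    then have "u \<le> c * ?n ^ k + c" using ck[of ?n] by linarith
    then show "\<exists>t\<le>c * ?n ^ k + c. case (tm_step (tm_of ?P) ^^ t) (init_config w) of (q, p, tp) \<Rightarrow>
        q = 1 \<and> (\<forall>i<length (f w). tp (p + int i) = bitsym (f w ! i)) \<and> tp (p + int (length (f w))) = 0"
      using u(2) by (intro exI[of _ u]) (simp add: init tape)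
  qed
  moreover have "wf_tm (tm_of ?P)" by (rule wf_tm_of) (simp add: readC_def)
  ultimately show ?thesis unfolding poly_time_computable_def by blast
qed

section \<open>Binary numerals\<close>

lemmas pt_all = pt_intros pt_id pt_const pt_rev pt_append pt_concat pt_add pt_length pt_drop pt_less pt_eq_nat
  pt_take pt_upt pt_replicate pt_eq_bits

fun digits :: "nat \<Rightarrow> bool list" where
  "digits n = (if n = 0 then [] else odd n # digits (n div 2))"

declare digits.simps [simp del]

lemma digits_0 [simp]: "digits 0 = []"
  by (simp add: digits.simps)

lemma digits_pos: "n > 0 \<Longrightarrow> digits n = odd n # digits (n div 2)"
  by (subst digits.simps) simp

lemma digits_eq_Nil_iff [simp]: "digits n = [] \<longleftrightarrow> n = 0"
  by (subst digits.simps) simp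

primrec digits_val :: "bool list \<Rightarrow> nat" where
  "digits_val [] = 0"
| "digits_val (d # ds) = of_bool d + 2 * digits_val ds"

lemma digits_val_digits [simp]: "digits_val (digits n) = n"
proof (induction n rule: digits.induct)
  case (1 n)
  show ?case
  proof (cases "n = 0")
    case False
    then show ?thesis using 1 by (simp add: digits_pos)
  qed simp
qed

lemma digits_inject: "digits m = digits n \<longleftrightarrow> m = n"
  by (metis digits_val_digits)

text \<open>Digits come least significant first, so the canonical numerals are those whose last
  entry is \<open>True\<close>.\<close>

lemma digits_digits_val: "(ds = [] \<or> last ds) \<Longrightarrow> digits (digits_val ds) = ds"
proof (induction ds)
  case (Cons d ds)
  have "digits (digits_val ds) = ds" using Cons by (cases ds) auto
  moreover have "digits_val (d # ds) > 0" using Cons \<open>digits (digits_val ds) = ds\<close>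
    by (cases ds) (auto simp: of_bool_def intro!: gr0I)
  ultimately show ?case by (subst digits_pos) auto
qed simp

lemma last_digits: "n > 0 \<Longrightarrow> last (digits n)"
proof (induction n rule: digits.induct)
  case (1 n)
  then show ?case by (cases "n div 2 = 0") (auto simp: digits_pos[of n] intro!: Nat.gr0I)
qed

primrec add_carry :: "bool \<Rightarrow> bool list \<Rightarrow> bool list" where
  "add_carry c [] = (if c then [True] else [])"
| "add_carry c (d # ds) = (c \<noteq> d) # add_carry (c \<and> d) ds"

lemma digits_add_carry: "digits (n + of_bool c) = add_carry c (digits n)"
proof (induction n arbitrary: c rule: digits.induct)
  case (1 n)
  show ?case
  proof (cases "n = 0")
    case True
    then show ?thesis by (cases c) (simp_all add: digits_pos)
  next
    case False
    have "add_carry c (digits n) = (c \<noteq> odd n) # digits (n div 2 + of_bool (c \<and> odd n))"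
      using False 1 by (simp add: digits_pos)
    also have "n div 2 + of_bool (c \<and> odd n) = (n + of_bool c) div 2" by (cases c) auto
    finally show ?thesis using False by (subst digits_pos) (cases c, auto)
  qed
qed

lemma sz_add_carry: "sz (add_carry c ds) \<le> sz ds + 4 * of_bool c"
proof (induction ds arbitrary: c)
  case (Cons d ds)
  then show ?case using Cons[of "c \<and> d"] by (cases c; cases d) auto
qed simp

lemma pt_add_carry: assumes "pt f" shows "pt (\<lambda>x. add_carry True (f x))"
proof (rule pt_cong)
  let ?g = "\<lambda>s d. (fst s \<and> d, (\<not> (fst s = (d::bool))) # snd s)"
  let ?r = "\<lambda>x. foldl ?g (True, []) (f x)"
  have b: "sz (?g s e) \<le> sz s + 7" for s e
    using sz_bool_le[of "fst s \<and> e"] sz_bool_le[of "\<not> (fst s = e)"] by (cases s) simp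
  have "pt ?r"
    by (rule pt_foldl_elem[of "\<lambda>_. ?g", where q = "\<lambda>_. 7"])
      (intro pt_all pt_eq_bool assms poly_const b)+
  then show "pt (\<lambda>x. rev (snd (?r x)) @ (if fst (?r x) then [True] else []))"
    by (intro pt_all)
  have "rev (snd (foldl ?g (c, ys) ds)) @ (if fst (foldl ?g (c, ys) ds) then [True] else []) = rev ys @ add_carry c ds"
    for c ys ds by (induction ds arbitrary: c ys) auto
  then show "rev (snd (?r x)) @ (if fst (?r x) then [True] else []) = add_carry True (f x)" for x by simp
qed

text \<open>Counting up in binary converts a unary number; one increment enlarges the tree by at
  most 4, so the growth is additive.\<close>

lemma pt_digits': "pt digits"
proof (rule pt_cong)
  have b: "sz (add_carry True s) \<le> sz s + 4" for s using sz_add_carry[of True] by simp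
  show "pt (\<lambda>n. foldl (\<lambda>s e. add_carry True s) [] (replicate n ()))"
    by (rule pt_foldl_elem[of "\<lambda>_ s e. add_carry True s", where q = "\<lambda>_. 4"])
      (intro pt_fst pt_snd pt_add_carry pt_units pt_id pt_const poly_const b)+
  have "foldl (\<lambda>s e. add_carry True s) (digits m) (replicate n ()) = digits (m + n)" for m n
  proof (induction n arbitrary: m)
    case (Suc n)
    then show ?case using digits_add_carry[of m True] Suc[of "Suc m"] by simp
  qed simp
  from this[of 0] show "foldl (\<lambda>s e. add_carry True s) [] (replicate n ()) = digits n" for n by simp
qed

lemmas pt_digits = pt_comp[OF pt_digits']

text \<open>A short numeral may denote an exponentially large number, so decoding is a search below
  a given bound; a numeral that is not found yields the default 0.\<close>

definition udec :: "nat \<Rightarrow> bool list \<Rightarrow> nat" where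
  "udec c ds = hd (filter (\<lambda>i. digits i = ds) [0..<c] @ [0])"

lemma udec_digits: "i < c \<Longrightarrow> udec c (digits i) = i"
proof -
  assume "i < c"
  then have "filter (\<lambda>j. digits j = digits i) [0..<c] \<noteq> []" by (auto simp: filter_empty_conv)
  moreover from hd_in_set[OF this] have "hd (filter (\<lambda>j. digits j = digits i) [0..<c]) = i"
    by (auto simp: digits_inject)
  ultimately show ?thesis by (simp add: udec_def)
qed

lemma pt_udec: "pt f \<Longrightarrow> pt g \<Longrightarrow> pt (\<lambda>x. udec (f x) (g x))"
proof (rule pt_comp2[of udec])
  show "pt (\<lambda>z. udec (fst z) (snd z))" unfolding udec_def
    by (intro pt_all pt_filter pt_digits)
qed

text \<open>The second component is the verdict on the digits read so far, overridden by each more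
  significant position where the two differ. Missing digits of \<open>ys\<close> read as
  \<open>False\<close>; digits of \<open>ys\<close> left over make it the larger one.\<close>

definition less_digits :: "bool list \<Rightarrow> bool list \<Rightarrow> bool" where
  "less_digits xs ys = (let r = foldl (\<lambda>s x. (tl (fst s), if x = (\<not> fst s = [] \<and> hd (fst s)) then snd s else \<not> x)) (ys, False) xs
     in \<not> (fst r = [] \<and> \<not> snd r))"

lemma less_digits_digits: "less_digits (digits p) (digits q) \<longleftrightarrow> p < q"
proof -
  let ?g = "\<lambda>s x. (tl (fst s), if x = (\<not> fst s = [] \<and> hd (fst s)) then snd s else \<not> x)"
  \<comment> \<open>The verdict \<open>r\<close> on lower digits decides only between equal numbers;
    this generalisation makes the induction work.\<close>
  have "\<not> (fst (foldl ?g (digits q, r) (digits p)) = [] \<and> \<not> snd (foldl ?g (digits q, r) (digits p)))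
    \<longleftrightarrow> p < q \<or> p = q \<and> r" for r
  proof (induction p arbitrary: q r rule: digits.induct)
    case (1 p)
    show ?case
    proof (cases "p = 0")
      case False
      have tl: "tl (digits q) = digits (q div 2)" by (cases "q = 0") (auto simp: digits_pos)
      have hd: "(\<not> digits q = [] \<and> hd (digits q)) = odd q" by (cases "q = 0") (auto simp: digits_pos)
      let ?r = "if odd p = odd q then r else \<not> odd p"
      have "foldl ?g (digits q, r) (digits p) = foldl ?g (digits (q div 2), ?r) (digits (p div 2))"
        using False by (simp only: digits_pos[of p] foldl.simps fst_conv snd_conv tl hd)
      moreover have "p div 2 < q div 2 \<or> p div 2 = q div 2 \<and> ?r \<longleftrightarrow> p < q \<or> p = q \<and> r"
        by (cases "odd p"; cases "odd q"; cases r; (simp; fail)?; simp?; presburger)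
      ultimately show ?thesis using 1[OF False, of "q div 2" ?r] by simp
    qed auto
  qed
  from this[of False] show ?thesis by (simp add: less_digits_def Let_def)
qed

lemma pt_less_digits: "pt f \<Longrightarrow> pt g \<Longrightarrow> pt (\<lambda>x. less_digits (f x) (g x))"
proof (rule pt_comp2[of less_digits])
  let ?g = "\<lambda>s x. (tl (fst s), if x = (\<not> fst s = [] \<and> hd (fst s)) then snd s else \<not> x)"
  have b: "sz (?g s e) \<le> sz s + 3" for s e
    using sz_tl_le[of "fst s"] sz_bool_le[of "snd (?g s e)"] by (cases s) simp
  have "pt (\<lambda>z. foldl ?g (snd z, False) (fst z))"
    by (rule pt_foldl_elem[of "\<lambda>_. ?g", where q = "\<lambda>_. 3"]) (intro pt_all pt_eq_bool poly_const b)+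
  then show "pt (\<lambda>z. less_digits (fst z) (snd z))" unfolding less_digits_def Let_def
    by (intro pt_intros)
qed

definition enc_digits :: "bool list \<Rightarrow> bool list" where
  "enc_digits ds = concat (map (\<lambda>d. [True, d]) ds) @ [False]"

lemma enc_digits_simps [simp]: "enc_digits [] = [False]" "enc_digits (d # ds) = True # d # enc_digits ds"
  by (auto simp: enc_digits_def)

lemma enc_bin_conv_digits: "enc_bin n = enc_digits (digits n)"
proof (induction n rule: digits.induct)
  case (1 n)
  show ?case
  proof (cases "n = 0")
    case False
    then show ?thesis using 1 by (simp add: digits_pos del: enc_bin.simps) (subst enc_bin.simps, simp)
  qed simp
qed

lemma pt_enc_digits: "pt f \<Longrightarrow> pt (\<lambda>x. enc_digits (f x))"
  unfolding enc_digits_def by (intro pt_all pt_map)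

text \<open>The flags of the scanning automaton mean that the numeral is complete and that a digit
  follows; digits and remainder are collected in reverse.\<close>

definition split_digits :: "bool list \<Rightarrow> bool list \<times> bool list" where
  "split_digits w = (let r = foldl (\<lambda>s b.
      if fst s then (True, False, fst (snd (snd s)), b # snd (snd (snd s)))
      else if fst (snd s) then (False, False, b # fst (snd (snd s)), snd (snd (snd s)))
      else if b then (False, True, fst (snd (snd s)), snd (snd (snd s)))
      else (True, False, fst (snd (snd s)), snd (snd (snd s)))) (False, False, [], []) w
    in (rev (fst (snd (snd r))), rev (snd (snd (snd r)))))"

lemma split_digits_enc_digits: "split_digits (enc_digits ds @ r) = (ds, r)"
proof -
  let ?g = "\<lambda>s b. if fst s then (True, False, fst (snd (snd s)), b # snd (snd (snd s)))
      else if fst (snd s) then (False, False, b # fst (snd (snd s)), snd (snd (snd s)))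
      else if b then (False, True, fst (snd (snd s)), snd (snd (snd s)))
      else (True, False, fst (snd (snd s)), snd (snd (snd s)))"
  have 1: "foldl ?g (True, False, xs, ys) r = (True, False, xs, rev r @ ys)" for xs ys r
    by (induction r arbitrary: ys) auto
  have "foldl ?g (False, False, xs, []) (enc_digits ds @ r) = (True, False, rev ds @ xs, rev r)" for xs
    by (induction ds arbitrary: xs) (simp_all add: 1)
  then show ?thesis by (simp add: split_digits_def Let_def)
qed

lemma pt_split_digits: "pt f \<Longrightarrow> pt (\<lambda>x. split_digits (f x))"
proof (rule pt_comp[of split_digits])
  let ?g = "\<lambda>s b. if fst s then (True, False, fst (snd (snd s)), b # snd (snd (snd s)))
      else if fst (snd s) then (False, False, b # fst (snd (snd s)), snd (snd (snd s)))
      else if b then (False, True, fst (snd (snd s)), snd (snd (snd s)))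
      else (True, False, fst (snd (snd s)), snd (snd (snd s)))"
  have b: "sz (?g s e) \<le> sz s + 10" for s e
    using sz_bool_le[of e] by (cases s) (auto simp: sz_pos)
  have "pt (\<lambda>w. foldl ?g (False, False, [], []) w)"
    by (rule pt_foldl_elem[of "\<lambda>_. ?g", where q = "\<lambda>_. 10"]) (intro pt_all poly_const b)+
  then show "pt split_digits" unfolding split_digits_def Let_def
    by (intro pt_intros pt_rev)
qed

definition all_digits :: "bool list \<Rightarrow> bool list list" where
  "all_digits w = rev (snd (snd (foldl (\<lambda>s b.
      if fst s then (False, b # fst (snd s), snd (snd s))
      else if b then (True, fst (snd s), snd (snd s))
      else (False, [], rev (fst (snd s)) # snd (snd s))) (False, [], []) w)))"

lemma all_digits_concat: "all_digits (concat (map enc_digits dss)) = dss"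
proof -
  let ?g = "\<lambda>s b. if fst s then (False, b # fst (snd s), snd (snd s))
      else if b then (True, fst (snd s), snd (snd s))
      else (False, [], rev (fst (snd s)) # snd (snd s))"
  have 1: "foldl ?g (False, cur, ts) (enc_digits ds @ r) = foldl ?g (False, [], (rev cur @ ds) # ts) r" for cur ts ds r
    by (induction ds arbitrary: cur) simp_all
  have "foldl ?g (False, [], ts) (concat (map enc_digits dss)) = (False, [], rev dss @ ts)" for ts
  proof (induction dss arbitrary: ts)
    case (Cons ds dss)
    show ?case using 1[of "[]" ts ds "concat (map enc_digits dss)"] Cons[of "ds # ts"] by simp
  qed simp
  then show ?thesis by (simp add: all_digits_def)
qed

lemma pt_all_digits: "pt f \<Longrightarrow> pt (\<lambda>x. all_digits (f x))"
proof (rule pt_comp[of all_digits])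
  let ?g = "\<lambda>s b. if fst s then (False, b # fst (snd s), snd (snd s))
      else if b then (True, fst (snd s), snd (snd s))
      else (False, [], rev (fst (snd s)) # snd (snd s))"
  have b: "sz (?g s e) \<le> sz s + 10" for s e
    using sz_bool_le[of e] by (cases s) auto
  have "pt (\<lambda>w. foldl ?g (False, [], []) w)"
    by (rule pt_foldl_elem[of "\<lambda>_. ?g", where q = "\<lambda>_. 10"]) (intro pt_all poly_const b)+
  then show "pt all_digits" unfolding all_digits_def
    by (intro pt_intros pt_rev)
qed

section \<open>Parsing parity games\<close>

text \<open>Priorities stay digit lists, since they may be exponentially large; the vertex count is
  the length of the owner list.\<close>

type_synonym raw_game = "bool list \<times> (nat \<times> nat) list \<times> bool list list \<times> nat"

definition raw_of :: "parity_game \<Rightarrow> raw_game" where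
  "raw_of G = (pg_eve G, pg_edges G, map digits (pg_prio G), pg_init G)"

definition game_of :: "raw_game \<Rightarrow> parity_game" where
  "game_of g = \<lparr>pg_n = length (fst g), pg_eve = fst g, pg_edges = fst (snd g),
     pg_prio = map digits_val (fst (snd (snd g))), pg_init = snd (snd (snd g))\<rparr>"

lemma game_of_raw_of: "wf_pg G \<Longrightarrow> game_of (raw_of G) = G"
  by (simp add: game_of_def raw_of_def wf_pg_def comp_def)

definition parse_bits :: "bool list \<Rightarrow> bool list \<times> bool list" where
  "parse_bits w = split_digits (snd (split_digits w))"

text \<open>Counts and vertex numbers in a valid word are at most its length, whence the search
  bound \<open>Suc (length w)\<close>.\<close>

definition parse_owner :: "bool list \<Rightarrow> bool list" where
  "parse_owner w = take (udec (Suc (length w)) (fst (parse_bits w))) (snd (parse_bits w))"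

text \<open>Behind the owner bits a valid word is a plain sequence of self-delimiting numerals, so
  it is tokenised in one pass and the fields are then found by position.\<close>

definition parse_numbers :: "bool list \<Rightarrow> bool list list" where
  "parse_numbers w = all_digits (drop (udec (Suc (length w)) (fst (parse_bits w))) (snd (parse_bits w)))"

definition parse_num_edges :: "bool list \<Rightarrow> nat" where
  "parse_num_edges w = udec (Suc (length w)) (hd (parse_numbers w))"

definition parse_rest :: "bool list \<Rightarrow> bool list list" where
  "parse_rest w = drop (parse_num_edges w + parse_num_edges w) (tl (parse_numbers w))"

definition parse_edge :: "bool list \<Rightarrow> nat \<Rightarrow> nat \<times> nat" where
  "parse_edge w i = (udec (Suc (length w)) (hd (drop (i + i) (tl (parse_numbers w)))),
     udec (Suc (length w)) (hd (drop (Suc (i + i)) (tl (parse_numbers w)))))"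

definition parse :: "bool list \<Rightarrow> raw_game" where
  "parse w = (parse_owner w, map (parse_edge w) [0..<parse_num_edges w],
     take (length (parse_owner w)) (tl (parse_rest w)),
     udec (Suc (length w)) (hd (drop (Suc (length (parse_owner w))) (parse_rest w))))"

definition unparse :: "raw_game \<Rightarrow> bool list" where
  "unparse g = enc_digits (digits (length (fst g))) @ enc_digits (digits (length (fst g))) @ fst g
     @ enc_digits (digits (length (fst (snd g))))
     @ concat (map (\<lambda>e. enc_digits (digits (fst e)) @ enc_digits (digits (snd e))) (fst (snd g)))
     @ enc_digits (digits (length (fst (snd (snd g))))) @ concat (map enc_digits (fst (snd (snd g))))
     @ enc_digits (digits (snd (snd (snd g))))"

text \<open>\<open>unparse\<close> reproduces digit lists verbatim, so priorities with leading zeros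
  would pass the comparison with the input; they are rejected here.\<close>

definition valid_raw :: "raw_game \<Rightarrow> bool" where
  "valid_raw g \<longleftrightarrow> length (fst (snd (snd g))) = length (fst g)
     \<and> list_all (\<lambda>p. \<not> (\<not> p = [] \<and> \<not> hd (rev p))) (fst (snd (snd g)))
     \<and> list_all (\<lambda>e. fst e < length (fst g) \<and> snd e < length (fst g)) (fst (snd g))
     \<and> list_all (\<lambda>u. list_ex (\<lambda>e. fst e = u) (fst (snd g))) [0..<length (fst g)]
     \<and> snd (snd (snd g)) < length (fst g)"

lemma pt_parse: "pt parse"
proof -
  have bits: "pt f \<Longrightarrow> pt (\<lambda>x. parse_bits (f x))" for f :: "'a::treeable \<Rightarrow> bool list"
    unfolding parse_bits_def by (intro pt_split_digits pt_snd)
  have owner: "pt parse_owner" unfolding parse_owner_def by (intro pt_all pt_udec bits)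
  have numbers': "pt parse_numbers" unfolding parse_numbers_def by (intro pt_all pt_udec bits pt_all_digits)
  note numbers = pt_comp[OF numbers']
  have m': "pt parse_num_edges" unfolding parse_num_edges_def by (intro pt_all pt_udec numbers)
  note m = pt_comp[OF m']
  have rest: "pt parse_rest" unfolding parse_rest_def by (intro pt_all numbers m)
  have edge: "pt (\<lambda>z. parse_edge (fst z) (snd z))" unfolding parse_edge_def by (intro pt_all pt_udec numbers)
  show ?thesis unfolding parse_def
    by (intro pt_all pt_udec pt_map edge pt_comp[OF owner] m pt_comp[OF rest])
qed

lemma pt_unparse: "pt unparse"
  unfolding unparse_def by (intro pt_all pt_map pt_enc_digits pt_digits)

lemma pt_valid_raw: "pt valid_raw"
  unfolding valid_raw_def by (intro pt_all pt_list_all pt_list_ex)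

lemma length_enc_digits: "length (enc_digits ds) \<ge> 1"
  by (cases ds) auto

lemma length_le_concat: "(\<And>x. x \<in> set xs \<Longrightarrow> length x \<ge> 1) \<Longrightarrow> length xs \<le> length (concat xs)"
proof (induction xs)
  case (Cons a xs)
  then have "length a \<ge> 1" "length xs \<le> length (concat xs)" by auto
  then show ?case by simp
qed simp

lemma concat_map_concat: "concat (map h (concat (map k xs))) = concat (map (\<lambda>x. concat (map h (k x))) xs)"
  by (induction xs) auto

lemma drop_pairs: "i \<le> length es \<Longrightarrow>
  drop (i + i) (concat (map (\<lambda>e. [a e, b e]) es) @ zs) = concat (map (\<lambda>e. [a e, b e]) (drop i es)) @ zs"
proof (induction i arbitrary: es)
  case (Suc i)
  then show ?case by (cases es) auto
qed simp

lemma enc_pg_conv: "wf_pg G \<Longrightarrow> enc_pg G = unparse (raw_of G)"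
proof -
  have e: "enc_bin = (\<lambda>n. enc_digits (digits n))" using enc_bin_conv_digits by blast
  show "wf_pg G \<Longrightarrow> enc_pg G = unparse (raw_of G)"
    unfolding enc_pg_def enc_list_def e by (simp add: unparse_def raw_of_def wf_pg_def split_def comp_def)
qed

lemma parse_enc_pg:
  assumes "wf_pg G"
  shows "parse (enc_pg G) = raw_of G"
proof -
  define w where "w = enc_pg G"
  let ?c = "Suc (length w)" and ?es = "pg_edges G" and ?m = "length (pg_edges G)" and ?n = "pg_n G"
  define D where "D = digits ?n # map digits (pg_prio G) @ [digits (pg_init G)]"
  define T where "T = digits ?m # concat (map (\<lambda>e. [digits (fst e), digits (snd e)]) ?es) @ D"
  have wf: "length (pg_eve G) = ?n" "length (pg_prio G) = ?n" "pg_init G < ?n"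
    "\<And>e. e \<in> set ?es \<Longrightarrow> fst e < ?n \<and> snd e < ?n" using assms by (auto simp: wf_pg_def)
  have T: "concat (map enc_digits T) = enc_digits (digits ?m)
     @ concat (map (\<lambda>e. enc_digits (digits (fst e)) @ enc_digits (digits (snd e))) ?es)
     @ enc_digits (digits ?n) @ concat (map enc_digits (map digits (pg_prio G))) @ enc_digits (digits (pg_init G))"
    by (simp add: T_def D_def concat_map_concat comp_def)
  have w: "w = enc_digits (digits ?n) @ enc_digits (digits ?n) @ pg_eve G @ concat (map enc_digits T)"
    unfolding T w_def enc_pg_conv[OF assms] by (simp add: unparse_def raw_of_def wf)
  have "length T \<le> length (concat (map enc_digits T))"
    using length_le_concat[of "map enc_digits T"] length_enc_digits by auto
  moreover have "length T \<ge> ?m"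
  proof -
    have "length (concat (map (\<lambda>e. [digits (fst e), digits (snd e)]) es)) \<ge> length es" for es :: "(nat \<times> nat) list"
      by (induction es) auto
    from this[of ?es] show ?thesis by (simp add: T_def)
  qed
  \<comment> \<open>The owner list alone takes \<open>?n\<close> bits and every edge at least one,
    so both counts lie below the search bound.\<close>
  ultimately have c: "?n < ?c" "?m < ?c" using wf by (auto simp: w)
  have bits: "parse_bits w = (digits ?n, pg_eve G @ concat (map enc_digits T))"
    unfolding parse_bits_def w by (simp add: split_digits_enc_digits)
  have owner: "parse_owner w = pg_eve G"
    by (simp add: parse_owner_def bits udec_digits[OF c(1)] wf)
  have numbers: "parse_numbers w = T"
    by (simp add: parse_numbers_def bits udec_digits[OF c(1)] wf all_digits_concat)
  have m: "parse_num_edges w = ?m"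
    by (simp add: parse_num_edges_def numbers T_def udec_digits[OF c(2)])
  have rest: "parse_rest w = D"
    using drop_pairs[of ?m ?es _ _ D] by (simp add: parse_rest_def m numbers T_def)
  have edge: "parse_edge w i = ?es ! i" if "i < ?m" for i
  proof -
    have d: "drop (i + i) (tl T) = digits (fst (?es ! i)) # digits (snd (?es ! i)) # concat (map (\<lambda>e. [digits (fst e), digits (snd e)]) (drop (Suc i) ?es)) @ D"
      using that by (simp add: T_def drop_pairs Cons_nth_drop_Suc[symmetric] del: drop_append)
    have "drop (Suc (i + i)) (tl T) = tl (drop (i + i) (tl T))" by (simp add: drop_Suc tl_drop)
    moreover have "fst (?es ! i) < ?c" "snd (?es ! i) < ?c" using wf(4)[OF nth_mem[OF that]] c(1) by auto
    ultimately show ?thesis unfolding parse_edge_def numbers d by (simp add: udec_digits)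
  qed
  have "map (parse_edge w) [0..<?m] = ?es" by (rule nth_equalityI) (auto simp: edge)
  moreover have "udec ?c (digits (pg_init G)) = pg_init G" using wf c by (intro udec_digits) auto
  ultimately have "parse w = raw_of G"
    by (simp add: parse_def raw_of_def owner m rest D_def wf)
  then show ?thesis by (simp add: w_def)
qed

lemma valid_raw_iff:
  "valid_raw g \<longleftrightarrow> wf_pg (game_of g) \<and> (\<forall>p \<in> set (fst (snd (snd g))). p = [] \<or> last p)"
proof -
  have "(\<exists>e \<in> set es. fst e = u) \<longleftrightarrow> (\<exists>v. (u, v) \<in> set es)" for u and es :: "(nat \<times> nat) list" by force
  then show ?thesis
    by (auto simp: valid_raw_def wf_pg_def game_of_def list_all_iff list_ex_iff hd_rev)
qed

lemma valid_raw_of: "wf_pg G \<Longrightarrow> valid_raw (raw_of G)"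
proof -
  have "digits n = [] \<or> last (digits n)" for n using last_digits[of n] by auto
  then show "wf_pg G \<Longrightarrow> valid_raw (raw_of G)"
    unfolding valid_raw_iff by (simp add: game_of_raw_of) (simp add: raw_of_def)
qed

lemma raw_of_game_of: "valid_raw g \<Longrightarrow> raw_of (game_of g) = g"
  unfolding valid_raw_iff by (cases g) (auto simp: raw_of_def game_of_def digits_digits_val intro!: map_idI)

lemma enc_pg_game_of: "valid_raw g \<Longrightarrow> enc_pg (game_of g) = unparse g"
  using enc_pg_conv[of "game_of g"] raw_of_game_of[of g] by (simp add: valid_raw_iff)

section \<open>The reduced game\<close>

definition prio_colour :: "nat list \<Rightarrow> nat \<Rightarrow> nat" where
  "prio_colour ps p = 2 * length (filter (\<lambda>q. q < p) ps) + p mod 2"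

abbreviation colour :: "parity_game \<Rightarrow> nat \<Rightarrow> nat" where
  "colour G u \<equiv> prio_colour (pg_prio G) (pg_prio G ! u)"

abbreviation top_weight :: "parity_game \<Rightarrow> nat" where
  "top_weight G \<equiv> 2 * pg_n G + 2"

text \<open>The new vertex belongs to the list index and not to the pair, so repeated entries of
  \<open>pg_edges\<close> become different vertices and no edge receives two weights.\<close>

definition red_edges :: "parity_game \<Rightarrow> nat \<Rightarrow> (nat \<times> nat \<times> int) list" where
  "red_edges G i = (let u = fst (pg_edges G ! i); v = snd (pg_edges G ! i); e = pg_n G + i in
     [(u, e, int (top_weight G)), (e, e, int (colour G u)), (e, v, int (top_weight G))])"

text \<open>The colours of a well-formed game reach at most \<open>2 * pg_n G + 1\<close>, so
  intervals with index up to \<open>pg_n G\<close> cover them.\<close>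

definition red :: "parity_game \<Rightarrow> imp_game" where
  "red G = \<lparr>ig_n = pg_n G + length (pg_edges G),
     ig_eve = pg_eve G @ map (\<lambda>e. even (pg_prio G ! fst e)) (pg_edges G),
     ig_edges = concat (map (red_edges G) [0..<length (pg_edges G)]),
     ig_init = pg_init G,
     ig_intervals = map (\<lambda>j. (Bnd False (int (2 * j)) 1, Bnd True (int (2 * j + 1)) 1)) [0..<Suc (pg_n G)]\<rparr>"

definition enc_weight :: "nat \<Rightarrow> bool list" where
  "enc_weight k = False # replicate k True @ [False]"

lemma enc_int_un_int: "enc_int_un (int k) = enc_weight k"
  by (simp add: enc_int_un_def enc_un_def enc_weight_def)

definition raw_prio :: "raw_game \<Rightarrow> nat \<Rightarrow> bool list" where
  "raw_prio g u = hd (drop u (fst (snd (snd g))))"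

definition raw_odd :: "raw_game \<Rightarrow> nat \<Rightarrow> bool" where
  "raw_odd g u = (\<not> raw_prio g u = [] \<and> hd (raw_prio g u))"

text \<open>Rank and parity are read off the digit lists, so a priority is never expanded into
  unary; only the colour, which is small, becomes a number.\<close>

definition raw_colour :: "raw_game \<Rightarrow> nat \<Rightarrow> nat" where
  "raw_colour g u = (let k = length (filter (\<lambda>q. less_digits q (raw_prio g u)) (fst (snd (snd g)))) in
     if raw_odd g u then Suc (k + k) else k + k)"

definition raw_top :: "raw_game \<Rightarrow> nat" where
  "raw_top g = Suc (Suc (length (fst g) + length (fst g)))"

definition raw_edges :: "raw_game \<Rightarrow> nat \<Rightarrow> bool list" where
  "raw_edges g i = (let u = fst (hd (drop i (fst (snd g)))); v = snd (hd (drop i (fst (snd g))));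
     e = enc_digits (digits (length (fst g) + i)); W = enc_weight (raw_top g) in
     (enc_digits (digits u) @ e @ W) @ (e @ e @ enc_weight (raw_colour g u)) @ (e @ enc_digits (digits v) @ W))"

definition raw_red :: "raw_game \<Rightarrow> bool list" where
  "raw_red g = (let n = length (fst g); es = fst (snd g); m = length es in
     enc_digits (digits (n + m)) @ enc_digits (digits (n + m)) @ fst g @ map (\<lambda>e. \<not> raw_odd g (fst e)) es
     @ enc_digits (digits (m + (m + m))) @ concat (map (raw_edges g) [0..<m])
     @ enc_digits (digits (snd (snd (snd g)))) @ enc_digits (digits (Suc n))
     @ concat (map (\<lambda>j. True # False # enc_weight (j + j) @ True # False # True # True # enc_weight (Suc (j + j)) @ [True, False])
         [0..<Suc n]))"

lemma pt_enc_weight: "pt f \<Longrightarrow> pt (\<lambda>x. enc_weight (f x))"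
  unfolding enc_weight_def by (intro pt_all)

lemma pt_raw_red: "pt raw_red"
proof -
  have prio: "pt (\<lambda>z. raw_prio (fst z) (snd z))" unfolding raw_prio_def by (intro pt_all)
  have odd: "pt (\<lambda>z. raw_odd (fst z) (snd z))" unfolding raw_odd_def by (intro pt_all pt_comp2[OF prio])
  have colour: "pt (\<lambda>z. raw_colour (fst z) (snd z))" unfolding raw_colour_def Let_def
    by (intro pt_all pt_comp2[OF odd] pt_comp2[OF prio] pt_filter pt_less_digits)
  have top: "pt raw_top" unfolding raw_top_def by (intro pt_all)
  have edges: "pt (\<lambda>z. raw_edges (fst z) (snd z))" unfolding raw_edges_def Let_def
    by (intro pt_all pt_enc_digits pt_digits pt_enc_weight pt_comp2[OF colour] pt_comp[OF top])
  show ?thesis unfolding raw_red_def Let_def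
    by (intro pt_all pt_map pt_enc_digits pt_digits pt_enc_weight pt_comp2[OF odd] edges)
qed

lemma raw_red_raw_of:
  assumes "wf_pg G"
  shows "raw_red (raw_of G) = enc_imp_unary (red G)"
proof -
  let ?g = "raw_of G"
  have wf: "length (pg_eve G) = pg_n G" "length (pg_prio G) = pg_n G"
    "\<And>e. e \<in> set (pg_edges G) \<Longrightarrow> fst e < pg_n G \<and> snd e < pg_n G" using assms by (auto simp: wf_pg_def)
  have g: "fst ?g = pg_eve G" "fst (snd ?g) = pg_edges G" "snd (snd (snd ?g)) = pg_init G" by (auto simp: raw_of_def)
  have prio: "raw_prio ?g u = digits (pg_prio G ! u)" if "u < pg_n G" for u
    using that wf by (simp add: raw_prio_def raw_of_def hd_drop_conv_nth)
  have odd: "raw_odd ?g u \<longleftrightarrow> odd (pg_prio G ! u)" if "u < pg_n G" for u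
    using digits_pos[of "pg_prio G ! u"] by (cases "pg_prio G ! u = 0") (auto simp: raw_odd_def prio[OF that])
  have colour: "raw_colour ?g u = colour G u" if "u < pg_n G" for u
  proof -
    have "fst (snd (snd ?g)) = map digits (pg_prio G)" by (simp add: raw_of_def)
    then show ?thesis using that odd[OF that]
      by (auto simp: raw_colour_def prio Let_def filter_map comp_def less_digits_digits prio_colour_def mod_2_eq_odd)
  qed
  have top: "raw_top ?g = top_weight G" by (simp add: raw_top_def raw_of_def wf)
  have edges: "raw_edges ?g i = concat (map (\<lambda>(u, v, w). enc_bin u @ enc_bin v @ enc_int_un w) (red_edges G i))"
    if "i < length (pg_edges G)" for i
    using that wf(3)[OF nth_mem[OF that]]
    unfolding raw_edges_def red_edges_def Let_def g top enc_bin_conv_digits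
    by (simp add: hd_drop_conv_nth wf enc_int_un_int colour enc_bin_conv_digits
        del: of_nat_add of_nat_mult of_nat_Suc of_nat_numeral add_2_eq_Suc add_2_eq_Suc' enc_bin.simps)
  let ?m = "length (pg_edges G)" and ?n = "pg_n G"
  have len: "length (concat (map (red_edges G) [0..<?m])) = ?m + (?m + ?m)"
    by (simp add: length_concat comp_def red_edges_def Let_def sum_list_triv)
  have bits: "concat (map (\<lambda>b. [b]) bs) = bs" for bs :: "bool list" by (induction bs) auto
  have e: "concat (map (raw_edges ?g) [0..<?m])
      = concat (map (\<lambda>(u, v, w). enc_bin u @ enc_bin v @ enc_int_un w) (concat (map (red_edges G) [0..<?m])))"
    unfolding concat_map_concat by (intro arg_cong[of _ _ concat] map_cong) (auto simp: edges)
  have i: "enc_bound_un (Bnd False (int (2 * j)) 1) @ enc_bound_un (Bnd True (int (2 * j + 1)) 1)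
    = True # False # enc_weight (j + j) @ True # False # True # True # enc_weight (Suc (j + j)) @ [True, False]" for j
    unfolding enc_bound_un.simps enc_int_un_int by (simp add: enc_un_def mult_2)
  have o: "map (\<lambda>e. \<not> raw_odd ?g (fst e)) (pg_edges G) = map (\<lambda>e. even (pg_prio G ! fst e)) (pg_edges G)"
    using wf(3) by (auto simp: odd)
  show ?thesis
    unfolding raw_red_def Let_def g o e enc_imp_unary_def red_def imp_game.simps enc_list_def len bits
      map_map comp_def prod.case i enc_bin_conv_digits
    by (simp add: wf del: upt_Suc)
qed

section \<open>Unique readability of the encoding\<close>

text \<open>The arbitrary continuations \<open>u\<close> and \<open>v\<close> make the property
  compose along concatenated fields.\<close>

definition prefix_free :: "('a \<Rightarrow> bool list) \<Rightarrow> bool" where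
  "prefix_free e \<longleftrightarrow> (\<forall>x y u v. e x @ u = e y @ v \<longrightarrow> x = y \<and> u = v)"

lemma prefix_freeD: "prefix_free e \<Longrightarrow> e x @ u = e y @ v \<Longrightarrow> x = y \<and> u = v"
  unfolding prefix_free_def by blast

lemma prefix_free_enc_bin: "prefix_free enc_bin"
proof -
  have "x = y \<and> u = v" if "enc_digits (digits x) @ u = enc_digits (digits y) @ v" for x y u v
    using arg_cong[OF that, of split_digits] by (simp add: split_digits_enc_digits digits_inject)
  then show ?thesis unfolding prefix_free_def enc_bin_conv_digits by blast
qed

lemma prefix_free_enc_un: "prefix_free enc_un"
proof -
  have "enc_un a @ u = enc_un b @ v \<Longrightarrow> a = b \<and> u = v" for a b u v
  proof (induction a arbitrary: b)
    case 0
    then show ?case by (cases b) (simp_all add: enc_un_def)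
  next
    case (Suc a)
    then show ?case by (cases b) (simp_all add: enc_un_def)
  qed
  then show ?thesis unfolding prefix_free_def by blast
qed

lemma prefix_free_enc_int_un: "prefix_free enc_int_un"
proof -
  have "x = y \<and> u = v" if "enc_int_un x @ u = enc_int_un y @ v" for x y u v
  proof -
    have "(x < 0) = (y < 0)" and "enc_un (nat \<bar>x\<bar>) @ u = enc_un (nat \<bar>y\<bar>) @ v"
      using that by (auto simp: enc_int_un_def)
    with prefix_freeD[OF prefix_free_enc_un this(2)] have "(x < 0) = (y < 0)" "nat \<bar>x\<bar> = nat \<bar>y\<bar>" "u = v" by simp_all
    then show ?thesis by linarith
  qed
  then show ?thesis unfolding prefix_free_def by blast
qed

lemma prefix_free_enc_bool: "prefix_free (\<lambda>b. [b])"
  by (simp add: prefix_free_def)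

lemma prefix_free_enc_bound_un: "prefix_free enc_bound_un"
proof -
  have "x = y \<and> u = v" if "enc_bound_un x @ u = enc_bound_un y @ v" for x y u v
  proof (cases x; cases y)
    fix c p q c' p' q' assume xy: "x = Bnd c p q" "y = Bnd c' p' q'"
    then have "c = c'" "enc_int_un p @ (enc_un q @ u) = enc_int_un p' @ (enc_un q' @ v)" using that by auto
    with prefix_freeD[OF prefix_free_enc_int_un this(2)] prefix_freeD[OF prefix_free_enc_un, of q u q' v] xy
    show ?thesis by blast
  qed (use that in auto)
  then show ?thesis unfolding prefix_free_def by blast
qed

lemma prefix_free_prod:
  assumes "prefix_free e" "prefix_free f"
  shows "prefix_free (\<lambda>(x, y). e x @ f y)"
proof -
  have "x = y \<and> u = v" if "(case x of (a, b) \<Rightarrow> e a @ f b) @ u = (case y of (a, b) \<Rightarrow> e a @ f b) @ v" for x y u v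
  proof (cases x; cases y)
    fix a b c d assume xy: "x = (a, b)" "y = (c, d)"
    then have "e a @ (f b @ u) = e c @ (f d @ v)" using that by simp
    with prefix_freeD[OF assms(1) this] prefix_freeD[OF assms(2), of b u d v] xy show ?thesis by blast
  qed
  then show ?thesis unfolding prefix_free_def by blast
qed

lemma prefix_free_enc_list:
  assumes "prefix_free e"
  shows "prefix_free (enc_list e)"
proof -
  have *: "concat (map e xs) @ u = concat (map e ys) @ v \<Longrightarrow> xs = ys \<and> u = v" if "length xs = length ys" for xs ys u v
    using that
  proof (induction xs ys rule: list_induct2)
    case (Cons x xs y ys)
    then show ?case using prefix_freeD[OF assms, of x "concat (map e xs) @ u" y "concat (map e ys) @ v"] by auto
  qed simp
  have "xs = ys \<and> u = v" if "enc_list e xs @ u = enc_list e ys @ v" for xs ys u v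
  proof -
    have "enc_bin (length xs) @ (concat (map e xs) @ u) = enc_bin (length ys) @ (concat (map e ys) @ v)"
      using that by (simp add: enc_list_def del: enc_bin.simps)
    from prefix_freeD[OF prefix_free_enc_bin this] show ?thesis using * by blast
  qed
  then show ?thesis unfolding prefix_free_def by blast
qed

text \<open>Membership in \<open>UNARY_IMP\<close> speaks of some game with the given code;
  injectivity pins it to the reduced game.\<close>

lemma enc_imp_unary_inject:
  assumes "enc_imp_unary G = enc_imp_unary H"
  shows "G = H"
proof -
  have e: "prefix_free (\<lambda>(u, v, w). enc_bin u @ enc_bin v @ enc_int_un w)"
    using prefix_free_prod[OF prefix_free_enc_bin prefix_free_prod[OF prefix_free_enc_bin prefix_free_enc_int_un]]
    by (simp add: case_prod_beta' del: enc_bin.simps)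
  have i: "prefix_free (\<lambda>(lo, hi). enc_bound_un lo @ enc_bound_un hi)"
    by (rule prefix_free_prod[OF prefix_free_enc_bound_un prefix_free_enc_bound_un])
  note 1 = prefix_freeD[OF prefix_free_enc_bin assms[unfolded enc_imp_unary_def]]
  note 2 = prefix_freeD[OF prefix_free_enc_list[OF prefix_free_enc_bool] 1[THEN conjunct2]]
  note 3 = prefix_freeD[OF prefix_free_enc_list[OF e] 2[THEN conjunct2]]
  note 4 = prefix_freeD[OF prefix_free_enc_bin 3[THEN conjunct2]]
  have "ig_intervals G = ig_intervals H"
    using prefix_freeD[OF prefix_free_enc_list[OF i], of _ "[]" _ "[]"] 4[THEN conjunct2] by simp
  with 1 2 3 4 show ?thesis by simp
qed

section \<open>Limits of averages\<close>

text \<open>\<open>D k\<close> is \<open>2 * k\<close> times the distance of the average from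
  \<open>a + 1/2\<close>. It is an integer that falls by at most 1 and only from positive values, so
  once nonnegative it stays so; recurring values \<open>D k \<le> 0\<close> make the bound
  sharp.\<close>

lemma liminf_eq_half:
  fixes P :: "nat \<Rightarrow> int" and a :: int
  defines "D \<equiv> \<lambda>k. 2 * P k - (2 * a + 1) * int k"
  assumes up: "\<And>k. k \<ge> K \<Longrightarrow> D k \<le> 0 \<Longrightarrow> D (Suc k) \<ge> D k + 1"
    and down: "\<And>k. k \<ge> K \<Longrightarrow> D k > 0 \<Longrightarrow> D (Suc k) \<ge> D k - 1"
    and inf: "\<And>N. \<exists>k \<ge> N. D k \<le> 0"
  shows "liminf (\<lambda>k. ereal (real_of_int (P k) / real k)) = ereal (real_of_int a + 1 / 2)"
proof (rule antisym)
  \<comment> \<open>While negative, \<open>D\<close> rises by at least 1 per step, so after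
    \<open>- D K\<close> steps it cannot still be negative.\<close>
  have "\<exists>k \<ge> K. D k \<ge> 0"
  proof (rule ccontr)
    assume "\<not> ?thesis"
    then have neg: "\<And>k. k \<ge> K \<Longrightarrow> D k < 0" by force
    have "D (K + j) \<ge> D K + int j" for j
    proof (induction j)
      case (Suc j)
      then show ?case using up[of "K + j"] neg[of "K + j"] by simp
    qed simp
    from this[of "nat (- D K)"] neg[of "K + nat (- D K)"] neg[of K] show False by simp
  qed
  then obtain k0 where k0: "k0 \<ge> K" "D k0 \<ge> 0" by blast
  have nonneg: "D k \<ge> 0" if "k \<ge> k0" for k
    using that
  proof (induction k rule: dec_induct)
    case (step k)
    then show ?case using up[of k] down[of k] k0 by (cases "D k > 0") auto
  qed (rule k0)
  have "\<forall>\<^sub>F k in sequentially. ereal (real_of_int a + 1 / 2) \<le> ereal (real_of_int (P k) / real k)"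
  proof (rule eventually_sequentiallyI)
    fix k assume k: "k \<ge> Suc k0"
    then have "real_of_int (D k) \<ge> 0" using nonneg[of k] by simp
    then show "ereal (real_of_int a + 1 / 2) \<le> ereal (real_of_int (P k) / real k)"
      using k by (simp add: D_def field_simps)
  qed
  then show "ereal (real_of_int a + 1 / 2) \<le> liminf (\<lambda>k. ereal (real_of_int (P k) / real k))"
    by (rule Liminf_bounded)
  show "liminf (\<lambda>k. ereal (real_of_int (P k) / real k)) \<le> ereal (real_of_int a + 1 / 2)"
  proof (rule ccontr)
    assume "\<not> ?thesis"
    then have "ereal (real_of_int a + 1 / 2) < liminf (\<lambda>k. ereal (real_of_int (P k) / real k))" by simp
    from less_LiminfD[OF this] obtain N where
      N: "\<And>k. k \<ge> N \<Longrightarrow> ereal (real_of_int a + 1 / 2) < ereal (real_of_int (P k) / real k)"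
      by (auto simp: eventually_sequentially)
    obtain k where k: "k \<ge> Suc N" "D k \<le> 0" using inf by blast
    then have "real_of_int (D k) \<le> 0" by simp
    then show False using N[of k] k by (simp add: D_def field_simps)
  qed
qed

lemma liminf_eventually_linear:
  fixes P :: "nat \<Rightarrow> int" and c :: int
  assumes "\<And>k. k \<ge> K \<Longrightarrow> P (Suc k) = P k + c"
  shows "liminf (\<lambda>k. ereal (real_of_int (P k) / real k)) = ereal (real_of_int c)"
proof (rule lim_imp_Liminf)
  have P: "P (K + j) = P K + c * int j" for j
    by (induction j) (auto simp: assms algebra_simps)
  let ?d = "real_of_int (P K - c * int K)"
  have "(\<lambda>k. real_of_int c + ?d / real k) \<longlonglongrightarrow> real_of_int c + 0"
    by (intro tendsto_add tendsto_const lim_const_over_n)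
  moreover have "\<forall>\<^sub>F k in sequentially. real_of_int c + ?d / real k = real_of_int (P k) / real k"
  proof (rule eventually_sequentiallyI)
    fix k assume k: "k \<ge> Suc K"
    then have "P k = P K + c * int (k - K)" using P[of "k - K"] by simp
    then have "real_of_int (P k) = real_of_int (P K) + real_of_int c * (real k - real K)"
      using k by (simp add: of_nat_diff)
    then show "real_of_int c + ?d / real k = real_of_int (P k) / real k"
      using k by (simp add: field_simps)
  qed
  ultimately have "(\<lambda>k. real_of_int (P k) / real k) \<longlonglongrightarrow> real_of_int c"
    using Lim_transform_eventually by fastforce
  then show "(\<lambda>k. ereal (real_of_int (P k) / real k)) \<longlonglongrightarrow> ereal (real_of_int c)" by simp
qed simp

section \<open>Structure of the reduced game\<close>

lemma even_prio_colour: "even (prio_colour ps p) \<longleftrightarrow> even p"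
  by (simp add: prio_colour_def mod_2_eq_odd)

text \<open>An occurrence of \<open>p\<close> counts towards the rank of \<open>q\<close> but not of
  \<open>p\<close>, so the doubled ranks differ by at least 2, and the parity takes back at most
  1.\<close>

lemma prio_colour_less:
  assumes "p \<in> set ps" "p < q"
  shows "prio_colour ps p < prio_colour ps q"
proof -
  have "{i. i < length ps \<and> ps ! i < p} \<subset> {i. i < length ps \<and> ps ! i < q}"
    using assms by (auto simp: in_set_conv_nth)
  then have "length (filter (\<lambda>x. x < p) ps) < length (filter (\<lambda>x. x < q) ps)"
    unfolding length_filter_conv_card by (rule psubset_card_mono[rotated]) simp
  then show ?thesis unfolding prio_colour_def by (simp add: mod_2_eq_odd)
qed

lemma prio_colour_le: "prio_colour ps p \<le> 2 * length ps + 1"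
proof -
  have "length (filter (\<lambda>x. x < p) ps) \<le> length ps" by (rule length_filter_le)
  moreover have "p mod 2 \<le> 1" by simp
  ultimately show ?thesis unfolding prio_colour_def by linarith
qed

locale reduction =
  fixes G :: parity_game
  assumes wf: "wf_pg G"
begin

abbreviation "n \<equiv> pg_n G"
abbreviation "es \<equiv> pg_edges G"
abbreviation "m \<equiv> length es"
abbreviation "H \<equiv> red G"
abbreviation "W \<equiv> int (top_weight G)"
abbreviation "src x \<equiv> fst (es ! (x - n))"
abbreviation "tgt x \<equiv> snd (es ! (x - n))"
abbreviation "col x \<equiv> colour G (src x)"

lemma len_prio: "length (pg_prio G) = n" and len_eve: "length (pg_eve G) = n" and init_less: "pg_init G < n"
  and out_edge: "u < n \<Longrightarrow> \<exists>v. (u, v) \<in> set es"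
  using wf by (auto simp: wf_pg_def)

lemma edge_less: "i < m \<Longrightarrow> fst (es ! i) < n" "i < m \<Longrightarrow> snd (es ! i) < n"
proof -
  have "\<forall>e \<in> set es. fst e < n \<and> snd e < n" using wf by (auto simp: wf_pg_def)
  then show "i < m \<Longrightarrow> fst (es ! i) < n" "i < m \<Longrightarrow> snd (es ! i) < n" by auto
qed

lemma red_edges_iff: "(x, y, w) \<in> set (ig_edges H) \<longleftrightarrow> (\<exists>i < m.
    (x, y, w) = (fst (es ! i), n + i, W) \<or> (x, y, w) = (n + i, n + i, int (colour G (fst (es ! i))))
    \<or> (x, y, w) = (n + i, snd (es ! i), W))"
  unfolding red_def by (auto simp: red_edges_def Let_def simp del: of_nat_add of_nat_mult)

text \<open>Edges made from the first \<open>k\<close> indices mention only vertices below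
  \<open>n + k\<close>, while every edge of the next index mentions \<open>n + k\<close>
  itself.\<close>

lemma distinct_red: "distinct (map (\<lambda>(u, v, w). (u, v)) (ig_edges H))"
proof -
  let ?f = "\<lambda>(u, v, w). (u, v)"
  have "distinct (map ?f (concat (map (red_edges G) [0..<k]))) \<and>
    (\<forall>(x, y) \<in> set (map ?f (concat (map (red_edges G) [0..<k]))). x < n + k \<and> y < n + k)" if "k \<le> m" for k
    using that
  proof (induction k)
    case (Suc k)
    then have IH: "distinct (map ?f (concat (map (red_edges G) [0..<k])))"
      "\<And>x y. (x, y) \<in> set (map ?f (concat (map (red_edges G) [0..<k]))) \<Longrightarrow> x < n + k \<and> y < n + k" by auto
    have k: "map ?f (red_edges G k) = [(fst (es ! k), n + k), (n + k, n + k), (n + k, snd (es ! k))]"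
      by (simp add: red_edges_def Let_def)
    have "concat (map (red_edges G) [0..<Suc k]) = concat (map (red_edges G) [0..<k]) @ red_edges G k" by simp
    then have eq: "map ?f (concat (map (red_edges G) [0..<Suc k]))
      = map ?f (concat (map (red_edges G) [0..<k])) @ map ?f (red_edges G k)" by (simp only: map_append)
    have less: "fst (es ! k) < n" "snd (es ! k) < n" using edge_less[of k] Suc.prems by auto
    define L where "L = map ?f (concat (map (red_edges G) [0..<k]))"
    have "(x, y) \<notin> set L" if "x = n + k \<or> y = n + k" for x y
      using IH(2)[folded L_def, of x y] that by auto
    then show ?case unfolding eq k using less IH[folded L_def] less
      by (auto simp: L_def[symmetric] dest!: IH(2)[folded L_def])
  qed simp
  then show ?thesis by (simp add: red_def)
qed

lemma ig_weight_eq: "(x, y, w) \<in> set (ig_edges H) \<Longrightarrow> ig_weight H x y = w"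
  unfolding ig_weight_def
  by (rule the_equality) (use distinct_red in \<open>auto simp: distinct_map inj_on_def\<close>)

lemma red_edge_set_iff: "(x, y) \<in> ig_edge_set H \<longleftrightarrow>
   (\<exists>i < m. x = fst (es ! i) \<and> y = n + i) \<or> (\<exists>i < m. x = n + i \<and> (y = n + i \<or> y = snd (es ! i)))"
proof -
  have "(x, y) \<in> ig_edge_set H \<longleftrightarrow> (\<exists>w. (x, y, w) \<in> set (ig_edges H))"
    unfolding ig_edge_set_def by force
  then show ?thesis unfolding red_edges_iff by blast
qed

lemma red_edge_cases:
  assumes "(x, y) \<in> ig_edge_set H"
  obtains (enter) "x < n" "n \<le> y" "y < n + m" "src y = x" "ig_weight H x y = W"
  | (spin) "n \<le> x" "x < n + m" "y = x" "ig_weight H x y = int (col x)"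
  | (leave) "n \<le> x" "x < n + m" "y < n" "y = tgt x" "ig_weight H x y = W"
proof -
  obtain w where w: "(x, y, w) \<in> set (ig_edges H)" using assms by (force simp: ig_edge_set_def)
  note wt = ig_weight_eq[OF w]
  from w obtain i where i: "i < m" "(x, y, w) = (fst (es ! i), n + i, W)
    \<or> (x, y, w) = (n + i, n + i, int (colour G (fst (es ! i)))) \<or> (x, y, w) = (n + i, snd (es ! i), W)"
    unfolding red_edges_iff by blast
  from i(2) show thesis
  proof (elim disjE)
    assume "(x, y, w) = (fst (es ! i), n + i, W)"
    then show thesis using wt i edge_less[OF i(1)] by (intro enter) auto
  next
    assume "(x, y, w) = (n + i, n + i, int (colour G (fst (es ! i))))"
    then show thesis using wt i edge_less[OF i(1)] by (intro spin) auto
  next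
    assume "(x, y, w) = (n + i, snd (es ! i), W)"
    then show thesis using wt i edge_less[OF i(1)] by (intro leave) auto
  qed
qed

lemma wf_red: "wf_imp H"
proof -
  have 1: "length (ig_eve H) = ig_n H" by (simp add: red_def len_eve)
  have 2: "\<forall>(u, v, w) \<in> set (ig_edges H). u < ig_n H \<and> v < ig_n H"
  proof clarify
    fix u v w assume "(u, v, w) \<in> set (ig_edges H)"
    moreover have "ig_n H = n + m" by (simp add: red_def)
    ultimately show "u < ig_n H \<and> v < ig_n H"
      unfolding red_edges_iff using edge_less by (auto intro: trans_less_add1)
  qed
  have 4: "\<exists>v. (u, v) \<in> ig_edge_set H" if u: "u < ig_n H" for u
  proof (cases "u < n")
    case True
    then obtain v where "(u, v) \<in> set es" using out_edge by blast
    then obtain i where "i < m" "es ! i = (u, v)" by (metis in_set_conv_nth)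
    then show ?thesis unfolding red_edge_set_iff by force
  next
    case False
    then show ?thesis unfolding red_edge_set_iff using u
      by (intro exI[of _ u] disjI2 exI[of _ "u - n"]) (auto simp: red_def)
  qed
  have 5: "ig_init H < ig_n H" using init_less by (simp add: red_def)
  have 6: "\<forall>(lo, hi) \<in> set (ig_intervals H). bound_wf lo \<and> bound_wf hi" by (auto simp: red_def)
  show ?thesis unfolding wf_imp_def using 1 2 distinct_red 4 5 6 by blast
qed

lemma red_eve_orig: "u < n \<Longrightarrow> u \<in> ig_eve_vertices H \<longleftrightarrow> u \<in> pg_eve_vertices G"
  by (simp add: ig_eve_vertices_def pg_eve_vertices_def red_def nth_append len_eve)

lemma red_eve_edge: "n \<le> x \<Longrightarrow> x < n + m \<Longrightarrow> x \<in> ig_eve_vertices H \<longleftrightarrow> even (col x)"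
  by (simp add: ig_eve_vertices_def red_def nth_append len_eve even_prio_colour)

lemma red_interval_iff: "r \<in> interval_union (ig_intervals H) \<longleftrightarrow> (\<exists>j \<le> n. 2 * real j < r \<and> r \<le> 2 * real j + 1)"
proof -
  have "{0..<Suc n} = {..n}" by auto
  then show ?thesis by (simp add: red_def interval_union_def del: upt_Suc) (auto simp: algebra_simps)
qed

lemma colour_in_interval_iff:
  assumes "c \<le> 2 * n + 1"
  shows "real c \<in> interval_union (ig_intervals H) \<longleftrightarrow> odd c"
proof
  assume "real c \<in> interval_union (ig_intervals H)"
  then obtain j where "2 * real j < real c" "real c \<le> 2 * real j + 1" unfolding red_interval_iff by blast
  then have "2 * j < c" "c \<le> 2 * j + 1" by linarith+
  then have "c = 2 * j + 1" by simp
  then show "odd c" by simp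
next
  assume "odd c"
  then obtain j where "c = 2 * j + 1" by (elim oddE)
  then show "real c \<in> interval_union (ig_intervals H)"
    unfolding red_interval_iff using assms by (intro exI[of _ j]) auto
qed

lemma half_in_interval_iff:
  assumes "c \<le> 2 * n + 1"
  shows "real c + 1 / 2 \<in> interval_union (ig_intervals H) \<longleftrightarrow> even c"
proof
  assume "real c + 1 / 2 \<in> interval_union (ig_intervals H)"
  then obtain j where "2 * real j < real c + 1 / 2" "real c + 1 / 2 \<le> 2 * real j + 1" unfolding red_interval_iff by blast
  then have "2 * j \<le> c" "c \<le> 2 * j" by linarith+
  then have "c = 2 * j" by simp
  then show "even c" by simp
next
  assume "even c"
  then obtain j where "c = 2 * j" by (elim evenE)
  then show "real c + 1 / 2 \<in> interval_union (ig_intervals H)"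
    unfolding red_interval_iff using assms by (intro exI[of _ j]) auto
qed

lemma colour_le: "colour G u \<le> 2 * n + 1"
  using prio_colour_le[of "pg_prio G"] by (simp add: len_prio)

end

section \<open>Plays of the reduced game\<close>

context reduction
begin

abbreviation "PW \<equiv> prefix_weight H"

definition hist_weight :: "nat list \<Rightarrow> int" where
  "hist_weight h = (\<Sum>i < length h - 1. ig_weight H (h ! i) (h ! Suc i))"

text \<open>The average weight of the history exceeds \<open>c + 1/2\<close>, cleared of denominators.\<close>
definition keeps_spinning :: "nat list \<Rightarrow> bool" where
  "keeps_spinning h \<longleftrightarrow> (2 * int (col (last h)) + 1) * int (length h - 1) < 2 * hist_weight h"

lemma keeps_spinning_prefix:
  "keeps_spinning (map \<pi> [0..<Suc k]) \<longleftrightarrow> (2 * int (col (\<pi> k)) + 1) * int k < 2 * PW \<pi> k"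
proof -
  have "hist_weight (map \<pi> [0..<Suc k]) = PW \<pi> k"
    unfolding hist_weight_def prefix_weight_def by (intro sum.cong) (auto simp del: upt_Suc)
  then show ?thesis by (simp add: keeps_spinning_def)
qed

lemma PW_Suc: "PW \<pi> (Suc k) = PW \<pi> k + ig_weight H (\<pi> k) (\<pi> (Suc k))"
  by (simp add: prefix_weight_def)

definition hplay :: "(nat \<Rightarrow> nat) \<Rightarrow> bool" where
  "hplay \<pi> \<longleftrightarrow> is_play (ig_edge_set H) (pg_init G) \<pi>"

lemma hplay_edge: "hplay \<pi> \<Longrightarrow> (\<pi> k, \<pi> (Suc k)) \<in> ig_edge_set H"
  by (simp add: hplay_def is_play_def)

lemma hplay_0: "hplay \<pi> \<Longrightarrow> \<pi> 0 = pg_init G"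
  by (simp add: hplay_def is_play_def)

lemma hplay_enter: "hplay \<pi> \<Longrightarrow> \<pi> k < n \<Longrightarrow>
    n \<le> \<pi> (Suc k) \<and> \<pi> (Suc k) < n + m \<and> src (\<pi> (Suc k)) = \<pi> k \<and> ig_weight H (\<pi> k) (\<pi> (Suc k)) = W"
  by (erule red_edge_cases[OF hplay_edge[of \<pi> k]]) auto

lemma hplay_edge_vertex: "hplay \<pi> \<Longrightarrow> n \<le> \<pi> k \<Longrightarrow> \<pi> k < n + m \<and>
    (\<pi> (Suc k) = \<pi> k \<and> ig_weight H (\<pi> k) (\<pi> (Suc k)) = int (col (\<pi> k)) \<or>
     \<pi> (Suc k) = tgt (\<pi> k) \<and> \<pi> (Suc k) < n \<and> ig_weight H (\<pi> k) (\<pi> (Suc k)) = W)"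
  by (erule red_edge_cases[OF hplay_edge[of \<pi> k]]) auto

definition orig_times :: "(nat \<Rightarrow> nat) \<Rightarrow> nat set" where
  "orig_times \<pi> = {k. \<pi> k < n}"

text \<open>An edge vertex is left only towards an original vertex, so after the last original
  vertex the play repeats one loop and its weight grows linearly.\<close>

lemma stuck:
  assumes "hplay \<pi>" "finite (orig_times \<pi>)"
  obtains K x where "n \<le> x" "x < n + m" "\<And>k. k \<ge> K \<Longrightarrow> \<pi> k = x" "lim_inf_mp H \<pi> = ereal (real (col x))"
proof -
  obtain K where K: "\<And>k. k \<in> orig_times \<pi> \<Longrightarrow> k < K"
    using assms(2) finite_nat_bounded by (metis lessThan_iff subsetD)
  have ge: "n \<le> \<pi> k" if "k \<ge> K" for k using K[of k] that by (force simp: orig_times_def)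
  have const: "\<pi> k = \<pi> K" if "k \<ge> K" for k
    using that
  proof (induction k rule: dec_induct)
    case (step k)
    then show ?case using hplay_edge_vertex[OF assms(1) ge[of k]] ge[of "Suc k"] by simp
  qed simp
  have "PW \<pi> (Suc k) = PW \<pi> k + int (col (\<pi> K))" if "k \<ge> K" for k
    using hplay_edge_vertex[OF assms(1) ge[OF that]] ge[of "Suc k"] const[OF that] const[of "Suc k"] that
    by (auto simp: PW_Suc)
  from liminf_eventually_linear[of K "PW \<pi>", OF this]
  have "lim_inf_mp H \<pi> = ereal (real (col (\<pi> K)))" by (simp add: lim_inf_mp_def)
  from that[OF _ _ const this] show thesis using ge[of K] hplay_edge_vertex[OF assms(1), of K] by blast
qed

text \<open>Each round of the loop lowers \<open>?D\<close> by exactly 1, so an owner who follows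
  the rule leaves eventually.\<close>

lemma not_always_spinning:
  assumes "hplay \<pi>" "n \<le> x" "\<And>k. k \<ge> K \<Longrightarrow> \<pi> k = x"
    and "\<And>k. k \<ge> K \<Longrightarrow> keeps_spinning (map \<pi> [0..<Suc k])"
  shows False
proof -
  let ?D = "\<lambda>k. 2 * PW \<pi> k - (2 * int (col x) + 1) * int k"
  have pos: "?D k > 0" if "k \<ge> K" for k
    using assms(4)[OF that] assms(3)[OF that] unfolding keeps_spinning_prefix by simp
  have "?D (K + j) = ?D K - int j" for j
  proof (induction j)
    case (Suc j)
    have "\<pi> (K + j) = x" "\<pi> (Suc (K + j)) = x" using assms(3) by auto
    then have "ig_weight H (\<pi> (K + j)) (\<pi> (Suc (K + j))) = int (col x)"
      using hplay_edge_vertex[OF assms(1), of "K + j"] assms(2) by auto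
    then show ?case using Suc by (simp add: PW_Suc algebra_simps)
  qed simp
  from this[of "nat (?D K)"] pos[of "K + nat (?D K)"] pos[of K] show False by simp
qed

lemma leaves_eventually:
  assumes "hplay \<pi>" "infinite (orig_times \<pi>)" "n \<le> \<pi> k"
  obtains j where "j \<ge> k" "\<forall>i \<in> {k..j}. \<pi> i = \<pi> k" "\<pi> (Suc j) = tgt (\<pi> k)" "\<pi> (Suc j) < n"
proof -
  obtain l where l: "l > k" "\<pi> l < n" using assms(2) by (auto simp: orig_times_def infinite_nat_iff_unbounded)
  \<comment> \<open>The next visit to an original vertex; before it the play can only stay on the
    same edge vertex.\<close>
  define l0 where "l0 = (LEAST l. l > k \<and> \<pi> l < n)"
  have l0: "l0 > k" "\<pi> l0 < n" using LeastI[of "\<lambda>l. l > k \<and> \<pi> l < n" l] l by (auto simp: l0_def)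
  have ge: "n \<le> \<pi> i" if "k \<le> i" "i < l0" for i
    using not_less_Least[of i "\<lambda>l. l > k \<and> \<pi> l < n"] that assms(3) by (cases "i = k") (auto simp: l0_def)
  have const: "\<pi> i = \<pi> k" if "k \<le> i" "i < l0" for i
    using that
  proof (induction i rule: dec_induct)
    case (step i)
    then show ?case using hplay_edge_vertex[OF assms(1) ge[of i]] ge[of "Suc i"] by simp
  qed simp
  obtain j where j: "l0 = Suc j" using l0(1) by (cases l0) auto
  show thesis
  proof (rule that[of j])
    show "j \<ge> k" using l0 j by simp
    show "\<pi> (Suc j) < n" using l0 j by simp
    show "\<forall>i \<in> {k..j}. \<pi> i = \<pi> k"
    proof
      fix i assume "i \<in> {k..j}"
      then show "\<pi> i = \<pi> k" using j by (intro const) auto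
    qed
    have "\<pi> j = \<pi> k" using const[of j] l0 j by simp
    then show "\<pi> (Suc j) = tgt (\<pi> k)" using hplay_edge_vertex[OF assms(1), of j] assms(3) l0 j by auto
  qed
qed

text \<open>Obedience is demanded only on loops of colour exactly \<open>a\<close>: a larger colour
  is at least \<open>a + 1\<close>, hence above \<open>a + 1/2\<close>, and such a loop pushes the
  average up whoever owns it.\<close>

lemma liminf_colour_half:
  assumes play: "hplay \<pi>" and inf: "infinite (orig_times \<pi>)"
    and inf_a: "infinite {k. \<pi> k < n \<and> colour G (\<pi> k) = a}"
    and low: "\<And>k. k \<ge> K \<Longrightarrow> \<pi> k < n \<Longrightarrow> a \<le> colour G (\<pi> k)"
    and obey: "\<And>k. n \<le> \<pi> k \<Longrightarrow> col (\<pi> k) = a \<Longrightarrow> \<pi> (Suc k) = \<pi> k \<longleftrightarrow> keeps_spinning (map \<pi> [0..<Suc k])"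
  shows "lim_inf_mp H \<pi> = ereal (real a + 1 / 2)"
proof -
  let ?D = "\<lambda>k. 2 * PW \<pi> k - (2 * int a + 1) * int k"
  have "\<exists>k \<ge> K. \<pi> k < n" using inf by (auto simp: orig_times_def infinite_nat_iff_unbounded_le)
  \<comment> \<open>Counting starts at an original vertex, because at time \<open>K\<close> the play
    may still sit on a loop of smaller colour entered earlier.\<close>
  then obtain k1 where k1: "k1 \<ge> K" "\<pi> k1 < n" by blast
  have low': "n \<le> \<pi> k \<longrightarrow> a \<le> col (\<pi> k)" if "k \<ge> k1" for k
    using that
  proof (induction k rule: dec_induct)
    case (step k)
    show ?case
    proof (cases "\<pi> k < n")
      case True
      then show ?thesis using hplay_enter[OF play True] low[of k] k1 step by auto
    next
      case False
      then show ?thesis using hplay_edge_vertex[OF play, of k] step by auto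
    qed
  qed (use k1 in simp)
  \<comment> \<open>This makes \<open>2 * W - (2 * a + 1)\<close> positive: entering and leaving
    edge vertices raises \<open>?D\<close>.\<close>
  have aW: "a + 1 \<le> top_weight G"
  proof -
    obtain k where "colour G (\<pi> k) = a" using inf_a not_finite_existsD by blast
    then show ?thesis using colour_le[of "\<pi> k"] by simp
  qed
  have step: "?D (Suc k) = ?D k + 2 * ig_weight H (\<pi> k) (\<pi> (Suc k)) - (2 * int a + 1)" for k
    by (simp add: PW_Suc algebra_simps)
  have cases: "?D (Suc k) \<ge> ?D k + 1 \<or> ?D k > 0 \<and> ?D (Suc k) = ?D k - 1" if "k \<ge> k1" for k
  proof (cases "\<pi> k < n")
    case True
    then show ?thesis using hplay_enter[OF play True] aW step[of k] by simp
  next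
    case False
    then consider "\<pi> (Suc k) = \<pi> k" "ig_weight H (\<pi> k) (\<pi> (Suc k)) = int (col (\<pi> k))" | "ig_weight H (\<pi> k) (\<pi> (Suc k)) = W"
      using hplay_edge_vertex[OF play, of k] by auto
    then show ?thesis
    proof cases
      case 1
      have "a \<le> col (\<pi> k)" using low'[OF that] False by simp
      then show ?thesis
      proof (cases "col (\<pi> k) = a")
        case True
        then have "?D k > 0" using obey[of k] 1 False unfolding keeps_spinning_prefix by simp
        then show ?thesis using 1 True step[of k] by simp
      next
        case False
        with \<open>a \<le> col (\<pi> k)\<close> have "int a + 1 \<le> int (col (\<pi> k))" by simp
        then show ?thesis using step[of k] 1(2) by simp
      qed
    next
      case 2
      then show ?thesis using aW step[of k] by simp
    qed
  qed
  \<comment> \<open>Vertices of colour \<open>a\<close> recur, each is followed by a loop of colour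
    \<open>a\<close>, and such a loop is left only when the rule fails, that is with
    \<open>?D j \<le> 0\<close>.\<close>
  have "\<exists>k \<ge> N. ?D k \<le> 0" for N
  proof -
    obtain k where k: "k \<ge> N" "\<pi> k < n" "colour G (\<pi> k) = a"
      using inf_a by (auto simp: infinite_nat_iff_unbounded_le)
    have e: "n \<le> \<pi> (Suc k)" "col (\<pi> (Suc k)) = a" using hplay_enter[OF play k(2)] k(3) by auto
    obtain j where j: "j \<ge> Suc k" "\<forall>i \<in> {Suc k..j}. \<pi> i = \<pi> (Suc k)"
      "\<pi> (Suc j) = tgt (\<pi> (Suc k))" "\<pi> (Suc j) < n"
      using leaves_eventually[OF play inf e(1)] by blast
    have "\<pi> j = \<pi> (Suc k)" using bspec[OF j(2), of j] j(1) by simp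
    then have "\<not> keeps_spinning (map \<pi> [0..<Suc j])" using obey[of j] e j(4) by auto
    then have "?D j \<le> 0" unfolding keeps_spinning_prefix using \<open>\<pi> j = _\<close> e by simp
    then show ?thesis using j(1) k(1) by (intro exI[of _ j]) auto
  qed
  note often = this
  have "liminf (\<lambda>k. ereal (real_of_int (PW \<pi> k) / real k)) = ereal (real_of_int (int a) + 1 / 2)"
  proof (rule liminf_eq_half[of k1])
    show "?D (Suc k) \<ge> ?D k + 1" if "k1 \<le> k" "?D k \<le> 0" for k using cases[OF that(1)] that(2) by linarith
    show "?D (Suc k) \<ge> ?D k - 1" if "k1 \<le> k" for k using cases[OF that] by linarith
    show "\<exists>k \<ge> N. ?D k \<le> 0" for N by (rule often)
  qed
  then show ?thesis by (simp add: lim_inf_mp_def)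
qed

section \<open>Projecting a play to its original vertices\<close>

definition visits :: "(nat \<Rightarrow> nat) \<Rightarrow> nat \<Rightarrow> nat" where
  "visits \<pi> k = card {j. j < k \<and> \<pi> j < n}"

lemma visits_0 [simp]: "visits \<pi> 0 = 0"
  by (simp add: visits_def)

lemma visits_Suc [simp]: "visits \<pi> (Suc k) = visits \<pi> k + (if \<pi> k < n then 1 else 0)"
proof -
  have "{j. j < Suc k \<and> \<pi> j < n} = (if \<pi> k < n then insert k {j. j < k \<and> \<pi> j < n} else {j. j < k \<and> \<pi> j < n})"
    by (auto simp: less_Suc_eq)
  then show ?thesis by (simp add: visits_def)
qed

lemma visits_mono: "j \<le> k \<Longrightarrow> visits \<pi> j \<le> visits \<pi> k"
  unfolding visits_def by (intro card_mono) auto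

lemma visits_inject:
  assumes "\<pi> j < n" "\<pi> k < n" "visits \<pi> j = visits \<pi> k"
  shows "j = k"
proof -
  have "\<not> j < k" if "\<pi> j < n" "visits \<pi> j = visits \<pi> k" for j k
    using that visits_mono[of "Suc j" k \<pi>] by auto
  from this[of j k] this[of k j] assms show ?thesis by simp
qed

lemma visits_surj:
  assumes "infinite (orig_times \<pi>)"
  obtains k where "\<pi> k < n" "visits \<pi> k = j"
proof -
  have "\<exists>k. visits \<pi> k \<ge> j" for j
  proof (induction j)
    case (Suc j)
    then obtain k where k: "visits \<pi> k \<ge> j" by blast
    obtain l where l: "l \<ge> k" "\<pi> l < n" using assms by (auto simp: orig_times_def infinite_nat_iff_unbounded_le)
    then show ?case using visits_mono[OF l(1), of \<pi>] k by (intro exI[of _ "Suc l"]) auto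
  qed simp
  then obtain k where k: "visits \<pi> k \<ge> Suc j" by blast
  define l where "l = (LEAST k. visits \<pi> k \<ge> Suc j)"
  have l: "visits \<pi> l \<ge> Suc j" unfolding l_def by (rule LeastI[of _ k]) (rule k)
  then obtain i where i: "l = Suc i" by (cases l) auto
  have "\<not> visits \<pi> i \<ge> Suc j" using not_less_Least[of i "\<lambda>k. visits \<pi> k \<ge> Suc j"] i l_def by simp
  then show thesis using that[of i] l i by (auto split: if_splits)
qed

text \<open>\<open>visits\<close> counts strictly earlier times, so an original vertex at time
  \<open>k\<close> has index \<open>visits \<pi> k\<close> in a projected play that starts at index
  0.\<close>

definition projects :: "(nat \<Rightarrow> nat) \<Rightarrow> (nat \<Rightarrow> nat) \<Rightarrow> bool" where
  "projects \<pi> \<rho> \<longleftrightarrow> (\<forall>k. \<pi> k < n \<longrightarrow> \<pi> k = \<rho> (visits \<pi> k))"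

text \<open>\<open>visits\<close> is a bijection between the times at original vertices and the
  positions of \<open>\<rho>\<close>.\<close>

lemma projects_infinite:
  assumes "infinite (orig_times \<pi>)" "projects \<pi> \<rho>"
  shows "infinite {j. Q (\<rho> j)} \<longleftrightarrow> infinite {k. \<pi> k < n \<and> Q (\<pi> k)}"
proof -
  have "{j. Q (\<rho> j)} = visits \<pi> ` {k. \<pi> k < n \<and> Q (\<pi> k)}"
  proof (intro set_eqI iffI)
    fix j assume "j \<in> {j. Q (\<rho> j)}"
    moreover obtain k where "\<pi> k < n" "visits \<pi> k = j" using visits_surj[OF assms(1)] by metis
    ultimately show "j \<in> visits \<pi> ` {k. \<pi> k < n \<and> Q (\<pi> k)}" using assms(2) unfolding projects_def by force
  next
    fix j assume "j \<in> visits \<pi> ` {k. \<pi> k < n \<and> Q (\<pi> k)}"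
    then show "j \<in> {j. Q (\<rho> j)}" using assms(2) unfolding projects_def by force
  qed
  moreover have "inj_on (visits \<pi>) {k. \<pi> k < n \<and> Q (\<pi> k)}"
    by (rule inj_onI) (auto intro: visits_inject)
  ultimately show ?thesis by (simp add: finite_image_iff)
qed

text \<open>Common core of both directions: the player favoured by the parity of \<open>p\<close>
  obeys the rule on all loops of that parity, which include those of the least recurring
  colour.\<close>

lemma liminf_projection:
  assumes play: "hplay \<pi>" and inf: "infinite (orig_times \<pi>)" and proj: "projects \<pi> \<rho>"
    and range: "\<And>j. \<rho> j < n"
  defines "p \<equiv> Min {p. infinite {j. pg_prio G ! \<rho> j = p}}"
  assumes obey: "\<And>k. n \<le> \<pi> k \<Longrightarrow> even (col (\<pi> k)) = even p \<Longrightarrow>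
    \<pi> (Suc k) = \<pi> k \<longleftrightarrow> keeps_spinning (map \<pi> [0..<Suc k])"
  shows "imp_winning H \<pi> \<longleftrightarrow> even p"
proof -
  let ?I = "{p. infinite {j. pg_prio G ! \<rho> j = p}}"
  let ?a = "prio_colour (pg_prio G) p"
  have sub: "?I \<subseteq> set (pg_prio G)"
  proof
    fix q assume "q \<in> ?I"
    then obtain j where "pg_prio G ! \<rho> j = q" using not_finite_existsD by blast
    then show "q \<in> set (pg_prio G)" using range[of j] len_prio by (metis nth_mem)
  qed
  then have fin: "finite ?I" using finite_subset by blast
  have ne: "?I \<noteq> {}"
  proof -
    have "finite (range (\<lambda>j. pg_prio G ! \<rho> j))"
      by (rule finite_subset[of _ "set (pg_prio G)"]) (use range len_prio in auto)
    from pigeonhole_infinite[OF infinite_UNIV_nat this] show ?thesis by auto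
  qed
  have p: "p \<in> ?I" unfolding p_def by (rule Min_in[OF fin ne])
  have p_set: "p \<in> set (pg_prio G)" using p sub by blast
  have "finite {j. pg_prio G ! \<rho> j < p}"
  proof -
    have "{j. pg_prio G ! \<rho> j < p} = (\<Union>q \<in> {..<p}. {j. pg_prio G ! \<rho> j = q})" by auto
    moreover have "finite {j. pg_prio G ! \<rho> j = q}" if "q < p" for q
    proof (rule ccontr)
      assume "infinite {j. pg_prio G ! \<rho> j = q}"
      then have "p \<le> q" unfolding p_def by (intro Min_le[OF fin]) simp
      then show False using that by simp
    qed
    ultimately show ?thesis by simp
  qed
  then have "finite {k. \<pi> k < n \<and> pg_prio G ! \<pi> k < p}"
    using projects_infinite[OF inf proj, of "\<lambda>u. pg_prio G ! u < p"] by blast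
  then obtain K where K: "\<And>k. \<pi> k < n \<Longrightarrow> pg_prio G ! \<pi> k < p \<Longrightarrow> k < K"
    using finite_nat_bounded by (metis (mono_tags, lifting) lessThan_iff mem_Collect_eq subsetD)
  have low: "?a \<le> colour G (\<pi> k)" if "k \<ge> K" "\<pi> k < n" for k
  proof (cases "pg_prio G ! \<pi> k = p")
    case False
    then have "p < pg_prio G ! \<pi> k" using K[of k] that by force
    then show ?thesis using prio_colour_less[OF p_set] by (simp add: less_imp_le)
  qed simp
  have "infinite {k. \<pi> k < n \<and> pg_prio G ! \<pi> k = p}"
    using projects_infinite[OF inf proj, of "\<lambda>u. pg_prio G ! u = p"] p by blast
  then have inf_a: "infinite {k. \<pi> k < n \<and> colour G (\<pi> k) = ?a}"
    by (rule infinite_super[rotated]) auto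
  have "lim_inf_mp H \<pi> = ereal (real ?a + 1 / 2)"
  proof (rule liminf_colour_half[OF play inf inf_a low])
    fix k assume "n \<le> \<pi> k" "col (\<pi> k) = ?a"
    then show "\<pi> (Suc k) = \<pi> k \<longleftrightarrow> keeps_spinning (map \<pi> [0..<Suc k])"
      by (intro obey) (simp_all add: even_prio_colour)
  qed
  moreover have "?a \<le> 2 * n + 1" using prio_colour_le[of "pg_prio G" p] by (simp add: len_prio)
  ultimately show ?thesis unfolding imp_winning_def using half_in_interval_iff[of ?a]
    by (auto simp: even_prio_colour)
qed

end

context reduction
begin

section \<open>From parity strategies to mean-payoff strategies\<close>

lemma ig_init_red: "ig_init H = pg_init G"
  by (simp add: red_def)

text \<open>Dropping edge vertices from the history recovers the parity history for
  \<open>\<sigma>\<close>; among repeated entries of one edge any index will do.\<close>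

definition mp_strategy :: "(nat list \<Rightarrow> nat) \<Rightarrow> nat list \<Rightarrow> nat" where
  "mp_strategy \<sigma> h = (if last h < n then n + (SOME i. i < m \<and> es ! i = (last h, \<sigma> (filter (\<lambda>x. x < n) h)))
     else if keeps_spinning h then last h else tgt (last h))"

lemma edge_index: "(u, v) \<in> set es \<Longrightarrow> (SOME i. i < m \<and> es ! i = (u, v)) < m \<and> es ! (SOME i. i < m \<and> es ! i = (u, v)) = (u, v)"
  by (rule someI_ex) (auto simp: in_set_conv_nth)

lemma last_filter_less: "h \<noteq> [] \<Longrightarrow> last h < n \<Longrightarrow> last (filter (\<lambda>x. x < n) h) = last h \<and> filter (\<lambda>x. x < n) h \<noteq> []"
  by (cases h rule: rev_cases) auto

lemma mp_strategy_orig: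
  assumes "legal_strategy (set es) (pg_eve_vertices G) \<sigma>" "h \<noteq> []" "last h \<in> pg_eve_vertices G" "last h < n"
  shows "\<exists>i < m. mp_strategy \<sigma> h = n + i \<and> es ! i = (last h, \<sigma> (filter (\<lambda>x. x < n) h))"
proof -
  have "(last h, \<sigma> (filter (\<lambda>x. x < n) h)) \<in> set es"
    using assms last_filter_less[OF assms(2,4)] unfolding legal_strategy_def by metis
  from edge_index[OF this] show ?thesis using assms(4) by (simp add: mp_strategy_def)
qed

lemma legal_mp_strategy:
  assumes "legal_strategy (set es) (pg_eve_vertices G) \<sigma>"
  shows "legal_strategy (ig_edge_set H) (ig_eve_vertices H) (mp_strategy \<sigma>)"
  unfolding legal_strategy_def
proof (intro allI impI)
  fix h assume h: "h \<noteq> [] \<and> last h \<in> ig_eve_vertices H"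
  show "(last h, mp_strategy \<sigma> h) \<in> ig_edge_set H"
  proof (cases "last h < n")
    case True
    then obtain i where "i < m" "mp_strategy \<sigma> h = n + i" "es ! i = (last h, \<sigma> (filter (\<lambda>x. x < n) h))"
      using mp_strategy_orig[OF assms] h red_eve_orig by blast
    then show ?thesis unfolding red_edge_set_iff by (intro disjI1 exI[of _ i]) simp
  next
    case False
    then have "mp_strategy \<sigma> h = last h \<or> mp_strategy \<sigma> h = tgt (last h)" by (simp add: mp_strategy_def)
    moreover have "last h < n + m" using h by (simp add: ig_eve_vertices_def red_def)
    ultimately show ?thesis unfolding red_edge_set_iff
      using False by (intro disjI2 exI[of _ "last h - n"]) auto
  qed
qed

definition projection :: "(nat \<Rightarrow> nat) \<Rightarrow> nat \<Rightarrow> nat" where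
  "projection \<pi> j = \<pi> (SOME k. \<pi> k < n \<and> visits \<pi> k = j)"

lemma projects_projection: "projects \<pi> (projection \<pi>)"
  unfolding projects_def
proof (intro allI impI)
  fix k assume k: "\<pi> k < n"
  let ?l = "SOME l. \<pi> l < n \<and> visits \<pi> l = visits \<pi> k"
  have "\<pi> ?l < n \<and> visits \<pi> ?l = visits \<pi> k" by (rule someI[of _ k]) (use k in simp)
  then have "?l = k" using k visits_inject by blast
  then show "\<pi> k = projection \<pi> (visits \<pi> k)" by (simp add: projection_def)
qed

lemma filter_orig:
  assumes "projects \<pi> \<rho>"
  shows "filter (\<lambda>x. x < n) (map \<pi> [0..<k]) = map \<rho> [0..<visits \<pi> k]"
proof (induction k)
  case (Suc k)
  then show ?case using assms unfolding projects_def by auto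
qed simp

lemma next_orig:
  assumes "hplay \<pi>" "infinite (orig_times \<pi>)" "projects \<pi> \<rho>" "\<pi> k < n"
  shows "\<rho> (Suc (visits \<pi> k)) = tgt (\<pi> (Suc k))"
proof -
  have e: "n \<le> \<pi> (Suc k)" using hplay_enter[OF assms(1,4)] by simp
  obtain j where j: "j \<ge> Suc k" "\<forall>i \<in> {Suc k..j}. \<pi> i = \<pi> (Suc k)" "\<pi> (Suc j) = tgt (\<pi> (Suc k))" "\<pi> (Suc j) < n"
    using leaves_eventually[OF assms(1,2) e] by blast
  have "visits \<pi> (Suc i) = Suc (visits \<pi> k)" if "k \<le> i" "i \<le> j" for i
    using that
  proof (induction i rule: dec_induct)
    case base
    then show ?case using assms(4) by simp
  next
    case (step i)
    have "\<pi> (Suc i) = \<pi> (Suc k)" using bspec[OF j(2), of "Suc i"] step by simp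
    then show ?case using step e by simp
  qed
  from this[of j] have "visits \<pi> (Suc j) = Suc (visits \<pi> k)" using j(1) by simp
  then show ?thesis using assms(3) j(3,4) unfolding projects_def by metis
qed

lemma red_wins_if_parity_wins:
  assumes "pg_eve_wins G"
  shows "imp_eve_wins H"
proof -
  obtain \<sigma> where legal: "legal_strategy (set es) (pg_eve_vertices G) \<sigma>"
    and win: "\<And>\<rho>. is_play (set es) (pg_init G) \<rho> \<Longrightarrow> consistent_with (pg_eve_vertices G) \<sigma> \<rho> \<Longrightarrow> parity_winning G \<rho>"
    using assms unfolding pg_eve_wins_def eve_wins_def by blast
  have "imp_winning H \<pi>" if play: "hplay \<pi>" and con: "consistent_with (ig_eve_vertices H) (mp_strategy \<sigma>) \<pi>" for \<pi>
  proof -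
    have move: "\<pi> (Suc k) = mp_strategy \<sigma> (map \<pi> [0..<Suc k])" if "\<pi> k \<in> ig_eve_vertices H" for k
      using con that unfolding consistent_with_def by blast
    have last: "last (map \<pi> [0..<Suc k]) = \<pi> k" for k by simp
    \<comment> \<open>The target is an original vertex and so differs from \<open>\<pi> k\<close>;
      hence staying happens exactly when the rule says so.\<close>
    have spin: "\<pi> (Suc k) = \<pi> k \<longleftrightarrow> keeps_spinning (map \<pi> [0..<Suc k])" if "n \<le> \<pi> k" "even (col (\<pi> k))" for k
    proof -
      have k: "\<pi> k < n + m" using hplay_edge_vertex[OF play that(1)] by simp
      then have "\<pi> (Suc k) = mp_strategy \<sigma> (map \<pi> [0..<Suc k])" using that red_eve_edge by (intro move) simp
      then have "\<pi> (Suc k) = (if keeps_spinning (map \<pi> [0..<Suc k]) then \<pi> k else tgt (\<pi> k))"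
        unfolding mp_strategy_def last using that by simp
      moreover have "tgt (\<pi> k) < n" using edge_less(2)[of "\<pi> k - n"] k that by simp
      ultimately show ?thesis using that by auto
    qed
    show ?thesis
    proof (cases "finite (orig_times \<pi>)")
      case True
      obtain K x where x: "n \<le> x" "x < n + m" "\<And>k. k \<ge> K \<Longrightarrow> \<pi> k = x" "lim_inf_mp H \<pi> = ereal (real (col x))"
        using stuck[OF play True] by metis
      \<comment> \<open>On an even loop Eve would spin forever by the rule, which is impossible. So
        the play is stuck on a loop of Adam, whose odd value lies in an interval.\<close>
      have "odd (col x)"
      proof
        assume even: "even (col x)"
        have "keeps_spinning (map \<pi> [0..<Suc k])" if "k \<ge> K" for k
          using spin[of k] x(3)[of k] x(3)[of "Suc k"] that x(1) even by (simp del: upt_Suc)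
        then show False using not_always_spinning[OF play x(1), of K] x(3) by blast
      qed
      then show ?thesis unfolding imp_winning_def x(4)
        using colour_in_interval_iff[OF colour_le] by blast
    next
      case False
      define \<rho> where "\<rho> = projection \<pi>"
      have proj: "projects \<pi> \<rho>" unfolding \<rho>_def by (rule projects_projection)
      have time: "\<exists>k. \<pi> k < n \<and> visits \<pi> k = j \<and> \<rho> j = \<pi> k" for j
        using visits_surj[OF False, of j] proj unfolding projects_def by metis
      have "is_play (set es) (pg_init G) \<rho>" unfolding is_play_def
      proof (intro conjI allI)
        show "\<rho> 0 = pg_init G" using proj hplay_0[OF play] init_less unfolding projects_def by (metis visits_0)
        fix j
        obtain k where k: "\<pi> k < n" "visits \<pi> k = j" "\<rho> j = \<pi> k" using time by blast
        have "\<rho> (Suc j) = tgt (\<pi> (Suc k))" using next_orig[OF play False proj k(1)] k(2) by simp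
        moreover have "\<rho> j = src (\<pi> (Suc k))" "\<pi> (Suc k) - n < m" using hplay_enter[OF play k(1)] k(3) by auto
        ultimately show "(\<rho> j, \<rho> (Suc j)) \<in> set es" by simp
      qed
      moreover have "consistent_with (pg_eve_vertices G) \<sigma> \<rho>" unfolding consistent_with_def
      proof (intro allI impI)
        fix j assume j: "\<rho> j \<in> pg_eve_vertices G"
        obtain k where k: "\<pi> k < n" "visits \<pi> k = j" "\<rho> j = \<pi> k" using time by blast
        have eve: "\<pi> k \<in> pg_eve_vertices G" using j k(3) by simp
        then have "\<pi> (Suc k) = mp_strategy \<sigma> (map \<pi> [0..<Suc k])" using red_eve_orig[OF k(1)] by (intro move) simp
        moreover obtain i where "i < m" "mp_strategy \<sigma> (map \<pi> [0..<Suc k]) = n + i"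
          "es ! i = (\<pi> k, \<sigma> (filter (\<lambda>x. x < n) (map \<pi> [0..<Suc k])))"
          using mp_strategy_orig[OF legal, of "map \<pi> [0..<Suc k]"] eve k(1) unfolding last by auto
        moreover have "filter (\<lambda>x. x < n) (map \<pi> [0..<Suc k]) = map \<rho> [0..<Suc j]"
          using filter_orig[OF proj, of "Suc k"] k(1,2) by simp
        ultimately show "\<rho> (Suc j) = \<sigma> (map \<rho> [0..<Suc j])"
          using next_orig[OF play False proj k(1)] k(2) by simp
      qed
      ultimately have even: "even (Min {p. infinite {j. pg_prio G ! \<rho> j = p}})"
        using win unfolding parity_winning_def by blast
      have range: "\<rho> j < n" for j using time[of j] by auto
      \<comment> \<open>The minimum is even, so the loops on which obedience is demanded are exactly
        those of Eve.\<close>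
      show ?thesis using liminf_projection[OF play False proj range] spin even by blast
    qed
  qed
  then show ?thesis unfolding imp_eve_wins_def eve_wins_def ig_init_red hplay_def
    using legal_mp_strategy[OF legal] by blast
qed

section \<open>From mean-payoff strategies to parity strategies\<close>

text \<open>Adam's part is scripted: \<open>v\<close> is the next vertex of the parity play, used
  when he leaves an original vertex, and on his loops he follows the rule.\<close>

definition advance :: "(nat list \<Rightarrow> nat) \<Rightarrow> nat list \<Rightarrow> nat \<Rightarrow> nat" where
  "advance \<tau> h v = (if last h \<in> ig_eve_vertices H then \<tau> h
     else if last h < n then n + (SOME i. i < m \<and> es ! i = (last h, v))
     else if keeps_spinning h then last h else tgt (last h))"

abbreviation num_orig :: "nat list \<Rightarrow> nat" where
  "num_orig h \<equiv> length (filter (\<lambda>x. x < n) h)"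

text \<open>Eve's mean-payoff strategy plays against an opponent who follows the parity play
  and spins as long as the average is too high.\<close>
primrec expansion :: "(nat list \<Rightarrow> nat) \<Rightarrow> (nat \<Rightarrow> nat) \<Rightarrow> nat \<Rightarrow> nat list" where
  "expansion \<tau> \<rho> 0 = [\<rho> 0]"
| "expansion \<tau> \<rho> (Suc k) = expansion \<tau> \<rho> k @ [advance \<tau> (expansion \<tau> \<rho> k) (\<rho> (num_orig (expansion \<tau> \<rho> k)))]"

text \<open>The prefix \<open>r\<close> determines the expansion up to its last vertex; there
  \<open>\<tau>\<close> picks an edge vertex, whose target is the answer. The fallback keeps the
  strategy legal where that answer is no edge.\<close>

definition parity_strategy :: "(nat list \<Rightarrow> nat) \<Rightarrow> nat list \<Rightarrow> nat" where
  "parity_strategy \<tau> r = (let k = (LEAST k. num_orig (expansion \<tau> ((!) r) k) = length r);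
       v = tgt (\<tau> (expansion \<tau> ((!) r) k)) in
     if (last r, v) \<in> set es then v else (SOME v. (last r, v) \<in> set es))"

lemma legal_parity_strategy: "legal_strategy (set es) (pg_eve_vertices G) (parity_strategy \<tau>)"
  unfolding legal_strategy_def
proof (intro allI impI)
  fix h assume "h \<noteq> [] \<and> last h \<in> pg_eve_vertices G"
  then have "last h < n" by (simp add: pg_eve_vertices_def)
  then have "(last h, SOME v. (last h, v) \<in> set es) \<in> set es" using out_edge by (metis someI_ex)
  then show "(last h, parity_strategy \<tau> h) \<in> set es" by (simp add: parity_strategy_def Let_def)
qed

lemma expansion_play: "expansion \<tau> \<rho> k = map (\<lambda>k. last (expansion \<tau> \<rho> k)) [0..<Suc k]"
proof (induction k)
  case (Suc k)
  have "map (\<lambda>k. last (expansion \<tau> \<rho> k)) [0..<Suc (Suc k)]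
      = map (\<lambda>k. last (expansion \<tau> \<rho> k)) [0..<Suc k] @ [last (expansion \<tau> \<rho> (Suc k))]"
    by simp
  also have "\<dots> = expansion \<tau> \<rho> k @ [last (expansion \<tau> \<rho> (Suc k))]" by (simp only: Suc[symmetric])
  also have "\<dots> = expansion \<tau> \<rho> (Suc k)" by simp
  finally show ?case ..
qed simp

lemma num_orig_mono: "j \<le> k \<Longrightarrow> num_orig (expansion \<tau> \<rho> j) \<le> num_orig (expansion \<tau> \<rho> k)"
  by (induction k rule: dec_induct) auto

text \<open>The expansion reads \<open>\<rho>\<close> only at the number of original vertices
  reached so far, so the first \<open>c\<close> entries determine it until that number reaches
  \<open>c\<close>.\<close>

lemma expansion_cong:
  assumes "\<And>i. i < c \<Longrightarrow> \<rho>' i = \<rho> i" "0 < c"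
  shows "(\<And>j. j < k \<Longrightarrow> num_orig (expansion \<tau> \<rho> j) < c) \<Longrightarrow> expansion \<tau> \<rho>' k = expansion \<tau> \<rho> k"
  by (induction k) (auto simp: assms)

lemma parity_strategy_eq:
  assumes "last (expansion \<tau> \<rho> k) < n" "num_orig (expansion \<tau> \<rho> k) = c"
    and "(\<rho> (c - 1), tgt (\<tau> (expansion \<tau> \<rho> k))) \<in> set es"
  shows "parity_strategy \<tau> (map \<rho> [0..<c]) = tgt (\<tau> (expansion \<tau> \<rho> k))"
proof -
  let ?r = "map \<rho> [0..<c]"
  have c: "0 < c"
  proof -
    have "expansion \<tau> \<rho> k \<noteq> []" by (cases k) auto
    then have "last (expansion \<tau> \<rho> k) \<in> set (filter (\<lambda>x. x < n) (expansion \<tau> \<rho> k))" using assms(1) by simp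
    then show ?thesis using assms(2) by (metis length_pos_if_in_set)
  qed
  \<comment> \<open>Position \<open>k\<close> holds an original vertex, so the count rises to
    \<open>c\<close> exactly there and \<open>k\<close> is the least such position.\<close>
  have less: "num_orig (expansion \<tau> \<rho> j) < c" if jk: "j < k" for j
  proof -
    obtain l where l: "k = Suc l" using jk by (cases k) auto
    then have "num_orig (expansion \<tau> \<rho> j) \<le> num_orig (expansion \<tau> \<rho> l)" using jk by (intro num_orig_mono) simp
    moreover have "c = Suc (num_orig (expansion \<tau> \<rho> l))" using assms(1,2) l by auto
    ultimately show ?thesis by simp
  qed
  have eq: "expansion \<tau> ((!) ?r) j = expansion \<tau> \<rho> j" if "j \<le> k" for j
    by (rule expansion_cong[of c]) (use c less that in auto)
  have "(LEAST j. num_orig (expansion \<tau> ((!) ?r) j) = length ?r) = k"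
  proof (rule Least_equality)
    show "num_orig (expansion \<tau> ((!) ?r) k) = length ?r" using eq[of k] assms(2) by simp
    fix j assume j: "num_orig (expansion \<tau> ((!) ?r) j) = length ?r"
    show "k \<le> j"
    proof (rule ccontr)
      assume "\<not> k \<le> j"
      then show False using eq[of j] less[of j] j by simp
    qed
  qed
  moreover have "last ?r = \<rho> (c - 1)" using c by (simp add: last_map)
  ultimately show ?thesis using assms(3) eq[of k] by (simp add: parity_strategy_def Let_def)
qed

text \<open>A play consistent with \<open>parity_strategy\<close> expands to one consistent with
  \<open>\<tau>\<close> in which Adam obeys the rule on his odd loops. \<open>\<tau>\<close> wins
  it, but with an odd minimum this obedience would make it lost for Eve.\<close>

lemma parity_wins_if_red_wins:
  assumes "imp_eve_wins H"
  shows "pg_eve_wins G"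
proof -
  obtain \<tau> where legal: "legal_strategy (ig_edge_set H) (ig_eve_vertices H) \<tau>"
    and win: "\<And>\<pi>. hplay \<pi> \<Longrightarrow> consistent_with (ig_eve_vertices H) \<tau> \<pi> \<Longrightarrow> imp_winning H \<pi>"
    using assms unfolding imp_eve_wins_def eve_wins_def ig_init_red hplay_def by blast
  have "parity_winning G \<rho>" if play: "is_play (set es) (pg_init G) \<rho>"
    and con: "consistent_with (pg_eve_vertices G) (parity_strategy \<tau>) \<rho>" for \<rho>
  proof -
    define \<pi> where "\<pi> = (\<lambda>k. last (expansion \<tau> \<rho> k))"
    have hist: "expansion \<tau> \<rho> k = map \<pi> [0..<Suc k]" for k unfolding \<pi>_def by (rule expansion_play)
    have last: "last (map \<pi> [0..<Suc k]) = \<pi> k" for k by simp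
    have edge: "(\<rho> j, \<rho> (Suc j)) \<in> set es" for j using play by (simp add: is_play_def)
    have range: "\<rho> j < n" for j using edge[of j] wf by (auto simp: wf_pg_def)
    have num: "num_orig (expansion \<tau> \<rho> k) = visits \<pi> (Suc k)" for k
    proof -
      have "length (filter (\<lambda>x. x < n) (map \<pi> [0..<l])) = visits \<pi> l" for l by (induction l) auto
      then show ?thesis unfolding hist .
    qed
    have next_move: "\<pi> (Suc k) = advance \<tau> (map \<pi> [0..<Suc k]) (\<rho> (visits \<pi> (Suc k)))" for k
    proof -
      have "\<pi> (Suc k) = advance \<tau> (expansion \<tau> \<rho> k) (\<rho> (num_orig (expansion \<tau> \<rho> k)))" by (simp add: \<pi>_def)
      then show ?thesis unfolding num unfolding hist .
    qed
    have tau_edge: "(\<pi> k, \<tau> (map \<pi> [0..<Suc k])) \<in> ig_edge_set H" if "\<pi> k \<in> ig_eve_vertices H" for k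
      using legal[unfolded legal_strategy_def, rule_format, of "map \<pi> [0..<Suc k]", unfolded last] that by simp
    \<comment> \<open>At an edge vertex \<open>visits\<close> already counts the source, so its edge
      leads from index \<open>visits - 1\<close> to index \<open>visits\<close>. At Adam's vertices
      this is built into \<open>advance\<close>; at Eve's it follows from the consistency of
      \<open>\<rho>\<close>.\<close>
    have inv: "(\<pi> k < n \<longrightarrow> \<pi> k = \<rho> (visits \<pi> k)) \<and>
      (n \<le> \<pi> k \<longrightarrow> \<pi> k < n + m \<and> 0 < visits \<pi> k \<and> es ! (\<pi> k - n) = (\<rho> (visits \<pi> k - 1), \<rho> (visits \<pi> k)))" for k
    proof (induction k)
      case 0
      show ?case using range[of 0] by (simp add: \<pi>_def)
    next
      case (Suc k)
      show ?case
      proof (cases "\<pi> k < n")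
        case True
        define c where "c = visits \<pi> k"
        have c: "visits \<pi> (Suc k) = Suc c" "\<pi> k = \<rho> c" using True Suc by (simp_all add: c_def)
        have e: "(\<pi> k, \<rho> (Suc c)) \<in> set es" using edge[of c] c(2) by simp
        have "\<exists>i < m. \<pi> (Suc k) = n + i \<and> es ! i = (\<pi> k, \<rho> (Suc c))"
        proof (cases "\<pi> k \<in> ig_eve_vertices H")
          case False
          then have "\<pi> (Suc k) = n + (SOME i. i < m \<and> es ! i = (\<pi> k, \<rho> (Suc c)))"
            using next_move[of k] True unfolding advance_def last c(1) by simp
          then show ?thesis using edge_index[OF e] by blast
        next
          case eve: True
          then have t: "\<pi> (Suc k) = \<tau> (expansion \<tau> \<rho> k)"
            using next_move[of k] unfolding advance_def last hist by simp
          then have "(\<pi> k, \<pi> (Suc k)) \<in> ig_edge_set H" using tau_edge[OF eve] unfolding hist by simp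
          then have y: "n \<le> \<pi> (Suc k)" "\<pi> (Suc k) < n + m" "src (\<pi> (Suc k)) = \<pi> k"
            using True by (auto elim: red_edge_cases)
          then have i: "\<pi> (Suc k) - n < m" "es ! (\<pi> (Suc k) - n) = (\<pi> k, tgt (\<pi> (Suc k)))" by (auto simp: prod_eq_iff)
          \<comment> \<open>That the answer is an edge rules out the fallback in
            \<open>parity_strategy\<close>.\<close>
          then have "(\<pi> k, tgt (\<pi> (Suc k))) \<in> set es" by (metis nth_mem)
          then have "parity_strategy \<tau> (map \<rho> [0..<Suc c]) = tgt (\<tau> (expansion \<tau> \<rho> k))"
            using True c num[of k] unfolding t by (intro parity_strategy_eq) (simp_all add: \<pi>_def)
          moreover have "\<rho> c \<in> pg_eve_vertices G" using eve red_eve_orig[OF True] c(2) by simp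
          then have "\<rho> (Suc c) = parity_strategy \<tau> (map \<rho> [0..<Suc c])"
            using con unfolding consistent_with_def by blast
          ultimately have "\<rho> (Suc c) = tgt (\<pi> (Suc k))" using t by simp
          then show ?thesis using i y by (intro exI[of _ "\<pi> (Suc k) - n"]) simp
        qed
        then obtain i where "i < m" "\<pi> (Suc k) = n + i" "es ! i = (\<rho> c, \<rho> (Suc c))" unfolding c(2) by blast
        then show ?thesis unfolding c(1) by simp
      next
        case False
        then have x: "n \<le> \<pi> k" "\<pi> k < n + m" "0 < visits \<pi> k" "es ! (\<pi> k - n) = (\<rho> (visits \<pi> k - 1), \<rho> (visits \<pi> k))"
          using Suc by auto
        have "\<pi> (Suc k) = \<pi> k \<or> \<pi> (Suc k) = tgt (\<pi> k)"
        proof (cases "\<pi> k \<in> ig_eve_vertices H")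
          case True
          then have "(\<pi> k, \<pi> (Suc k)) \<in> ig_edge_set H"
            using tau_edge[OF True] next_move[of k] unfolding advance_def last by simp
          then show ?thesis using False by (auto elim: red_edge_cases)
        next
          case nEve: False
          then show ?thesis using next_move[of k] False unfolding advance_def last by (auto split: if_splits)
        qed
        moreover have "visits \<pi> (Suc k) = visits \<pi> k" using False by simp
        moreover have "tgt (\<pi> k) = \<rho> (visits \<pi> k)" using x(4) by simp
        ultimately show ?thesis using x range[of "visits \<pi> k"] by auto
      qed
    qed
    have "hplay \<pi>" unfolding hplay_def is_play_def
    proof (intro conjI allI)
      show "\<pi> 0 = pg_init G" using play by (simp add: \<pi>_def is_play_def)
      fix k
      show "(\<pi> k, \<pi> (Suc k)) \<in> ig_edge_set H"
      proof (cases "\<pi> k \<in> ig_eve_vertices H")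
        case True
        then show ?thesis using tau_edge[OF True] next_move[of k] unfolding advance_def last by simp
      next
        case nEve: False
        show ?thesis
        proof (cases "\<pi> k < n")
          case True
          define v where "v = \<rho> (visits \<pi> (Suc k))"
          define i where "i = (SOME i. i < m \<and> es ! i = (\<pi> k, v))"
          have "(\<pi> k, v) \<in> set es" unfolding v_def using inv[of k] True edge[of "visits \<pi> k"] by simp
          then have "i < m" "es ! i = (\<pi> k, v)" using edge_index unfolding i_def by blast+
          moreover have "\<pi> (Suc k) = n + i"
            using next_move[of k] True nEve unfolding advance_def last i_def v_def by simp
          ultimately show ?thesis unfolding red_edge_set_iff by (intro disjI1 exI[of _ i]) simp
        next
          case False
          then have "\<pi> (Suc k) = \<pi> k \<or> \<pi> (Suc k) = tgt (\<pi> k)"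
            using next_move[of k] nEve unfolding advance_def last by (auto split: if_splits)
          then show ?thesis unfolding red_edge_set_iff using inv[of k] False
            by (intro disjI2 exI[of _ "\<pi> k - n"]) auto
        qed
      qed
    qed
    note hp = this
    have "consistent_with (ig_eve_vertices H) \<tau> \<pi>" unfolding consistent_with_def
      using next_move unfolding advance_def last by simp
    then have imp: "imp_winning H \<pi>" by (rule win[OF hp])
    have spin: "\<pi> (Suc k) = \<pi> k \<longleftrightarrow> keeps_spinning (map \<pi> [0..<Suc k])" if "n \<le> \<pi> k" "odd (col (\<pi> k))" for k
    proof -
      have k: "\<pi> k < n + m" using inv[of k] that by simp
      then have "\<pi> (Suc k) = (if keeps_spinning (map \<pi> [0..<Suc k]) then \<pi> k else tgt (\<pi> k))"
        using next_move[of k] that red_eve_edge[of "\<pi> k"] unfolding advance_def last by simp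
      moreover have "tgt (\<pi> k) < n" using edge_less(2)[of "\<pi> k - n"] k that by simp
      ultimately show ?thesis using that by auto
    qed
    \<comment> \<open>When stuck, winning would require an odd value, hence a loop of Adam; but by
      the rule he leaves his loops.\<close>
    have inf: "infinite (orig_times \<pi>)"
    proof
      assume fin: "finite (orig_times \<pi>)"
      obtain K x where x: "n \<le> x" "x < n + m" "\<And>k. k \<ge> K \<Longrightarrow> \<pi> k = x" "lim_inf_mp H \<pi> = ereal (real (col x))"
        using stuck[OF hp fin] by metis
      have odd: "odd (col x)"
        using imp colour_in_interval_iff[OF colour_le] unfolding imp_winning_def x(4) by auto
      have "keeps_spinning (map \<pi> [0..<Suc k])" if "k \<ge> K" for k
        using spin[of k] x(3)[of k] x(3)[of "Suc k"] that x(1) odd by (simp del: upt_Suc)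
      then show False using not_always_spinning[OF hp x(1), of K] x(3) by blast
    qed
    have proj: "projects \<pi> \<rho>" unfolding projects_def using inv by blast
    show ?thesis
    proof (rule ccontr)
      assume "\<not> ?thesis"
      then have odd: "odd (Min {p. infinite {j. pg_prio G ! \<rho> j = p}})" by (simp add: parity_winning_def)
      then show False using liminf_projection[OF hp inf proj range] spin imp by blast
    qed
  qed
  then show ?thesis unfolding pg_eve_wins_def eve_wins_def using legal_parity_strategy by blast
qed

end

section \<open>The reduction\<close>

text \<open>The empty word encodes no game, so it is a safe image for malformed input.\<close>

definition reduce :: "bool list \<Rightarrow> bool list" where
  "reduce w = (if unparse (parse w) = w \<and> valid_raw (parse w) then raw_red (parse w) else [])"

lemma poly_time_reduce: "poly_time_computable reduce"
  by (rule poly_time_computable_if_pt, unfold reduce_def)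
    (intro pt_if pt_conj pt_eq_bits pt_id pt_const pt_comp[OF pt_unparse] pt_comp[OF pt_valid_raw]
      pt_comp[OF pt_raw_red] pt_parse)

lemma reduce_enc_pg: "wf_pg G \<Longrightarrow> reduce (enc_pg G) = enc_imp_unary (red G)"
  by (simp add: reduce_def parse_enc_pg enc_pg_conv[symmetric] valid_raw_of raw_red_raw_of)

lemma reduce_cases:
  obtains G where "wf_pg G" "w = enc_pg G" | "reduce w = []"
proof (cases "unparse (parse w) = w \<and> valid_raw (parse w)")
  case True
  then show thesis using that(1)[of "game_of (parse w)"] enc_pg_game_of valid_raw_iff by metis
qed (use that in \<open>auto simp: reduce_def\<close>)

lemma enc_pg_inject: "wf_pg G \<Longrightarrow> wf_pg G' \<Longrightarrow> enc_pg G = enc_pg G' \<Longrightarrow> G = G'"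
  by (metis game_of_raw_of parse_enc_pg)

lemma enc_imp_unary_ne_Nil: "enc_imp_unary H \<noteq> []"
proof -
  have "enc_digits ds \<noteq> []" for ds by (cases ds) auto
  then show ?thesis unfolding enc_imp_unary_def enc_bin_conv_digits by blast
qed

lemma enc_pg_in_PARITY_iff: "wf_pg G \<Longrightarrow> enc_pg G \<in> PARITY \<longleftrightarrow> pg_eve_wins G"
  unfolding PARITY_def using enc_pg_inject by blast

lemma enc_imp_in_UNARY_IMP_iff: "wf_imp H \<Longrightarrow> enc_imp_unary H \<in> UNARY_IMP \<longleftrightarrow> imp_eve_wins H"
  unfolding UNARY_IMP_def using enc_imp_unary_inject by blast

theorem mainTheorem5:
  shows "poly_time_reduces PARITY UNARY_IMP"
  unfolding poly_time_reduces_def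
proof (intro exI[of _ reduce] conjI allI poly_time_reduce)
  fix w
  show "w \<in> PARITY \<longleftrightarrow> reduce w \<in> UNARY_IMP"
  proof (cases w rule: reduce_cases)
    case (1 G)
    then interpret reduction G by unfold_locales
    show ?thesis
      using 1 red_wins_if_parity_wins parity_wins_if_red_wins
      by (auto simp: reduce_enc_pg enc_pg_in_PARITY_iff enc_imp_in_UNARY_IMP_iff[OF wf_red])
  next
    case 2
    have "w \<notin> PARITY"
    proof
      assume "w \<in> PARITY"
      then obtain G where "wf_pg G" "w = enc_pg G" unfolding PARITY_def by blast
      then show False using 2 reduce_enc_pg enc_imp_unary_ne_Nil by metis
    qed
    moreover have "reduce w \<notin> UNARY_IMP"
    proof
      assume "reduce w \<in> UNARY_IMP"
      then obtain H where "reduce w = enc_imp_unary H" unfolding UNARY_IMP_def by blast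
      then show False using 2 enc_imp_unary_ne_Nil by metis
    qed
    ultimately show ?thesis by simp
  qed
qed

end
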